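(* Let $V$ be a real vector space of even dimension $m\ge 4$, and let $(V,\langle\cdot,\cdot\rangle,J_\pm,A)$ be a (para)-Kähler Weyl curvature model. Then it is geometrically realizable by a (para)-Kähler Weyl manifold; that is, there exist a (para)-Kähler Weyl manifold $(M,g,J^M_\pm,\nabla)$ of dimension $m$ (with $J^M_\pm$ of the same type, complex or para-complex, as $J_\pm$), a point $P\in M$, and a linear isomorphism $\Phi:V\to T_PM$ such that $$\Phi^*g_P=\langle\cdot,\cdot\rangle,\qquad J^M_{\pm}(P)\circ\Phi=\Phi\circ J_\pm,\qquad \Phi^*R^\nabla_P=A,$$ where $R^\nabla(x,y,z,w)=g(R^\nabla(x,y)z,w)$ is the curvature tensor of $\nabla$.
   Context: Sign convention: the complex case ($J_-$, always lower signs) and the para-complex case ($J_+$, always upper signs) are treated simultaneously but never mixed. All inner products are non-degenerate symmetric bilinear forms of arbitrary signature. Algebraic notions. Let $V$ be a real vector space of even dimension $m$. A complex structure on $V$ is $J_-\in\operatorname{End}(V)$ with $J_-^2=-\operatorname{Id}$; a para-complex structure is $J_+\in\operatorname{End}(V)$ with $J_+^2=\operatorname{Id}$ and $\operatorname{Tr}(J_+)=0$. Let $\langle\cdot,\cdot\rangle$ be an inner product on $V$. For $A\in\otimes^4V^*$, define the operator $\hat A$ by $\langle\hat A(x,y)z,w\rangle=A(x,y,z,w)$, and set $\rho(x,y):=\operatorname{Tr}(z\mapsto\hat A(z,x)y)$, $\rho_a(x,y):=\frac12\{\rho(x,y)-\rho(y,x)\}$. The space $\mathfrak{W}=\mathfrak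 W(V)$ of Weyl algebraic curvature tensors consists of all $A\in\otimes^4V^*$ such that for all $x,y,z,w\in V$: (i) $A(x,y,z,w)+A(y,x,z,w)=0$; (ii) $A(x,y,z,w)+A(y,z,x,w)+A(z,x,y,w)=0$; (iii) $A(x,y,z,w)+A(x,y,w,z)=-\frac4m\rho_a(x,y)\langle z,w\rangle$. Set $\mathfrak{K}_\pm:=\{A\in\otimes^4V^*: A(x,y,z,w)=\mp A(x,y,J_\pm z,J_\pm w)\ \forall x,y,z,w\}$ and $\mathfrak{K}_{\pm,\mathfrak W}:=\mathfrak K_\pm\cap\mathfrak W$. A (para)-Kähler Weyl curvature model is a quadruple $(V,\langle\cdot,\cdot\rangle,J_\pm,A)$ where $J_\pm$ is a (para)-complex structure on $V$, $\langle J_\pm x,J_\pm y\rangle=\mp\langle x,y\rangle$ for all $x,y$, and $A\in\mathfrak K_{\pm,\mathfrak W}$. Geometric notions. A Weyl manifold $(M,g,\nabla)$ is a pseudo-Riemannian manifold $(M,g)$ with a torsion free connection $\nabla$ on $TM$ such that $\nabla g=-2\phi\otimes g$ for some smooth $1$-form $\phi$ on $M$. A (para)-complex manifold $(M,J_\pm)$ of dimension $m=2\bar m$ is a manifold with a smooth endomorphism $J_\pm$ of $TM$ that is a (para)-complex structure on each tangent space and is integrable, i.e. $M$ is covered by coordinate charts $(x^1,y^1,\dots,x^{\bar m},y^{\bar m})$ in which $J_\pm\partial_{x_i}=\partial_{y_i}$ and $J_\pm\partial_{y_i}=\pm\partial_{x_i}$ for $1\le i\le\bar m$. A (para)-Kähler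 Weyl manifold $(M,g,J_\pm,\nabla)$ is a Weyl manifold $(M,g,\nabla)$ with a (para)-complex manifold structure $(M,J_\pm)$ such that $g(J_\pm x,J_\pm y)=\mp g(x,y)$ and $\nabla J_\pm=0$. *)

theory Defs
  imports "HOL-Analysis.Analysis" "HOL-Library.Function_Algebras"
begin

section \<open>Linear algebra\<close>

text \<open>Functions into a real vector space form a real vector space under the pointwise operations.
  It is used for tangent vectors, which are encoded below as functions on an atlas.\<close>

instantiation "fun" :: (type, real_vector) real_vector
begin

definition scaleR_fun :: "real \<Rightarrow> ('a \<Rightarrow> 'b) \<Rightarrow> 'a \<Rightarrow> 'b"
  where "scaleR_fun r f = (\<lambda>x. r *\<^sub>R f x)"

instance
  by standard (simp_all add: scaleR_fun_def fun_eq_iff scaleR_add_right scaleR_add_left)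

end

lemma scaleR_fun_apply [simp]: "(r *\<^sub>R f) x = r *\<^sub>R f x"
  by (simp add: scaleR_fun_def)

text \<open>The notions below are relative to a linear subspace \<open>S\<close>, so that they apply both to a vector
  space given as a type (\<open>S = UNIV\<close>) and to a tangent space.\<close>

definition linear_on :: "'a::real_vector set \<Rightarrow> ('a \<Rightarrow> 'b::real_vector) \<Rightarrow> bool"
  where "linear_on S f \<longleftrightarrow>
    (\<forall>x\<in>S. \<forall>y\<in>S. f (x + y) = f x + f y) \<and> (\<forall>r. \<forall>x\<in>S. f (r *\<^sub>R x) = r *\<^sub>R f x)"

definition endomorphism_on :: "'a::real_vector set \<Rightarrow> ('a \<Rightarrow> 'a) \<Rightarrow> bool"
  where "endomorphism_on S f \<longleftrightarrow> linear_on S f \<and> (\<forall>x\<in>S. f x \<in> S)"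

text \<open>Trace of an endomorphism of a finite-dimensional subspace; the value does not depend on the
  chosen basis.\<close>

definition trace_on :: "'a::real_vector set \<Rightarrow> ('a \<Rightarrow> 'a) \<Rightarrow> real"
  where "trace_on S f =
    (let B = (SOME B. independent B \<and> span B = S) in \<Sum>b\<in>B. representation B (f b) b)"

definition inner_product_on :: "'a::real_vector set \<Rightarrow> ('a \<Rightarrow> 'a \<Rightarrow> real) \<Rightarrow> bool"
  where "inner_product_on S b \<longleftrightarrow>
    (\<forall>x\<in>S. linear_on S (b x)) \<and>
    (\<forall>x\<in>S. \<forall>y\<in>S. b x y = b y x) \<and>
    (\<forall>x\<in>S. (\<forall>y\<in>S. b x y = 0) \<longrightarrow> x = 0)"

text \<open>\<open>Cplx\<close> corresponds to the lower signs, \<open>ParaCplx\<close> to the upper signs, and \<open>sgn_of k\<close> is the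
  value of the sign written \<open>\<plusminus>\<close> (so that \<open>\<mp>\<close> is \<open>- sgn_of k\<close>).\<close>

datatype kind = Cplx | ParaCplx

fun sgn_of :: "kind \<Rightarrow> real"
  where
    "sgn_of Cplx = - 1"
  | "sgn_of ParaCplx = 1"

definition complex_structure_on :: "kind \<Rightarrow> 'a::real_vector set \<Rightarrow> ('a \<Rightarrow> 'a) \<Rightarrow> bool"
  where "complex_structure_on k S J \<longleftrightarrow>
    endomorphism_on S J \<and>
    (\<forall>x\<in>S. J (J x) = sgn_of k *\<^sub>R x) \<and>
    (k = ParaCplx \<longrightarrow> trace_on S J = 0)"

definition hermitian_on :: "kind \<Rightarrow> 'a set \<Rightarrow> ('a \<Rightarrow> 'a \<Rightarrow> real) \<Rightarrow> ('a \<Rightarrow> 'a) \<Rightarrow> bool"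
  where "hermitian_on k S b J \<longleftrightarrow> (\<forall>x\<in>S. \<forall>y\<in>S. b (J x) (J y) = - sgn_of k * b x y)"


section \<open>Curvature models\<close>

type_synonym 'v tensor4 = "'v \<Rightarrow> 'v \<Rightarrow> 'v \<Rightarrow> 'v \<Rightarrow> real"

definition multilinear4 :: "'v::real_vector tensor4 \<Rightarrow> bool"
  where "multilinear4 A \<longleftrightarrow>
    (\<forall>x y z. linear (\<lambda>w. A x y z w)) \<and> (\<forall>x y w. linear (\<lambda>z. A x y z w)) \<and>
    (\<forall>x z w. linear (\<lambda>y. A x y z w)) \<and> (\<forall>y z w. linear (\<lambda>x. A x y z w))"

definition curv_op :: "('v \<Rightarrow> 'v \<Rightarrow> real) \<Rightarrow> 'v::real_vector tensor4 \<Rightarrow> 'v \<Rightarrow> 'v \<Rightarrow> 'v \<Rightarrow> 'v"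
  where "curv_op b A x y z = (THE u. \<forall>w. b u w = A x y z w)"

definition ricci :: "('v \<Rightarrow> 'v \<Rightarrow> real) \<Rightarrow> 'v::real_vector tensor4 \<Rightarrow> 'v \<Rightarrow> 'v \<Rightarrow> real"
  where "ricci b A x y = trace_on UNIV (\<lambda>z. curv_op b A z x y)"

definition ricci_alt :: "('v \<Rightarrow> 'v \<Rightarrow> real) \<Rightarrow> 'v::real_vector tensor4 \<Rightarrow> 'v \<Rightarrow> 'v \<Rightarrow> real"
  where "ricci_alt b A x y = 1 / 2 * (ricci b A x y - ricci b A y x)"

definition weyl_tensors :: "('v \<Rightarrow> 'v \<Rightarrow> real) \<Rightarrow> 'v::real_vector tensor4 set"
  where "weyl_tensors b = {A. multilinear4 A \<and>
    (\<forall>x y z w. A x y z w + A y x z w = 0) \<and>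
    (\<forall>x y z w. A x y z w + A y z x w + A z x y w = 0) \<and>
    (\<forall>x y z w. A x y z w + A x y w z =
        - (4 / real (dim (UNIV :: 'v set))) * ricci_alt b A x y * b z w)}"

definition kaehler_tensors :: "kind \<Rightarrow> ('v \<Rightarrow> 'v) \<Rightarrow> 'v::real_vector tensor4 set"
  where "kaehler_tensors k J =
    {A. multilinear4 A \<and> (\<forall>x y z w. A x y z w = - sgn_of k * A x y (J z) (J w))}"

definition kaehler_weyl_model ::
    "kind \<Rightarrow> ('v \<Rightarrow> 'v \<Rightarrow> real) \<Rightarrow> ('v \<Rightarrow> 'v) \<Rightarrow> 'v::real_vector tensor4 \<Rightarrow> bool"
  where "kaehler_weyl_model k b J A \<longleftrightarrow>
    inner_product_on UNIV b \<and>
    complex_structure_on k UNIV J \<and>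
    hermitian_on k UNIV b J \<and>
    A \<in> kaehler_tensors k J \<inter> weyl_tensors b"


section \<open>Smooth manifolds\<close>

text \<open>For an open subset \<open>S\<close> of a finite-dimensional space, \<open>Ck_on n S f\<close> says that \<open>f\<close> is of class
  \<open>C\<^sup>n\<close> on \<open>S\<close>: all iterated directional derivatives up to order \<open>n\<close> exist and are continuous.\<close>

fun Ck_on :: "nat \<Rightarrow> 'a::real_normed_vector set \<Rightarrow> ('a \<Rightarrow> 'b::real_normed_vector) \<Rightarrow> bool"
  where
    "Ck_on 0 S f \<longleftrightarrow> continuous_on S f"
  | "Ck_on (Suc n) S f \<longleftrightarrow>
      (\<forall>x\<in>S. f differentiable (at x)) \<and> (\<forall>v. Ck_on n S (\<lambda>x. frechet_derivative f (at x) v))"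

definition smooth_on :: "'a::real_normed_vector set \<Rightarrow> ('a \<Rightarrow> 'b::real_normed_vector) \<Rightarrow> bool"
  where "smooth_on S f \<longleftrightarrow> (\<forall>n. Ck_on n S f)"

text \<open>A chart is a pair of a domain and a map; only the values of the map on the domain matter.
  The atlas need not be maximal.\<close>

type_synonym ('p, 'e) chart = "'p set \<times> ('p \<Rightarrow> 'e)"

record ('p, 'e) mfd =
  mtop :: "'p topology"
  matlas :: "('p, 'e) chart set"

abbreviation pts :: "('p, 'e) mfd \<Rightarrow> 'p set"
  where "pts M \<equiv> topspace (mtop M)"

abbreviation cdom :: "('p, 'e) chart \<Rightarrow> 'p set"
  where "cdom c \<equiv> fst c"

abbreviation cmap :: "('p, 'e) chart \<Rightarrow> 'p \<Rightarrow> 'e"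
  where "cmap c \<equiv> snd c"

definition cinv :: "('p, 'e) chart \<Rightarrow> 'e \<Rightarrow> 'p"
  where "cinv c = inv_into (cdom c) (cmap c)"

definition chart_on :: "'p topology \<Rightarrow> ('p, 'e::euclidean_space) chart \<Rightarrow> bool"
  where "chart_on T c \<longleftrightarrow>
    openin T (cdom c) \<and> open (cmap c ` cdom c) \<and>
    homeomorphic_map (subtopology T (cdom c)) (top_of_set (cmap c ` cdom c)) (cmap c)"

definition compatible :: "('p, 'e::euclidean_space) chart \<Rightarrow> ('p, 'e) chart \<Rightarrow> bool"
  where "compatible c d \<longleftrightarrow>
    smooth_on (cmap c ` (cdom c \<inter> cdom d)) (cmap d \<circ> cinv c) \<and>
    smooth_on (cmap d ` (cdom c \<inter> cdom d)) (cmap c \<circ> cinv d)"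

definition smooth_manifold :: "('p, 'e::euclidean_space) mfd \<Rightarrow> bool"
  where "smooth_manifold M \<longleftrightarrow>
    Hausdorff_space (mtop M) \<and> second_countable (mtop M) \<and>
    (\<forall>c\<in>matlas M. chart_on (mtop M) c) \<and>
    (\<forall>c\<in>matlas M. \<forall>d\<in>matlas M. compatible c d) \<and>
    pts M = (\<Union>c\<in>matlas M. cdom c)"

definition charts_at :: "('p, 'e) mfd \<Rightarrow> 'p \<Rightarrow> ('p, 'e) chart set"
  where "charts_at M p = {c \<in> matlas M. p \<in> cdom c}"

text \<open>A tangent vector at \<open>p\<close> is a family of coordinate vectors, one for each chart of the atlas
  around \<open>p\<close>, that transforms by the Jacobians of the coordinate changes. The components at the
  other charts are set to zero, which makes the tangent space a linear subspace of a function space;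
  it is \<open>{0}\<close> if \<open>p\<close> is not a point of \<open>M\<close>.\<close>

type_synonym ('p, 'e) tvec = "('p, 'e) chart \<Rightarrow> 'e"

definition tangent_space :: "('p, 'e::euclidean_space) mfd \<Rightarrow> 'p \<Rightarrow> ('p, 'e) tvec set"
  where "tangent_space M p = {v.
    (\<forall>c\<in>charts_at M p. \<forall>d\<in>charts_at M p.
        v d = frechet_derivative (cmap d \<circ> cinv c) (at (cmap c p)) (v c)) \<and>
    (\<forall>c. c \<notin> charts_at M p \<longrightarrow> v c = 0)}"

definition smooth_functions :: "('p, 'e::euclidean_space) mfd \<Rightarrow> ('p \<Rightarrow> real) set"
  where "smooth_functions M =
    {f. \<forall>c\<in>matlas M. smooth_on (cmap c ` cdom c) (f \<circ> cinv c)}"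

text \<open>The differential of \<open>f\<close> at \<open>p\<close> applied to \<open>v\<close>, which can be computed in any chart around
  \<open>p\<close>.\<close>

definition tangent_deriv ::
    "('p, 'e::euclidean_space) mfd \<Rightarrow> 'p \<Rightarrow> ('p, 'e) tvec \<Rightarrow> ('p \<Rightarrow> 'b::real_normed_vector) \<Rightarrow> 'b"
  where "tangent_deriv M p v f =
    (let c = (SOME c. c \<in> charts_at M p)
     in frechet_derivative (f \<circ> cinv c) (at (cmap c p)) (v c))"

type_synonym ('p, 'e) vfield = "'p \<Rightarrow> ('p, 'e) tvec"

definition vector_fields :: "('p, 'e::euclidean_space) mfd \<Rightarrow> ('p, 'e) vfield set"
  where "vector_fields M = {X.
    (\<forall>p. X p \<in> tangent_space M p) \<and>
    (\<forall>c\<in>matlas M. smooth_on (cmap c ` cdom c) (\<lambda>x. X (cinv c x) c))}"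

definition fscale :: "('p \<Rightarrow> real) \<Rightarrow> ('p, 'e::euclidean_space) vfield \<Rightarrow> ('p, 'e) vfield"
  where "fscale f X = (\<lambda>p. f p *\<^sub>R X p)"

text \<open>In a chart, \<open>[X, Y]\<^sup>i = X\<^sup>j \<partial>\<^sub>j Y\<^sup>i - Y\<^sup>j \<partial>\<^sub>j X\<^sup>i\<close>.\<close>

definition lie_bracket ::
    "('p, 'e::euclidean_space) mfd \<Rightarrow> ('p, 'e) vfield \<Rightarrow> ('p, 'e) vfield \<Rightarrow> ('p, 'e) vfield"
  where "lie_bracket M X Y = (\<lambda>p c.
    if c \<in> charts_at M p
    then frechet_derivative (\<lambda>x. Y (cinv c x) c) (at (cmap c p)) (X p c)
       - frechet_derivative (\<lambda>x. X (cinv c x) c) (at (cmap c p)) (Y p c)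
    else 0)"


section \<open>Tensor fields and connections\<close>

text \<open>A field of multilinear maps on tangent spaces is smooth if it takes smooth vector fields to
  smooth functions or smooth vector fields.\<close>

definition smooth_one_form ::
    "('p, 'e::euclidean_space) mfd \<Rightarrow> ('p \<Rightarrow> ('p, 'e) tvec \<Rightarrow> real) \<Rightarrow> bool"
  where "smooth_one_form M \<phi> \<longleftrightarrow>
    (\<forall>p\<in>pts M. linear_on (tangent_space M p) (\<phi> p)) \<and>
    (\<forall>X\<in>vector_fields M. (\<lambda>p. \<phi> p (X p)) \<in> smooth_functions M)"

type_synonym ('p, 'e) metric_field = "'p \<Rightarrow> ('p, 'e) tvec \<Rightarrow> ('p, 'e) tvec \<Rightarrow> real"

definition pseudo_riemannian ::
    "('p, 'e::euclidean_space) mfd \<Rightarrow> ('p, 'e) metric_field \<Rightarrow> bool"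
  where "pseudo_riemannian M g \<longleftrightarrow>
    smooth_manifold M \<and>
    (\<forall>p\<in>pts M. inner_product_on (tangent_space M p) (g p)) \<and>
    (\<forall>X\<in>vector_fields M. \<forall>Y\<in>vector_fields M. (\<lambda>p. g p (X p) (Y p)) \<in> smooth_functions M)"

type_synonym ('p, 'e) endo_field = "'p \<Rightarrow> ('p, 'e) tvec \<Rightarrow> ('p, 'e) tvec"

definition endo_apply ::
    "('p, 'e::euclidean_space) mfd \<Rightarrow> ('p, 'e) endo_field \<Rightarrow> ('p, 'e) vfield \<Rightarrow> ('p, 'e) vfield"
  where "endo_apply M J X = (\<lambda>p. if p \<in> pts M then J p (X p) else 0)"

definition smooth_endo_field ::
    "('p, 'e::euclidean_space) mfd \<Rightarrow> ('p, 'e) endo_field \<Rightarrow> bool"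
  where "smooth_endo_field M J \<longleftrightarrow>
    (\<forall>p\<in>pts M. endomorphism_on (tangent_space M p) (J p)) \<and>
    (\<forall>X\<in>vector_fields M. endo_apply M J X \<in> vector_fields M)"

type_synonym ('p, 'e) conn = "('p, 'e) vfield \<Rightarrow> ('p, 'e) vfield \<Rightarrow> ('p, 'e) vfield"

text \<open>\<open>D X Y\<close> is the covariant derivative of \<open>Y\<close> in the direction \<open>X\<close>.\<close>

definition connection :: "('p, 'e::euclidean_space) mfd \<Rightarrow> ('p, 'e) conn \<Rightarrow> bool"
  where "connection M D \<longleftrightarrow>
    (\<forall>X\<in>vector_fields M. \<forall>Y\<in>vector_fields M. D X Y \<in> vector_fields M) \<and>
    (\<forall>X\<in>vector_fields M. \<forall>X'\<in>vector_fields M. \<forall>Y\<in>vector_fields M.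
        D (X + X') Y = D X Y + D X' Y) \<and>
    (\<forall>f\<in>smooth_functions M. \<forall>X\<in>vector_fields M. \<forall>Y\<in>vector_fields M.
        D (fscale f X) Y = fscale f (D X Y)) \<and>
    (\<forall>X\<in>vector_fields M. \<forall>Y\<in>vector_fields M. \<forall>Y'\<in>vector_fields M.
        D X (Y + Y') = D X Y + D X Y') \<and>
    (\<forall>f\<in>smooth_functions M. \<forall>X\<in>vector_fields M. \<forall>Y\<in>vector_fields M.
        D X (fscale f Y) = fscale (\<lambda>p. tangent_deriv M p (X p) f) Y + fscale f (D X Y))"

definition torsion_free :: "('p, 'e::euclidean_space) mfd \<Rightarrow> ('p, 'e) conn \<Rightarrow> bool"
  where "torsion_free M D \<longleftrightarrow>
    (\<forall>X\<in>vector_fields M. \<forall>Y\<in>vector_fields M. D X Y - D Y X = lie_bracket M X Y)"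

definition curvature_field ::
    "('p, 'e::euclidean_space) mfd \<Rightarrow> ('p, 'e) conn \<Rightarrow>
      ('p, 'e) vfield \<Rightarrow> ('p, 'e) vfield \<Rightarrow> ('p, 'e) vfield \<Rightarrow> ('p, 'e) vfield"
  where "curvature_field M D X Y Z = D X (D Y Z) - D Y (D X Z) - D (lie_bracket M X Y) Z"

text \<open>The curvature at a point is computed from arbitrary extensions of the tangent vectors to
  smooth vector fields.\<close>

definition vf_extension ::
    "('p, 'e::euclidean_space) mfd \<Rightarrow> 'p \<Rightarrow> ('p, 'e) tvec \<Rightarrow> ('p, 'e) vfield"
  where "vf_extension M p v = (SOME X. X \<in> vector_fields M \<and> X p = v)"

definition curvature_at ::
    "('p, 'e::euclidean_space) mfd \<Rightarrow> ('p, 'e) conn \<Rightarrow> 'p \<Rightarrow>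
      ('p, 'e) tvec \<Rightarrow> ('p, 'e) tvec \<Rightarrow> ('p, 'e) tvec \<Rightarrow> ('p, 'e) tvec"
  where "curvature_at M D p x y z =
    curvature_field M D (vf_extension M p x) (vf_extension M p y) (vf_extension M p z) p"

definition curvature_tensor ::
    "('p, 'e::euclidean_space) mfd \<Rightarrow> ('p, 'e) metric_field \<Rightarrow> ('p, 'e) conn \<Rightarrow> 'p \<Rightarrow>
      ('p, 'e) tvec tensor4"
  where "curvature_tensor M g D p x y z w = g p (curvature_at M D p x y z) w"


section \<open>(Para-)Kaehler Weyl manifolds\<close>

text \<open>The condition on \<open>\<phi>\<close> is \<open>(\<nabla>\<^sub>X g)(Y, Z) = - 2 \<phi>(X) g(Y, Z)\<close>.\<close>

definition weyl_manifold ::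
    "('p, 'e::euclidean_space) mfd \<Rightarrow> ('p, 'e) metric_field \<Rightarrow> ('p, 'e) conn \<Rightarrow> bool"
  where "weyl_manifold M g D \<longleftrightarrow>
    pseudo_riemannian M g \<and> connection M D \<and> torsion_free M D \<and>
    (\<exists>\<phi>. smooth_one_form M \<phi> \<and>
      (\<forall>X\<in>vector_fields M. \<forall>Y\<in>vector_fields M. \<forall>Z\<in>vector_fields M. \<forall>p\<in>pts M.
        tangent_deriv M p (X p) (\<lambda>q. g q (Y q) (Z q)) - g p (D X Y p) (Z p) - g p (Y p) (D X Z p)
        = - 2 * \<phi> p (X p) * g p (Y p) (Z p)))"

text \<open>Coordinates \<open>(x\<^sup>1, y\<^sup>1, \<dots>)\<close> are grouped as a pair \<open>(x, y)\<close>. The map \<open>std_J\<close> sends \<open>\<partial>\<^sub>x\<^sub>i\<close> to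
  \<open>\<partial>\<^sub>y\<^sub>i\<close> and \<open>\<partial>\<^sub>y\<^sub>i\<close> to \<open>\<plusminus>\<partial>\<^sub>x\<^sub>i\<close>.\<close>

definition std_J :: "kind \<Rightarrow> (real ^ 'k) \<times> (real ^ 'k) \<Rightarrow> (real ^ 'k) \<times> (real ^ 'k)"
  where "std_J k = (\<lambda>(a, b). (sgn_of k *\<^sub>R b, a))"

text \<open>The adapted charts are taken from the maximal atlas.\<close>

definition integrable ::
    "kind \<Rightarrow> ('p, (real ^ 'k::finite) \<times> (real ^ 'k)) mfd \<Rightarrow>
      ('p, (real ^ 'k) \<times> (real ^ 'k)) endo_field \<Rightarrow> bool"
  where "integrable k M J \<longleftrightarrow> (\<forall>p\<in>pts M. \<exists>c.
    chart_on (mtop M) c \<and> (\<forall>d\<in>matlas M. compatible c d) \<and> p \<in> cdom c \<and>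
    (\<forall>q\<in>cdom c. \<forall>v\<in>tangent_space M q.
      tangent_deriv M q (J q v) (cmap c) = std_J k (tangent_deriv M q v (cmap c))))"

definition complex_manifold ::
    "kind \<Rightarrow> ('p, (real ^ 'k::finite) \<times> (real ^ 'k)) mfd \<Rightarrow>
      ('p, (real ^ 'k) \<times> (real ^ 'k)) endo_field \<Rightarrow> bool"
  where "complex_manifold k M J \<longleftrightarrow>
    smooth_manifold M \<and> smooth_endo_field M J \<and>
    (\<forall>p\<in>pts M. complex_structure_on k (tangent_space M p) (J p)) \<and>
    integrable k M J"

definition kaehler_weyl_manifold ::
    "kind \<Rightarrow> ('p, (real ^ 'k::finite) \<times> (real ^ 'k)) mfd \<Rightarrow>
      ('p, (real ^ 'k) \<times> (real ^ 'k)) metric_field \<Rightarrow>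
      ('p, (real ^ 'k) \<times> (real ^ 'k)) endo_field \<Rightarrow>
      ('p, (real ^ 'k) \<times> (real ^ 'k)) conn \<Rightarrow> bool"
  where "kaehler_weyl_manifold k M g J D \<longleftrightarrow>
    weyl_manifold M g D \<and> complex_manifold k M J \<and>
    (\<forall>p\<in>pts M. hermitian_on k (tangent_space M p) (g p) (J p)) \<and>
    (\<forall>X\<in>vector_fields M. \<forall>Y\<in>vector_fields M.
      D X (endo_apply M J Y) = endo_apply M J (D X Y))"

end

theory Submission
  imports Defs
begin

text \<open>Everything happens in a single chart with the constant structure \<open>std_J\<close>. Write
  \<open>A(x,y,z,w) + A(x,y,w,z) = 2 F(x,y) b(z,w)\<close> and let \<open>\<Omega>\<^sub>0(z,w) = b(z, J w)\<close>. The symmetries of \<open>A\<close>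
  force \<open>F \<and> \<Omega>\<^sub>0 = 0\<close>, so \<open>F = 0\<close> if \<open>m \<ge> 6\<close>. A Hermitian metric \<open>g\<close> and a 1-form \<open>\<phi>\<close> define a
  Kaehler Weyl structure as soon as \<open>d\<Omega> + 2 \<phi> \<and> \<Omega> = 0\<close>. We take \<open>g = b + H(p,p;-,-) / 2\<close>
  with \<open>H\<close> the sum of two parts. The first is an explicit expression in \<open>F\<close>, \<open>b\<close> and \<open>J\<close> with
  \<open>d\<Omega> = - F(p,-) \<and> \<Omega>\<^sub>0\<close>; it accounts for the non-Riemannian part of \<open>A\<close>. What is left of \<open>A\<close> is a
  Riemannian Kaehler tensor, and is realized by the usual Kaehler metric in complex normal coordinates,
  which does not change \<open>d\<Omega>\<close>. If \<open>m \<ge> 6\<close> then \<open>\<phi> = 0\<close>; if \<open>m = 4\<close> then wedging with \<open>\<Omega>\<close> is an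
  isomorphism from 1-forms to 3-forms, so that \<open>\<phi>\<close> exists and is \<open>F(p,-) / 2\<close> to first order.\<close>

section \<open>Calculus of smooth functions\<close>

text \<open>The structural equations have to hold on an open set, the curvature only at one point.
  With \<open>g\<close> quadratic in \<open>p\<close> and the endomorphism constant, d\<Omega> is
  exactly linear in \<open>p\<close>, so the equation for \<phi> has no error terms; shrinking the
  chart only serves to keep \<open>g\<close> nondegenerate and, in dimension four, \<Omega> \<and>
  \<Omega> nonzero.

  The normalization of \<phi> comes from commuting covariant derivatives on \<open>g\<close>: the
  part of the curvature symmetric in its last two arguments is d\<phi> times \<open>g\<close>, so
  d\<phi> must be \<open>F\<close> at the origin. The prescribed 3-form is then closed precisely
  because \<open>F\<close> wedged with the Kaehler form of \<open>b\<close> vanishes. A primitive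
  always exists, but it must also be Hermitian to come from a metric, and this shapes the formula
  for the first part of \<open>H\<close>.

  The metric has no linear term and \<phi> vanishes at the origin, hence so do the Christoffel
  symbols. The curvature there is linear in \<open>H\<close> and \<open>F\<close>, which is why the
  two parts of \<open>A\<close> can be treated separately.\<close>

lemma frechet_derivative_cong_open:
  assumes "open S" "x \<in> S" "\<And>y. y \<in> S \<Longrightarrow> f y = g y"
  shows "frechet_derivative f (at x) = frechet_derivative g (at x)"
proof -
  have "(f has_derivative f') (at x) \<longleftrightarrow> (g has_derivative f') (at x)" for f'
    using has_derivative_transform_within_open[of f f' x UNIV S g]
      has_derivative_transform_within_open[of g f' x UNIV S f] assms by auto
  then show ?thesis
    unfolding frechet_derivative_def by simp
qed

lemma differentiable_cong_open:
  assumes "open S" "x \<in> S" "\<And>y. y \<in> S \<Longrightarrow> f y = g y" "f differentiable (at x)"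
  shows "g differentiable (at x)"
  using assms has_derivative_transform_within_open[of f _ x UNIV S g]
  unfolding differentiable_def by blast

lemma Ck_on_cong_open:
  assumes "open S" "\<And>x. x \<in> S \<Longrightarrow> f x = g x" "Ck_on n S f"
  shows "Ck_on n S g"
  using assms(2,3)
proof (induction n arbitrary: f g)
  case 0
  then show ?case by (simp cong: continuous_on_cong)
next
  case (Suc n)
  have "g differentiable (at x)" if "x \<in> S" for x
    using differentiable_cong_open[OF assms(1) that, of f g] Suc.prems that by simp
  moreover have "Ck_on n S (\<lambda>x. frechet_derivative g (at x) v)" for v
  proof (rule Suc.IH)
    show "frechet_derivative f (at x) v = frechet_derivative g (at x) v" if "x \<in> S" for x
      using frechet_derivative_cong_open[OF assms(1) that, of f g] Suc.prems by simp
    show "Ck_on n S (\<lambda>x. frechet_derivative f (at x) v)"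
      using Suc.prems by simp
  qed
  ultimately show ?case by simp
qed

text \<open>\<open>Ck_on\<close> speaks of \<open>frechet_derivative\<close>, which is defined by
  choice. Once any explicit formula for the derivative is allowed, the closure properties below
  become inductions on the order.\<close>

lemma Ck_on_SucI:
  assumes "open S" "\<And>x. x \<in> S \<Longrightarrow> (f has_derivative f' x) (at x)"
    "\<And>v. Ck_on n S (\<lambda>x. f' x v)"
  shows "Ck_on (Suc n) S f"
proof -
  have "f' x = frechet_derivative f (at x)" if "x \<in> S" for x
    using frechet_derivative_at[OF assms(2)[OF that]] .
  then have "Ck_on n S (\<lambda>x. frechet_derivative f (at x) v)" for v
    by (intro Ck_on_cong_open[OF assms(1) _ assms(3)[of v]]) simp
  then show ?thesis
    using assms(2) by (auto simp: differentiable_def)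
qed

lemma Ck_on_SucD:
  assumes "Ck_on (Suc n) S f" "x \<in> S"
  shows "(f has_derivative frechet_derivative f (at x)) (at x)"
  using assms by (simp add: frechet_derivative_works)

lemma Ck_on_pred: "Ck_on (Suc n) S f \<Longrightarrow> Ck_on n S f"
proof (induction n arbitrary: f)
  case 0
  then show ?case
    by (auto intro!: continuous_at_imp_continuous_on differentiable_imp_continuous_within)
next
  case (Suc n)
  then show ?case by (metis Ck_on.simps(2))
qed

lemma Ck_on_const: "Ck_on n S (\<lambda>x. c)"
  by (induction n arbitrary: c) simp_all

lemma Ck_on_bounded_linear:
  assumes "open S" "bounded_linear L" "Ck_on n S f"
  shows "Ck_on n S (\<lambda>x. L (f x))"
  using assms(3)
proof (induction n arbitrary: f)
  case 0
  then show ?case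
    using bounded_linear.continuous_on[OF assms(2)] by simp
next
  case (Suc n)
  show ?case
  proof (rule Ck_on_SucI[OF assms(1)])
    show "((\<lambda>x. L (f x)) has_derivative (\<lambda>v. L (frechet_derivative f (at x) v))) (at x)"
      if "x \<in> S" for x
      using bounded_linear.has_derivative[OF assms(2) Ck_on_SucD[OF Suc.prems that]] .
    show "Ck_on n S (\<lambda>x. L (frechet_derivative f (at x) v))" for v
      using Suc by simp
  qed
qed

lemma Ck_on_add:
  assumes "open S" "Ck_on n S f" "Ck_on n S g"
  shows "Ck_on n S (\<lambda>x. f x + g x)"
  using assms(2,3)
proof (induction n arbitrary: f g)
  case 0
  then show ?case by (simp add: continuous_on_add)
next
  case (Suc n)
  show ?case
  proof (rule Ck_on_SucI[OF assms(1)])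
    show "((\<lambda>x. f x + g x) has_derivative
        (\<lambda>v. frechet_derivative f (at x) v + frechet_derivative g (at x) v)) (at x)"
      if "x \<in> S" for x
      using has_derivative_add[OF Ck_on_SucD[OF Suc.prems(1) that] Ck_on_SucD[OF Suc.prems(2) that]] .
    show "Ck_on n S (\<lambda>x. frechet_derivative f (at x) v + frechet_derivative g (at x) v)" for v
      using Suc by simp
  qed
qed

lemma Ck_on_bilinear:
  assumes "open S" "bounded_bilinear B" "Ck_on n S f" "Ck_on n S g"
  shows "Ck_on n S (\<lambda>x. B (f x) (g x))"
  using assms(3,4)
proof (induction n arbitrary: f g)
  case 0
  then show ?case
    using bounded_bilinear.continuous_on[OF assms(2)] by simp
next
  case (Suc n)
  show ?case
  proof (rule Ck_on_SucI[OF assms(1)])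
    show "((\<lambda>x. B (f x) (g x)) has_derivative
        (\<lambda>v. B (f x) (frechet_derivative g (at x) v) + B (frechet_derivative f (at x) v) (g x))) (at x)"
      if "x \<in> S" for x
      using bounded_bilinear.FDERIV[OF assms(2) Ck_on_SucD[OF Suc.prems(1) that]
          Ck_on_SucD[OF Suc.prems(2) that]] .
    show "Ck_on n S (\<lambda>x. B (f x) (frechet_derivative g (at x) v)
        + B (frechet_derivative f (at x) v) (g x))" for v
      using Suc.prems
      by (intro Ck_on_add[OF assms(1)] Suc.IH Ck_on_pred[of n S f] Ck_on_pred[of n S g]) simp_all
  qed
qed

text \<open>The derivative of the reciprocal is a polynomial in the reciprocal itself and the
  derivative of \<open>f\<close>. So \<open>f\<close> stays fixed in the induction, and the
  hypothesis for the reciprocal, one order lower, supplies the factors.\<close>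

lemma Ck_on_inverse:
  fixes f :: "'a::real_normed_vector \<Rightarrow> real"
  assumes "open S" "\<And>x. x \<in> S \<Longrightarrow> f x \<noteq> 0" "Ck_on n S f"
  shows "Ck_on n S (\<lambda>x. inverse (f x))"
  using assms(3)
proof (induction n)
  case 0
  then show ?case
    using assms(2) by (simp add: continuous_on_inverse)
next
  case (Suc n)
  show ?case
  proof (rule Ck_on_SucI[OF assms(1)])
    show "((\<lambda>x. inverse (f x)) has_derivative
        (\<lambda>v. - (inverse (f x) * frechet_derivative f (at x) v * inverse (f x)))) (at x)"
      if "x \<in> S" for x
      using Deriv.has_derivative_inverse[OF assms(2)[OF that] Ck_on_SucD[OF Suc.prems that]] .
    have inv: "Ck_on n S (\<lambda>x. inverse (f x))"
      using Suc.IH[OF Ck_on_pred[OF Suc.prems]] .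
    have der: "Ck_on n S (\<lambda>x. frechet_derivative f (at x) v)" for v
      using Suc.prems by simp
    show "Ck_on n S (\<lambda>x. - (inverse (f x) * frechet_derivative f (at x) v * inverse (f x)))" for v
      by (intro Ck_on_bounded_linear[OF assms(1) bounded_linear_minus[OF bounded_linear_ident]]
          Ck_on_bilinear[OF assms(1) bounded_bilinear_mult] inv der)
  qed
qed

lemma smooth_on_cong_open:
  assumes "open S" "\<And>x. x \<in> S \<Longrightarrow> f x = g x"
  shows "smooth_on S f \<longleftrightarrow> smooth_on S g"
  using Ck_on_cong_open[OF assms(1), of f g] Ck_on_cong_open[OF assms(1), of g f] assms(2)
  unfolding smooth_on_def by auto

lemma smooth_on_const [simp]: "smooth_on S (\<lambda>x. c)"
  by (simp add: smooth_on_def Ck_on_const)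

lemma smooth_on_bounded_linear:
  "open S \<Longrightarrow> bounded_linear L \<Longrightarrow> smooth_on S f \<Longrightarrow> smooth_on S (\<lambda>x. L (f x))"
  by (simp add: smooth_on_def Ck_on_bounded_linear)

lemma smooth_on_add:
  "open S \<Longrightarrow> smooth_on S f \<Longrightarrow> smooth_on S g \<Longrightarrow> smooth_on S (\<lambda>x. f x + g x)"
  by (simp add: smooth_on_def Ck_on_add)

lemma smooth_on_bilinear:
  "open S \<Longrightarrow> bounded_bilinear B \<Longrightarrow> smooth_on S f \<Longrightarrow> smooth_on S g \<Longrightarrow>
    smooth_on S (\<lambda>x. B (f x) (g x))"
  by (simp add: smooth_on_def Ck_on_bilinear)

lemma smooth_on_minus:
  assumes "open S" "smooth_on S f"
  shows "smooth_on S (\<lambda>x. - f x)"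
  using smooth_on_bounded_linear[OF assms(1) bounded_linear_minus[OF bounded_linear_ident] assms(2)] .

lemma smooth_on_diff:
  assumes "open S" "smooth_on S f" "smooth_on S g"
  shows "smooth_on S (\<lambda>x. f x - g x)"
  using smooth_on_add[OF assms(1,2) smooth_on_minus[OF assms(1,3)]] by simp

lemma smooth_on_scaleR:
  "open S \<Longrightarrow> smooth_on S f \<Longrightarrow> smooth_on S g \<Longrightarrow> smooth_on S (\<lambda>x. f x *\<^sub>R g x)"
  by (rule smooth_on_bilinear[OF _ bounded_bilinear_scaleR])

lemma smooth_on_mult:
  fixes f g :: "'a::real_normed_vector \<Rightarrow> real"
  shows "open S \<Longrightarrow> smooth_on S f \<Longrightarrow> smooth_on S g \<Longrightarrow> smooth_on S (\<lambda>x. f x * g x)"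
  by (rule smooth_on_bilinear[OF _ bounded_bilinear_mult])

lemma smooth_on_divide:
  fixes f g :: "'a::real_normed_vector \<Rightarrow> real"
  assumes "open S" "smooth_on S f" "smooth_on S g" "\<And>x. x \<in> S \<Longrightarrow> g x \<noteq> 0"
  shows "smooth_on S (\<lambda>x. f x / g x)"
  unfolding divide_inverse
  using assms by (intro smooth_on_mult) (simp_all add: smooth_on_def Ck_on_inverse)

lemma smooth_on_sum:
  assumes "open S" "\<And>i. i \<in> I \<Longrightarrow> smooth_on S (f i)"
  shows "smooth_on S (\<lambda>x. \<Sum>i\<in>I. f i x)"
  using assms(2) by (induction I rule: infinite_finite_induct) (simp_all add: smooth_on_add[OF assms(1)])

lemma smooth_on_prod:
  fixes f :: "'i \<Rightarrow> 'a::real_normed_vector \<Rightarrow> real"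
  assumes "open S" "\<And>i. i \<in> I \<Longrightarrow> smooth_on S (f i)"
  shows "smooth_on S (\<lambda>x. \<Prod>i\<in>I. f i x)"
  using assms(2) by (induction I rule: infinite_finite_induct) (simp_all add: smooth_on_mult[OF assms(1)])

lemma smooth_on_id:
  assumes "open S"
  shows "smooth_on S (\<lambda>x. x)"
  unfolding smooth_on_def
proof
  fix n show "Ck_on n S (\<lambda>x. x)"
  proof (cases n)
    case (Suc m)
    then show ?thesis
      using Ck_on_SucI[OF assms, of "\<lambda>x. x" "\<lambda>_ v. v"] by (simp add: Ck_on_const)
  qed simp
qed

lemma smooth_on_linear:
  fixes L :: "'a::euclidean_space \<Rightarrow> 'b::real_normed_vector"
  assumes "open S" "linear L" "smooth_on S f"
  shows "smooth_on S (\<lambda>x. L (f x))"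
  using smooth_on_bounded_linear[OF assms(1) _ assms(3)] assms(2) by (simp add: linear_conv_bounded_linear)

lemma smooth_on_component_iff:
  fixes f :: "'a::real_normed_vector \<Rightarrow> 'b::euclidean_space"
  assumes "open S"
  shows "smooth_on S f \<longleftrightarrow> (\<forall>i\<in>Basis. smooth_on S (\<lambda>x. f x \<bullet> i))"
proof
  show "smooth_on S f \<Longrightarrow> \<forall>i\<in>Basis. smooth_on S (\<lambda>x. f x \<bullet> i)"
    by (auto intro: smooth_on_bounded_linear[OF assms bounded_linear_inner_left])
  assume "\<forall>i\<in>Basis. smooth_on S (\<lambda>x. f x \<bullet> i)"
  then have "smooth_on S (\<lambda>x. \<Sum>i\<in>Basis. (f x \<bullet> i) *\<^sub>R i)"
    by (intro smooth_on_sum[OF assms] smooth_on_scaleR[OF assms]) auto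
  then show "smooth_on S f"
    by (simp add: euclidean_representation)
qed

lemma linear_euclidean_sum:
  fixes L :: "'b::euclidean_space \<Rightarrow> 'c::real_vector"
  assumes "linear L"
  shows "L v = (\<Sum>i\<in>Basis. (v \<bullet> i) *\<^sub>R L i)"
proof -
  have "L v = L (\<Sum>i\<in>Basis. (v \<bullet> i) *\<^sub>R i)"
    by (simp add: euclidean_representation)
  also have "\<dots> = (\<Sum>i\<in>Basis. (v \<bullet> i) *\<^sub>R L i)"
    by (simp add: linear_sum[OF assms] linear_scale[OF assms])
  finally show ?thesis .
qed

text \<open>Expanding the argument in \<open>Basis\<close> turns the composite into a finite sum of
  products, so smoothness need only be known for constant arguments. Metrics, Christoffel symbols
  and differentials are families of this kind.\<close>

lemma smooth_on_linear_field:
  fixes L :: "'a::real_normed_vector \<Rightarrow> 'b::euclidean_space \<Rightarrow> 'c::real_normed_vector"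
  assumes "open S" "\<And>x. x \<in> S \<Longrightarrow> linear (L x)" "\<And>v. smooth_on S (\<lambda>x. L x v)" "smooth_on S f"
  shows "smooth_on S (\<lambda>x. L x (f x))"
proof -
  have "smooth_on S (\<lambda>x. \<Sum>i\<in>Basis. (f x \<bullet> i) *\<^sub>R L x i)"
    using assms(4)
    by (intro smooth_on_sum[OF assms(1)] smooth_on_scaleR[OF assms(1)] assms(3))
      (auto simp: smooth_on_component_iff[OF assms(1), of f])
  moreover have "(\<Sum>i\<in>Basis. (f x \<bullet> i) *\<^sub>R L x i) = L x (f x)" if "x \<in> S" for x
    by (rule linear_euclidean_sum[OF assms(2)[OF that], symmetric])
  ultimately show ?thesis
    using smooth_on_cong_open[OF assms(1), of "\<lambda>x. \<Sum>i\<in>Basis. (f x \<bullet> i) *\<^sub>R L x i" "\<lambda>x. L x (f x)"]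
    by simp
qed

lemma smooth_on_has_derivative:
  assumes "smooth_on S f" "x \<in> S"
  shows "(f has_derivative frechet_derivative f (at x)) (at x)"
  using assms Ck_on_SucD unfolding smooth_on_def by blast

lemma smooth_on_frechet_derivative:
  "smooth_on S f \<Longrightarrow> smooth_on S (\<lambda>x. frechet_derivative f (at x) v)"
  unfolding smooth_on_def by (metis Ck_on.simps(2))

lemma smooth_on_imp_continuous_on: "smooth_on S f \<Longrightarrow> continuous_on S f"
  unfolding smooth_on_def by (metis Ck_on.simps(1))

lemma smooth_on_linear_frechet_derivative:
  "smooth_on S f \<Longrightarrow> x \<in> S \<Longrightarrow> linear (frechet_derivative f (at x))"
  using smooth_on_has_derivative has_derivative_linear by blast

section \<open>Symmetry of second derivatives\<close>

lemma DERIV_along_line: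
  fixes f :: "'a::real_normed_vector \<Rightarrow> real"
  assumes "smooth_on U f" "c + s *\<^sub>R x \<in> U"
  shows "((\<lambda>s. f (c + s *\<^sub>R x)) has_real_derivative frechet_derivative f (at (c + s *\<^sub>R x)) x) (at s)"
proof -
  let ?D = "frechet_derivative f (at (c + s *\<^sub>R x))"
  have D: "(f has_derivative ?D) (at (c + s *\<^sub>R x))"
    using smooth_on_has_derivative[OF assms] .
  have "((\<lambda>s. c + s *\<^sub>R x) has_derivative (\<lambda>h. h *\<^sub>R x)) (at s)"
    by (auto intro!: derivative_eq_intros)
  from has_derivative_compose[OF this D]
  show ?thesis
    by (simp add: has_field_derivative_def linear_scale[OF has_derivative_linear[OF D]] mult.commute[of _ "?D x"])
qed

text \<open>The second difference over a parallelogram is an increment along \<open>x\<close> of a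
  first difference along \<open>y\<close>. One mean value theorem for each direction turns it into a
  mixed derivative at an interior point.\<close>

lemma second_difference_mvt:
  fixes f :: "'a::real_normed_vector \<Rightarrow> real"
  assumes "smooth_on U f" "h > 0"
    and sub: "\<And>s t. 0 \<le> s \<Longrightarrow> s \<le> h \<Longrightarrow> 0 \<le> t \<Longrightarrow> t \<le> h \<Longrightarrow> p + s *\<^sub>R x + t *\<^sub>R y \<in> U"
  shows "\<exists>s t. 0 < s \<and> s < h \<and> 0 < t \<and> t < h \<and>
    f (p + h *\<^sub>R x + h *\<^sub>R y) - f (p + h *\<^sub>R x) - f (p + h *\<^sub>R y) + f p
    = h * (h * frechet_derivative (\<lambda>q. frechet_derivative f (at q) x) (at (p + s *\<^sub>R x + t *\<^sub>R y)) y)"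
proof -
  let ?D = "\<lambda>q. frechet_derivative f (at q) x"
  let ?phi = "\<lambda>s. f ((p + h *\<^sub>R y) + s *\<^sub>R x) - f (p + s *\<^sub>R x)"
  have "\<exists>s>0. s < h \<and> ?phi h - ?phi 0
      = (h - 0) * (?D ((p + h *\<^sub>R y) + s *\<^sub>R x) - ?D (p + s *\<^sub>R x))"
  proof (rule MVT2)
    fix s assume "0 \<le> s" "s \<le> h"
    then have "(p + h *\<^sub>R y) + s *\<^sub>R x \<in> U" "p + s *\<^sub>R x \<in> U"
      using sub[of s h] sub[of s 0] assms(2) by (simp_all add: add_ac)
    then show "(?phi has_real_derivative ?D ((p + h *\<^sub>R y) + s *\<^sub>R x) - ?D (p + s *\<^sub>R x)) (at s)"
      by (intro DERIV_diff DERIV_along_line[OF assms(1)])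
  qed (fact assms(2))
  then obtain s where s: "0 < s" "s < h"
    "?phi h - ?phi 0 = h * (?D ((p + s *\<^sub>R x) + h *\<^sub>R y) - ?D ((p + s *\<^sub>R x) + 0 *\<^sub>R y))"
    by (auto simp: add_ac)
  have "\<exists>t>0. t < h \<and> ?D ((p + s *\<^sub>R x) + h *\<^sub>R y) - ?D ((p + s *\<^sub>R x) + 0 *\<^sub>R y)
      = (h - 0) * frechet_derivative ?D (at ((p + s *\<^sub>R x) + t *\<^sub>R y)) y"
  proof (rule MVT2)
    fix t assume "0 \<le> t" "t \<le> h"
    then have "(p + s *\<^sub>R x) + t *\<^sub>R y \<in> U"
      using sub[of s t] s by simp
    then show "((\<lambda>t. ?D ((p + s *\<^sub>R x) + t *\<^sub>R y)) has_real_derivative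
        frechet_derivative ?D (at ((p + s *\<^sub>R x) + t *\<^sub>R y)) y) (at t)"
      by (intro DERIV_along_line[OF smooth_on_frechet_derivative[OF assms(1)]])
  qed (fact assms(2))
  then obtain t where t: "0 < t" "t < h"
    "?D ((p + s *\<^sub>R x) + h *\<^sub>R y) - ?D ((p + s *\<^sub>R x) + 0 *\<^sub>R y)
      = h * frechet_derivative ?D (at ((p + s *\<^sub>R x) + t *\<^sub>R y)) y"
    by auto
  have "?phi h - ?phi 0 = f (p + h *\<^sub>R x + h *\<^sub>R y) - f (p + h *\<^sub>R x) - f (p + h *\<^sub>R y) + f p"
    by (simp add: add_ac)
  then show ?thesis
    using s t by (intro exI[of _ s] exI[of _ t]) simp
qed

text \<open>The second difference is symmetric in \<open>x\<close> and \<open>y\<close>, so the two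
  mixed derivatives agree at two points arbitrarily close to \<open>p\<close>; continuity does the
  rest. This symmetry removes second derivatives of vector fields from the curvature.\<close>

lemma frechet_derivative_commute_real:
  fixes f :: "'a::real_normed_vector \<Rightarrow> real"
  assumes "open U" "smooth_on U f" "p \<in> U"
  shows "frechet_derivative (\<lambda>q. frechet_derivative f (at q) x) (at p) y
    = frechet_derivative (\<lambda>q. frechet_derivative f (at q) y) (at p) x" (is "?A x y p = ?A y x p")
proof -
  have "\<bar>?A x y p - ?A y x p\<bar> \<le> e" if "e > 0" for e
  proof -
    have near: "\<exists>d>0. \<forall>q. norm (q - p) < d \<longrightarrow> \<bar>?A v w q - ?A v w p\<bar> < e / 2" for v w
    proof -
      have "smooth_on U (?A v w)"
        using assms(2) by (intro smooth_on_frechet_derivative)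
      then have "isCont (?A v w) p"
        using smooth_on_imp_continuous_on assms(1,3) continuous_on_eq_continuous_at by blast
      then show ?thesis
        using that unfolding continuous_at_eps_delta dist_norm by (metis half_gt_zero real_norm_def)
    qed
    obtain d1 where d1: "d1 > 0" "\<And>q. norm (q - p) < d1 \<Longrightarrow> \<bar>?A x y q - ?A x y p\<bar> < e / 2"
      using near by blast
    obtain d2 where d2: "d2 > 0" "\<And>q. norm (q - p) < d2 \<Longrightarrow> \<bar>?A y x q - ?A y x p\<bar> < e / 2"
      using near by blast
    obtain d3 where d3: "d3 > 0" "\<And>q. norm (q - p) < d3 \<Longrightarrow> q \<in> U"
      using assms(1,3) unfolding open_dist dist_norm by blast
    define d where "d = min d1 (min d2 d3)"
    \<comment> \<open>Combinations of \<open>x\<close> and \<open>y\<close> with coefficients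
      between 0 and \<open>h\<close> then have norm below \<open>d\<close>; the summand 1 keeps the
      denominator positive if both vectors are zero.\<close>
    define h where "h = d / (2 * (norm x + norm y + 1))"
    have "d > 0"
      using d1 d2 d3 by (simp add: d_def)
    then have h: "h > 0"
      unfolding h_def by (intro divide_pos_pos) (simp_all add: add_nonneg_pos)
    have small: "norm (s *\<^sub>R x + t *\<^sub>R y) < d" if "0 \<le> s" "s \<le> h" "0 \<le> t" "t \<le> h" for s t
    proof -
      have "norm (s *\<^sub>R x + t *\<^sub>R y) \<le> s * norm x + t * norm y"
        using that norm_triangle_ineq[of "s *\<^sub>R x" "t *\<^sub>R y"] by simp
      also have "\<dots> \<le> h * norm x + h * norm y"
        using that by (intro add_mono mult_right_mono) auto
      also have "\<dots> < h * (2 * (norm x + norm y + 1))"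
        using h mult_nonneg_nonneg[OF less_imp_le[OF h] norm_ge_zero[of x]]
          mult_nonneg_nonneg[OF less_imp_le[OF h] norm_ge_zero[of y]]
        by (simp add: algebra_simps add_nonneg_pos)
      also have "\<dots> = d"
        by (simp add: h_def add_nonneg_eq_0_iff)
      finally show ?thesis .
    qed
    have U: "p + s *\<^sub>R x + t *\<^sub>R y \<in> U" if "0 \<le> s" "s \<le> h" "0 \<le> t" "t \<le> h" for s t
      using d3(2)[of "p + s *\<^sub>R x + t *\<^sub>R y"] small[OF that] by (simp add: d_def add.assoc)
    then have U': "p + t *\<^sub>R y + s *\<^sub>R x \<in> U" if "0 \<le> t" "t \<le> h" "0 \<le> s" "s \<le> h" for s t
      using U[of s t] that by (simp add: add_ac)
    obtain s t where st: "0 < s" "s < h" "0 < t" "t < h"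
      "f (p + h *\<^sub>R x + h *\<^sub>R y) - f (p + h *\<^sub>R x) - f (p + h *\<^sub>R y) + f p
        = h * (h * ?A x y (p + s *\<^sub>R x + t *\<^sub>R y))"
      using second_difference_mvt[OF assms(2) h U] by blast
    obtain t' s' where st': "0 < t'" "t' < h" "0 < s'" "s' < h"
      "f (p + h *\<^sub>R y + h *\<^sub>R x) - f (p + h *\<^sub>R y) - f (p + h *\<^sub>R x) + f p
        = h * (h * ?A y x (p + t' *\<^sub>R y + s' *\<^sub>R x))"
      using second_difference_mvt[OF assms(2) h U'] by blast
    have swap: "f (p + h *\<^sub>R y + h *\<^sub>R x) = f (p + h *\<^sub>R x + h *\<^sub>R y)"
      by (simp add: add_ac)
    have "h * (h * ?A x y (p + s *\<^sub>R x + t *\<^sub>R y)) = h * (h * ?A y x (p + t' *\<^sub>R y + s' *\<^sub>R x))"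
      using st(5) st'(5) swap by linarith
    then have "?A x y (p + s *\<^sub>R x + t *\<^sub>R y) = ?A y x (p + t' *\<^sub>R y + s' *\<^sub>R x)"
      using h by simp
    moreover have "\<bar>?A x y (p + s *\<^sub>R x + t *\<^sub>R y) - ?A x y p\<bar> < e / 2"
      using small[of s t] st by (intro d1(2)) (simp add: d_def add.assoc)
    moreover have "\<bar>?A y x (p + t' *\<^sub>R y + s' *\<^sub>R x) - ?A y x p\<bar> < e / 2"
      using small[of s' t'] st' by (intro d2(2)) (simp add: d_def add_ac)
    ultimately show ?thesis
      by linarith
  qed
  then have "\<bar>?A x y p - ?A y x p\<bar> \<le> 0"
    using field_le_epsilon[of "\<bar>?A x y p - ?A y x p\<bar>" 0] by simp
  then show ?thesis by simp
qed

lemma frechet_derivative_add: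
  assumes "smooth_on U f" "smooth_on U g" "p \<in> U"
  shows "frechet_derivative (\<lambda>p. f p + g p) (at p) v
    = frechet_derivative f (at p) v + frechet_derivative g (at p) v"
  by (rule fun_cong[OF frechet_derivative_at[OF has_derivative_add[OF
          smooth_on_has_derivative[OF assms(1,3)] smooth_on_has_derivative[OF assms(2,3)]]], symmetric])

lemma frechet_derivative_scaleR:
  assumes "smooth_on U f" "smooth_on U g" "p \<in> U"
  shows "frechet_derivative (\<lambda>p. f p *\<^sub>R g p) (at p) v
    = f p *\<^sub>R frechet_derivative g (at p) v + frechet_derivative f (at p) v *\<^sub>R g p"
  by (rule fun_cong[OF frechet_derivative_at[OF has_derivative_scaleR[OF
          smooth_on_has_derivative[OF assms(1,3)] smooth_on_has_derivative[OF assms(2,3)]]], symmetric])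

lemma frechet_derivative_inner_left:
  assumes "smooth_on U f" "p \<in> U"
  shows "frechet_derivative (\<lambda>q. f q \<bullet> i) (at p) = (\<lambda>v. frechet_derivative f (at p) v \<bullet> i)"
  using frechet_derivative_at[OF bounded_linear.has_derivative[OF bounded_linear_inner_left
        smooth_on_has_derivative[OF assms]]] by simp

lemma frechet_derivative_commute:
  fixes f :: "'a::real_normed_vector \<Rightarrow> 'b::euclidean_space"
  assumes "open U" "smooth_on U f" "p \<in> U"
  shows "frechet_derivative (\<lambda>q. frechet_derivative f (at q) x) (at p) y
    = frechet_derivative (\<lambda>q. frechet_derivative f (at q) y) (at p) x"
proof (rule euclidean_eqI)
  fix i :: 'b
  have eq: "frechet_derivative (\<lambda>q. frechet_derivative f (at q) v) (at p) w \<bullet> i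
    = frechet_derivative (\<lambda>q. frechet_derivative (\<lambda>q. f q \<bullet> i) (at q) v) (at p) w" for v w
  proof -
    have "frechet_derivative (\<lambda>q. frechet_derivative f (at q) v) (at p) w \<bullet> i
      = frechet_derivative (\<lambda>q. frechet_derivative f (at q) v \<bullet> i) (at p) w"
      using frechet_derivative_inner_left[OF smooth_on_frechet_derivative[OF assms(2)] assms(3)] by simp
    also have "\<dots> = frechet_derivative (\<lambda>q. frechet_derivative (\<lambda>q. f q \<bullet> i) (at q) v) (at p) w"
      by (subst frechet_derivative_cong_open[OF assms(1,3),
            of "\<lambda>q. frechet_derivative f (at q) v \<bullet> i"
               "\<lambda>q. frechet_derivative (\<lambda>q. f q \<bullet> i) (at q) v"])
        (simp_all add: frechet_derivative_inner_left[OF assms(2)])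
    finally show ?thesis .
  qed
  have "smooth_on U (\<lambda>q. f q \<bullet> i)"
    using smooth_on_bounded_linear[OF assms(1) bounded_linear_inner_left assms(2)] .
  then show "frechet_derivative (\<lambda>q. frechet_derivative f (at q) x) (at p) y \<bullet> i
    = frechet_derivative (\<lambda>q. frechet_derivative f (at q) y) (at p) x \<bullet> i"
    unfolding eq by (rule frechet_derivative_commute_real[OF assms(1) _ assms(3)])
qed

lemma has_derivative_linear_field:
  fixes L :: "'a::real_normed_vector \<Rightarrow> 'b::euclidean_space \<Rightarrow> 'c::real_normed_vector"
  assumes "open S" "\<And>x. x \<in> S \<Longrightarrow> linear (L x)" "\<And>v. smooth_on S (\<lambda>x. L x v)" "smooth_on S f" "p \<in> S"
  shows "((\<lambda>x. L x (f x)) has_derivative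
    (\<lambda>h. frechet_derivative (\<lambda>x. L x (f p)) (at p) h + L p (frechet_derivative f (at p) h))) (at p)"
proof -
  let ?df = "frechet_derivative f (at p)"
  let ?dL = "\<lambda>v. frechet_derivative (\<lambda>x. L x v) (at p)"
  have sum_dL: "(\<Sum>i\<in>Basis. (v \<bullet> i) *\<^sub>R ?dL i h) = ?dL v h" for v h
  proof -
    have "((\<lambda>x. \<Sum>i\<in>Basis. (v \<bullet> i) *\<^sub>R L x i) has_derivative (\<lambda>h. \<Sum>i\<in>Basis. (v \<bullet> i) *\<^sub>R ?dL i h)) (at p)"
      by (intro has_derivative_sum has_derivative_scaleR_right smooth_on_has_derivative[OF assms(3) assms(5)])
    then have "((\<lambda>x. L x v) has_derivative (\<lambda>h. \<Sum>i\<in>Basis. (v \<bullet> i) *\<^sub>R ?dL i h)) (at p)"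
      by (rule has_derivative_transform_within_open[OF _ assms(1,5)])
        (simp add: linear_euclidean_sum[OF assms(2), symmetric])
    from frechet_derivative_at[OF this] show ?thesis
      by metis
  qed
  have "((\<lambda>x. \<Sum>i\<in>Basis. (f x \<bullet> i) *\<^sub>R L x i) has_derivative
      (\<lambda>h. \<Sum>i\<in>Basis. (f p \<bullet> i) *\<^sub>R ?dL i h + (?df h \<bullet> i) *\<^sub>R L p i)) (at p)"
    by (intro has_derivative_sum has_derivative_scaleR has_derivative_inner_left
        smooth_on_has_derivative[OF assms(3) assms(5)] smooth_on_has_derivative[OF assms(4,5)])
  also have "(\<lambda>h. \<Sum>i\<in>Basis. (f p \<bullet> i) *\<^sub>R ?dL i h + (?df h \<bullet> i) *\<^sub>R L p i)
      = (\<lambda>h. ?dL (f p) h + L p (?df h))"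
    by (simp add: sum.distrib sum_dL linear_euclidean_sum[OF assms(2)[OF assms(5)], symmetric])
  finally show ?thesis
    by (rule has_derivative_transform_within_open[OF _ assms(1,5)])
      (simp add: linear_euclidean_sum[OF assms(2), symmetric])
qed

section \<open>Manifolds with a single chart\<close>

lemma second_countable_top_of_set:
  "second_countable (top_of_set (S :: 'a::second_countable_topology set))"
proof -
  obtain B :: "'a set set" where B: "countable B" "\<forall>A\<in>B. open A" "\<And>T. open T \<Longrightarrow> \<exists>C\<subseteq>B. T = \<Union>C"
    using univ_second_countable by metis
  have "\<exists>W\<in>B. x \<in> W \<and> W \<subseteq> T" if "open T" "x \<in> T" for T x
    using B(3)[OF that(1)] that(2) by blast
  then have "second_countable (euclidean :: 'a topology)"
    unfolding second_countable_def using B(1,2) by auto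
  then show ?thesis
    by (rule second_countable_subtopology)
qed

locale open_chart =
  fixes U :: "'e::euclidean_space set"
  assumes open_U: "open U"
begin

definition chart :: "('e, 'e) chart" where "chart = (U, \<lambda>x. x)"

definition M :: "('e, 'e) mfd" where "M = \<lparr>mtop = top_of_set U, matlas = {chart}\<rparr>"

definition tv :: "'e \<Rightarrow> ('e, 'e) tvec" where "tv v = (\<lambda>c. if c = chart then v else 0)"

text \<open>Vanishing off \<open>U\<close> is forced: a vector field has a value at every element of
  the point type, and the tangent space is \<open>{0}\<close> outside the manifold.\<close>

definition vf :: "('e \<Rightarrow> 'e) \<Rightarrow> ('e, 'e) vfield" where "vf f = (\<lambda>p. if p \<in> U then tv (f p) else 0)"

lemma chart_simps [simp]: "fst chart = U" "snd chart = (\<lambda>x. x)"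
  by (simp_all add: chart_def)

lemma M_simps [simp]: "mtop M = top_of_set U" "matlas M = {chart}"
  by (simp_all add: M_def)

lemma cinv_chart [simp]: "p \<in> U \<Longrightarrow> cinv chart p = p"
  using inv_into_f_f[of "\<lambda>x. x" U p] by (simp add: cinv_def)

lemma chart_on_chart: "chart_on (top_of_set U) chart"
  using open_U homeomorphic_map_id[of "top_of_set U" "top_of_set U"]
  by (simp add: chart_on_def id_def subtopology_subtopology)

lemma smooth_on_cinv_iff:
  "smooth_on U (\<lambda>x. f (cinv chart x)) \<longleftrightarrow> smooth_on U f"
  by (rule smooth_on_cong_open[OF open_U]) simp

lemma compatible_chart: "compatible chart chart"
  using smooth_on_id[OF open_U] smooth_on_cinv_iff[of "\<lambda>x. x"] by (simp add: compatible_def o_def)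

lemma smooth_manifold_M: "smooth_manifold M"
  unfolding smooth_manifold_def
  using chart_on_chart compatible_chart
  by (simp add: Hausdorff_space_subtopology second_countable_top_of_set)

lemma charts_at_M: "charts_at M p = (if p \<in> U then {chart} else {})"
  by (auto simp: charts_at_def)

lemma frechet_derivative_cinv:
  "p \<in> U \<Longrightarrow> frechet_derivative (\<lambda>x. f (cinv chart x)) (at p) = frechet_derivative f (at p)"
  by (rule frechet_derivative_cong_open[OF open_U]) simp_all

lemma tv_chart [simp]: "tv v chart = v"
  by (simp add: tv_def)

lemma linear_tv: "linear tv"
  by (rule linearI) (auto simp: tv_def)

lemma tv_simps: "tv (v + w) = tv v + tv w" "tv (v - w) = tv v - tv w" "tv (r *\<^sub>R v) = r *\<^sub>R tv v"
  "tv 0 = 0"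
  by (auto simp: tv_def)

lemma inj_tv [simp]: "tv v = tv w \<longleftrightarrow> v = w"
  by (metis tv_chart)

lemma tangent_space_M: "tangent_space M p = (if p \<in> U then range tv else {0})"
proof (cases "p \<in> U")
  case True
  have "frechet_derivative (\<lambda>x. cinv chart x) (at p) = (\<lambda>v. v)"
    using frechet_derivative_cinv[OF True, of "\<lambda>x. x"] by simp
  then have "v \<in> tangent_space M p \<longleftrightarrow> (\<forall>c. c \<noteq> chart \<longrightarrow> v c = 0)" for v
    using True by (simp add: tangent_space_def charts_at_M o_def)
  moreover have "(\<forall>c. c \<noteq> chart \<longrightarrow> v c = 0) \<longleftrightarrow> v \<in> range tv" for v :: "('e, 'e) tvec"
  proof
    assume "\<forall>c. c \<noteq> chart \<longrightarrow> v c = 0"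
    then have "v = tv (v chart)"
      by (auto simp: tv_def)
    then show "v \<in> range tv" by blast
  qed (auto simp: tv_def)
  ultimately show ?thesis
    using True by auto
next
  case False
  then show ?thesis
    by (auto simp: tangent_space_def charts_at_M fun_eq_iff)
qed

lemma smooth_functions_M: "smooth_functions M = {f. smooth_on U f}"
  using smooth_on_cinv_iff by (auto simp: smooth_functions_def o_def)

lemma tangent_deriv_M:
  "p \<in> U \<Longrightarrow> tangent_deriv M p v f = frechet_derivative f (at p) (v chart)"
  by (simp add: tangent_deriv_def charts_at_M o_def frechet_derivative_cinv)

lemma vf_chart [simp]: "p \<in> U \<Longrightarrow> vf f p = tv (f p)"
  by (simp add: vf_def)

lemma vf_eq_iff: "vf f = vf g \<longleftrightarrow> (\<forall>p\<in>U. f p = g p)"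
proof
  assume eq: "vf f = vf g"
  show "\<forall>p\<in>U. f p = g p"
    using fun_cong[OF eq] by (metis inj_tv vf_chart)
qed (auto simp: vf_def)

lemma vf_in_vector_fields: "smooth_on U f \<Longrightarrow> vf f \<in> vector_fields M"
proof -
  assume f: "smooth_on U f"
  have "smooth_on U (\<lambda>x. vf f (cinv chart x) chart)"
    using smooth_on_cong_open[OF open_U, of f "\<lambda>x. vf f (cinv chart x) chart"] f by simp
  then show ?thesis
    by (auto simp: vector_fields_def tangent_space_M vf_def)
qed

lemma vector_fieldsE:
  assumes "X \<in> vector_fields M"
  obtains f where "smooth_on U f" "X = vf f"
proof
  show "smooth_on U (\<lambda>p. X p chart)"
    using assms smooth_on_cinv_iff[of "\<lambda>p. X p chart"] by (simp add: vector_fields_def)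
  show "X = vf (\<lambda>p. X p chart)"
  proof
    fix p
    have "X p \<in> tangent_space M p"
      using assms by (simp add: vector_fields_def)
    then show "X p = vf (\<lambda>p. X p chart) p"
      by (auto simp: tangent_space_M vf_def split: if_splits)
  qed
qed

lemma vector_fields_M: "vector_fields M = vf ` {f. smooth_on U f}"
  using vf_in_vector_fields by (auto elim: vector_fieldsE)

lemma frechet_derivative_vf:
  "p \<in> U \<Longrightarrow> frechet_derivative (\<lambda>x. vf f x chart) (at p) = frechet_derivative f (at p)"
  by (rule frechet_derivative_cong_open[OF open_U]) simp_all

lemma lie_bracket_vf:
  "lie_bracket M (vf f) (vf g) =
    vf (\<lambda>p. frechet_derivative g (at p) (f p) - frechet_derivative f (at p) (g p))"
proof (intro ext)
  fix p c
  show "lie_bracket M (vf f) (vf g) p c =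
    vf (\<lambda>p. frechet_derivative g (at p) (f p) - frechet_derivative f (at p) (g p)) p c"
  proof (cases "p \<in> U")
    case True
    then show ?thesis
      using frechet_derivative_cinv[of p "\<lambda>x. vf f x chart"] frechet_derivative_cinv[of p "\<lambda>x. vf g x chart"]
      by (simp add: lie_bracket_def charts_at_M tv_def frechet_derivative_vf)
  next
    case False
    then show ?thesis
      by (simp add: lie_bracket_def charts_at_M vf_def)
  qed
qed

lemma vf_add: "vf f + vf g = vf (\<lambda>p. f p + g p)"
  by (auto simp: vf_def tv_simps)

lemma vf_diff: "vf f - vf g = vf (\<lambda>p. f p - g p)"
  by (auto simp: vf_def tv_simps)

lemma fscale_vf: "fscale r (vf f) = vf (\<lambda>p. r p *\<^sub>R f p)"
  by (auto simp: vf_def fscale_def tv_simps)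

lemma linear_on_tangent_space:
  assumes "p \<in> U" "linear f"
  shows "linear_on (tangent_space M p) (\<lambda>v. f (v chart))"
  using assms by (auto simp: linear_on_def tangent_space_M linear_add linear_scale)

lemma smooth_on_frechet_derivative_field:
  assumes "smooth_on U f" "smooth_on U g"
  shows "smooth_on U (\<lambda>p. frechet_derivative g (at p) (f p))"
  by (rule smooth_on_linear_field[OF open_U smooth_on_linear_frechet_derivative[OF assms(2)]
        smooth_on_frechet_derivative[OF assms(2)] assms(1)])

end

section \<open>Connections given by Christoffel symbols\<close>

locale chart_connection = open_chart U for U :: "'e::euclidean_space set" +
  fixes \<Gamma> :: "'e \<Rightarrow> 'e \<Rightarrow> 'e \<Rightarrow> 'e"
  assumes bilinear_\<Gamma>: "\<And>p. p \<in> U \<Longrightarrow> bilinear (\<Gamma> p)"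
    and smooth_\<Gamma>: "\<And>v w. smooth_on U (\<lambda>p. \<Gamma> p v w)"
    and \<Gamma>_commute: "\<And>p v w. p \<in> U \<Longrightarrow> \<Gamma> p v w = \<Gamma> p w v"
begin

definition cov :: "('e \<Rightarrow> 'e) \<Rightarrow> ('e \<Rightarrow> 'e) \<Rightarrow> 'e \<Rightarrow> 'e"
  where "cov f g = (\<lambda>p. frechet_derivative g (at p) (f p) + \<Gamma> p (f p) (g p))"

definition D :: "('e, 'e) conn"
  where "D X Y = vf (cov (\<lambda>p. X p chart) (\<lambda>p. Y p chart))"

lemma D_vf: "D (vf f) (vf g) = vf (cov f g)"
  by (simp add: D_def vf_eq_iff cov_def frechet_derivative_vf)

lemma linear_\<Gamma>: "p \<in> U \<Longrightarrow> linear (\<Gamma> p v)" "p \<in> U \<Longrightarrow> linear (\<lambda>v. \<Gamma> p v w)"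
  using bilinear_\<Gamma> by (simp_all add: bilinear_def)

lemma smooth_\<Gamma>_field:
  assumes "smooth_on U f" "smooth_on U g"
  shows "smooth_on U (\<lambda>p. \<Gamma> p (f p) (g p))"
  by (rule smooth_on_linear_field[OF open_U linear_\<Gamma>(1) _ assms(2)])
    (auto intro: smooth_on_linear_field[OF open_U linear_\<Gamma>(2) smooth_\<Gamma> assms(1)])

lemma smooth_cov: "smooth_on U f \<Longrightarrow> smooth_on U g \<Longrightarrow> smooth_on U (cov f g)"
  unfolding cov_def
  by (intro smooth_on_add[OF open_U] smooth_on_frechet_derivative_field smooth_\<Gamma>_field)

lemma cov_linear:
  assumes "p \<in> U" "smooth_on U g" "smooth_on U h"
  shows "cov (\<lambda>p. f p + f' p) g p = cov f g p + cov f' g p"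
    and "cov (\<lambda>p. r p *\<^sub>R f p) g p = r p *\<^sub>R cov f g p"
    and "cov f (\<lambda>p. g p + h p) p = cov f g p + cov f h p"
  using linear_add[OF smooth_on_linear_frechet_derivative[OF assms(2,1)]]
    linear_scale[OF smooth_on_linear_frechet_derivative[OF assms(2,1)]]
    linear_add[OF linear_\<Gamma>(1)[OF assms(1)]] linear_add[OF linear_\<Gamma>(2)[OF assms(1)]]
    linear_scale[OF linear_\<Gamma>(2)[OF assms(1)]] frechet_derivative_add[OF assms(2,3,1)]
  by (simp_all add: cov_def scaleR_add_right)

lemma cov_scale_right:
  assumes "p \<in> U" "smooth_on U r" "smooth_on U g"
  shows "cov f (\<lambda>p. r p *\<^sub>R g p) p = frechet_derivative r (at p) (f p) *\<^sub>R g p + r p *\<^sub>R cov f g p"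
  using linear_scale[OF linear_\<Gamma>(1)[OF assms(1)]] frechet_derivative_scaleR[OF assms(2,3,1)]
  by (simp add: cov_def scaleR_add_right)

lemma connection_D: "connection M D"
  unfolding connection_def vector_fields_M smooth_functions_M
  by (simp add: D_vf vf_add fscale_vf vf_eq_iff cov_linear cov_scale_right tangent_deriv_M)
    (simp add: smooth_cov)

lemma torsion_free_D: "torsion_free M D"
  unfolding torsion_free_def vector_fields_M
  by (auto simp: D_vf vf_diff lie_bracket_vf vf_eq_iff cov_def \<Gamma>_commute)

text \<open>As \<Gamma> vanishes at \<open>p\<close>, differentiating the fields inserted into it
  contributes nothing; only the dependence of its coefficients on the point survives.\<close>

lemma frechet_derivative_cov:
  assumes "smooth_on U f" "smooth_on U g" "p \<in> U" "\<Gamma> p = (\<lambda>v w. 0)"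
  shows "frechet_derivative (cov f g) (at p) v
    = frechet_derivative (\<lambda>q. frechet_derivative g (at q) (f p)) (at p) v
    + frechet_derivative g (at p) (frechet_derivative f (at p) v)
    + frechet_derivative (\<lambda>q. \<Gamma> q (f p) (g p)) (at p) v"
proof -
  have 1: "((\<lambda>q. frechet_derivative g (at q) (f q)) has_derivative
      (\<lambda>v. frechet_derivative (\<lambda>q. frechet_derivative g (at q) (f p)) (at p) v
        + frechet_derivative g (at p) (frechet_derivative f (at p) v))) (at p)"
    by (rule has_derivative_linear_field[OF open_U smooth_on_linear_frechet_derivative[OF assms(2)]
          smooth_on_frechet_derivative[OF assms(2)] assms(1,3)])
  have 2: "((\<lambda>q. \<Gamma> q (f q) (g p)) has_derivative
      (\<lambda>v. frechet_derivative (\<lambda>q. \<Gamma> q (f p) (g p)) (at p) v)) (at p)"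
    using has_derivative_linear_field[OF open_U linear_\<Gamma>(2) smooth_\<Gamma> assms(1,3)] assms(4) by simp
  have 3: "((\<lambda>q. \<Gamma> q (f q) (g q)) has_derivative
      (\<lambda>v. frechet_derivative (\<lambda>q. \<Gamma> q (f q) (g p)) (at p) v)) (at p)"
    using has_derivative_linear_field[OF open_U linear_\<Gamma>(1)
        smooth_on_linear_field[OF open_U linear_\<Gamma>(2) smooth_\<Gamma> assms(1)] assms(2,3)] assms(4) by simp
  have "(cov f g has_derivative
      (\<lambda>v. (frechet_derivative (\<lambda>q. frechet_derivative g (at q) (f p)) (at p) v
        + frechet_derivative g (at p) (frechet_derivative f (at p) v))
        + frechet_derivative (\<lambda>q. \<Gamma> q (f p) (g p)) (at p) v)) (at p)"
    unfolding cov_def using has_derivative_add[OF 1 3] frechet_derivative_at[OF 2] by simp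
  from fun_cong[OF frechet_derivative_at[OF this], of v] show ?thesis
    by (rule sym)
qed

text \<open>Second derivatives of \<open>h\<close> cancel by symmetry, terms with derivatives of
  \<open>f\<close> and \<open>g\<close> are absorbed by the Lie bracket, and products of Christoffel
  symbols vanish at \<open>p\<close>. The rest depends on the fields only through their values at
  \<open>p\<close>.\<close>

lemma curvature_field_vf:
  assumes "smooth_on U f" "smooth_on U g" "smooth_on U h" "p \<in> U" "\<Gamma> p = (\<lambda>v w. 0)"
  shows "curvature_field M D (vf f) (vf g) (vf h) p
    = tv (frechet_derivative (\<lambda>q. \<Gamma> q (g p) (h p)) (at p) (f p)
        - frechet_derivative (\<lambda>q. \<Gamma> q (f p) (h p)) (at p) (g p))"
proof -
  have "frechet_derivative (\<lambda>q. frechet_derivative h (at q) (g p)) (at p) (f p)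
    = frechet_derivative (\<lambda>q. frechet_derivative h (at q) (f p)) (at p) (g p)"
    by (rule frechet_derivative_commute[OF open_U assms(3,4)])
  moreover have "linear (frechet_derivative h (at p))"
    using smooth_on_linear_frechet_derivative assms by blast
  ultimately show ?thesis
    using assms
    by (simp add: curvature_field_def D_vf lie_bracket_vf tv_simps(2)[symmetric])
      (simp add: cov_def[of _ "cov _ _"] cov_def[of "\<lambda>p. _ p - _ p"] frechet_derivative_cov linear_diff)
qed

lemma curvature_at_tv:
  assumes "p \<in> U" "\<Gamma> p = (\<lambda>v w. 0)"
  shows "curvature_at M D p (tv x) (tv y) (tv z)
    = tv (frechet_derivative (\<lambda>q. \<Gamma> q y z) (at p) x - frechet_derivative (\<lambda>q. \<Gamma> q x z) (at p) y)"
proof -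
  \<comment> \<open>The field with constant coefficients shows that an extension exists, so the
    choice in \<open>vf_extension\<close> is a genuine extension, possibly a different one.\<close>
  have ext: "\<exists>f. smooth_on U f \<and> vf_extension M p (tv v) = vf f \<and> f p = v" for v
  proof -
    have "vf (\<lambda>_. v) \<in> vector_fields M \<and> vf (\<lambda>_. v) p = tv v"
      using assms(1) by (simp add: vf_in_vector_fields)
    then have "vf_extension M p (tv v) \<in> vector_fields M \<and> vf_extension M p (tv v) p = tv v"
      unfolding vf_extension_def by (rule someI[where P = "\<lambda>X. X \<in> vector_fields M \<and> X p = tv v"])
    then show ?thesis
      using assms(1) by (auto elim!: vector_fieldsE)
  qed
  obtain f g h where "smooth_on U f" "vf_extension M p (tv x) = vf f" "f p = x"
    "smooth_on U g" "vf_extension M p (tv y) = vf g" "g p = y"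
    "smooth_on U h" "vf_extension M p (tv z) = vf h" "h p = z"
    using ext by metis
  then show ?thesis
    by (simp add: curvature_at_def curvature_field_vf assms)
qed

end

section \<open>Traces\<close>

text \<open>Change of basis: expand \<open>b\<close> in \<open>C\<close> and \<open>f c\<close> in
  \<open>B\<close>, then exchange the sums. It is needed because \<open>trace_on\<close> chooses its
  basis.\<close>

lemma sum_representation_independent:
  assumes B: "finite B" "independent B" and C: "finite C" "independent C" "span C = span B"
    and f: "endomorphism_on (span B) f"
  shows "(\<Sum>b\<in>B. representation B (f b) b) = (\<Sum>c\<in>C. representation C (f c) c)"
proof -
  \<comment> \<open>\<open>f\<close> is linear only on the span, so the induction has to carry along
    that partial sums stay inside it.\<close>
  have lin: "f (\<Sum>i\<in>I. r i *\<^sub>R h i) = (\<Sum>i\<in>I. r i *\<^sub>R f (h i))" if "\<And>i. i \<in> I \<Longrightarrow> h i \<in> span B"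
    for I :: "'a set" and r h
  proof -
    have "(\<Sum>i\<in>I. r i *\<^sub>R h i) \<in> span B
        \<and> f (\<Sum>i\<in>I. r i *\<^sub>R h i) = (\<Sum>i\<in>I. r i *\<^sub>R f (h i))"
      using that
    proof (induction I rule: infinite_finite_induct)
      case (insert x F)
      then show ?case
        using f by (simp add: endomorphism_on_def linear_on_def span_add span_scale)
    next
      case empty
      have "f (0 *\<^sub>R 0) = 0 *\<^sub>R f 0"
        using f unfolding endomorphism_on_def linear_on_def by (blast intro: span_zero)
      then show ?case by (simp add: span_zero)
    next
      case (infinite A)
      have "f (0 *\<^sub>R 0) = 0 *\<^sub>R f 0"
        using f unfolding endomorphism_on_def linear_on_def by (blast intro: span_zero)
      then show ?case using infinite by (simp add: span_zero)
    qed
    then show ?thesis by simp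
  qed
  have fB: "f x \<in> span B" if "x \<in> span B" for x
    using f that by (simp add: endomorphism_on_def)
  have exp: "(\<Sum>c\<in>C. representation C x c *\<^sub>R c) = x" if "x \<in> span B" for x
    using sum_representation_eq[OF C(2) _ C(1) order_refl, of x] that C(3) by simp
  have expB: "(\<Sum>c\<in>B. representation B x c *\<^sub>R c) = x" if "x \<in> span B" for x
    using sum_representation_eq[OF B(2) that B(1) order_refl] by simp
  have CB: "c \<in> span B" if "c \<in> C" for c
    using that C(3) span_base by blast
  have BB: "c \<in> span B" if "c \<in> B" for c
    using that span_base by blast
  have repB: "representation B (\<Sum>i\<in>I. r i *\<^sub>R h i) b = (\<Sum>i\<in>I. r i * representation B (h i) b)"
    if "\<And>i. i \<in> I \<Longrightarrow> h i \<in> span B" for I :: "'a set" and r h b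
    using that by (simp add: representation_sum[OF B(2)] representation_scale[OF B(2)] span_scale)
  have repC: "representation C (\<Sum>i\<in>I. r i *\<^sub>R h i) b = (\<Sum>i\<in>I. r i * representation C (h i) b)"
    if "\<And>i. i \<in> I \<Longrightarrow> h i \<in> span B" for I :: "'a set" and r h b
    using that C(3) by (simp add: representation_sum[OF C(2)] representation_scale[OF C(2)] span_scale)
  have "(\<Sum>b\<in>B. representation B (f b) b)
      = (\<Sum>b\<in>B. representation B (f (\<Sum>c\<in>C. representation C b c *\<^sub>R c)) b)"
    by (simp add: exp BB)
  also have "\<dots> = (\<Sum>b\<in>B. \<Sum>c\<in>C. representation C b c * representation B (f c) b)"
    by (simp add: lin CB repB fB)
  also have "\<dots> = (\<Sum>c\<in>C. \<Sum>b\<in>B. representation B (f c) b * representation C b c)"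
    by (subst sum.swap) (simp add: mult.commute)
  also have "\<dots> = (\<Sum>c\<in>C. representation C (\<Sum>b\<in>B. representation B (f c) b *\<^sub>R b) c)"
    by (simp add: repC BB)
  also have "\<dots> = (\<Sum>c\<in>C. representation C (f c) c)"
    by (simp add: expB fB CB)
  finally show ?thesis .
qed

lemma trace_on_span:
  assumes "finite B" "independent B" "endomorphism_on (span B) f"
  shows "trace_on (span B) f = (\<Sum>b\<in>B. representation B (f b) b)"
proof -
  define C where "C = (SOME C. independent C \<and> span C = span B)"
  have C: "independent C \<and> span C = span B"
    unfolding C_def by (rule someI[of _ B]) (simp add: assms)
  have "finite C"
    using independent_span_bound[OF assms(1), of C] C span_superset by blast
  then have "(\<Sum>c\<in>C. representation C (f c) c) = (\<Sum>b\<in>B. representation B (f b) b)"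
    using sum_representation_independent[OF assms(1,2) _ _ _ assms(3), of C] C by simp
  then show ?thesis
    by (simp add: trace_on_def C_def[symmetric] Let_def)
qed

lemma linear_std_J: "linear (std_J k)"
  by (rule linearI) (auto simp: std_J_def scaleR_add_right)

lemma std_J_std_J [simp]: "std_J k (std_J k v) = sgn_of k *\<^sub>R v"
  by (cases k; cases v) (simp_all add: std_J_def)

text \<open>\<open>std_J\<close> exchanges the two blocks of coordinates, so its matrix has zero
  diagonal. This yields the trace condition of the para-complex case.\<close>

lemma inner_std_J_basis:
  assumes "i \<in> Basis"
  shows "std_J k i \<bullet> i = 0"
  using assms by (auto simp: std_J_def Basis_prod_def)

context open_chart
begin

lemma endomorphism_on_tangent_space:
  assumes "p \<in> U" "linear f"
  shows "endomorphism_on (tangent_space M p) (\<lambda>v. tv (f (v chart)))"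
  using assms by (auto simp: endomorphism_on_def linear_on_def tangent_space_M tv_simps linear_add linear_scale)

lemma trace_on_tangent_space:
  assumes "p \<in> U" "linear f"
  shows "trace_on (tangent_space M p) (\<lambda>v. tv (f (v chart))) = (\<Sum>i\<in>Basis. f i \<bullet> i)"
proof -
  let ?B = "tv ` Basis"
  have B: "finite ?B" "independent ?B" "span ?B = tangent_space M p"
    using linear_independent_injective_image[OF linear_tv independent_Basis]
      linear_span_image[OF linear_tv, of Basis] assms(1)
    by (auto simp: tangent_space_M inj_on_def)
  have endo: "endomorphism_on (span ?B) (\<lambda>v. tv (f (v chart)))"
    unfolding B(3) by (rule endomorphism_on_tangent_space[OF assms])
  have "representation ?B (tv x) (tv i) = x \<bullet> i" if "i \<in> Basis" for x i
  proof -
    have "representation ?B (tv x) = (\<lambda>v. if v \<in> ?B then x \<bullet> v chart else 0)"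
    proof (rule representation_eqI[OF B(2)])
      show "tv x \<in> span ?B"
        using assms(1) by (simp add: B(3) tangent_space_M)
      show "(\<Sum>v | (if v \<in> ?B then x \<bullet> v chart else 0) \<noteq> 0. (if v \<in> ?B then x \<bullet> v chart else 0) *\<^sub>R v) = tv x"
      proof -
        have "(\<Sum>v | (if v \<in> ?B then x \<bullet> v chart else 0) \<noteq> 0. (if v \<in> ?B then x \<bullet> v chart else 0) *\<^sub>R v)
          = (\<Sum>v\<in>?B. (x \<bullet> v chart) *\<^sub>R v)"
          by (rule sum.mono_neutral_cong_left) (auto split: if_splits)
        also have "\<dots> = (\<Sum>i\<in>Basis. (x \<bullet> i) *\<^sub>R tv i)"
          by (subst sum.reindex) (auto simp: inj_on_def)
        also have "\<dots> = tv x"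
          by (rule linear_euclidean_sum[OF linear_tv, symmetric])
        finally show ?thesis .
      qed
    qed (auto split: if_splits intro: finite_subset[OF _ B(1)])
    then show ?thesis using that by simp
  qed
  then show ?thesis
    using trace_on_span[OF B(1,2) endo] unfolding B(3)
    by (simp add: sum.reindex inj_on_def)
qed

end

section \<open>Kaehler Weyl structures in a chart\<close>

text \<open>The axioms involve constant coordinate vectors only; multilinearity and the product rule
  extend them to smooth vector fields.\<close>

locale kaehler_weyl_chart = chart_connection U \<Gamma>
  for U :: "((real ^ 'k::finite) \<times> (real ^ 'k)) set" and \<Gamma> +
  fixes k :: kind
    and g :: "(real ^ 'k) \<times> (real ^ 'k) \<Rightarrow> (real ^ 'k) \<times> (real ^ 'k) \<Rightarrow> (real ^ 'k) \<times> (real ^ 'k) \<Rightarrow> real"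
    and \<phi> :: "(real ^ 'k) \<times> (real ^ 'k) \<Rightarrow> (real ^ 'k) \<times> (real ^ 'k) \<Rightarrow> real"
  assumes bilinear_g: "\<And>p. p \<in> U \<Longrightarrow> bilinear (g p)"
    and g_commute: "\<And>p v w. p \<in> U \<Longrightarrow> g p v w = g p w v"
    and g_nondegenerate: "\<And>p v. p \<in> U \<Longrightarrow> (\<And>w. g p v w = 0) \<Longrightarrow> v = 0"
    and smooth_g: "\<And>v w. smooth_on U (\<lambda>p. g p v w)"
    and linear_\<phi>: "\<And>p. p \<in> U \<Longrightarrow> linear (\<phi> p)"
    and smooth_\<phi>: "\<And>v. smooth_on U (\<lambda>p. \<phi> p v)"
    and weyl: "\<And>p u v w. p \<in> U \<Longrightarrow> frechet_derivative (\<lambda>q. g q v w) (at p) u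
      - g p (\<Gamma> p u v) w - g p v (\<Gamma> p u w) = - 2 * \<phi> p u * g p v w"
    and hermitian: "\<And>p v w. p \<in> U \<Longrightarrow> g p (std_J k v) (std_J k w) = - sgn_of k * g p v w"
    and parallel_J: "\<And>p v w. p \<in> U \<Longrightarrow> \<Gamma> p v (std_J k w) = std_J k (\<Gamma> p v w)"
begin

definition gM :: "((real ^ 'k) \<times> (real ^ 'k), (real ^ 'k) \<times> (real ^ 'k)) metric_field"
  where "gM p v w = g p (v chart) (w chart)"

definition JM :: "((real ^ 'k) \<times> (real ^ 'k), (real ^ 'k) \<times> (real ^ 'k)) endo_field"
  where "JM p v = tv (std_J k (v chart))"

lemma linear_g: "p \<in> U \<Longrightarrow> linear (g p v)" "p \<in> U \<Longrightarrow> linear (\<lambda>v. g p v w)"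
  using bilinear_g unfolding bilinear_def by blast+

lemma has_derivative_g_field:
  assumes "smooth_on U f" "smooth_on U h" "p \<in> U"
  shows "((\<lambda>q. g q (f q) (h q)) has_derivative
    (\<lambda>v. frechet_derivative (\<lambda>q. g q (f p) (h p)) (at p) v
      + g p (frechet_derivative f (at p) v) (h p) + g p (f p) (frechet_derivative h (at p) v))) (at p)"
proof -
  have "((\<lambda>q. g q (f q) (h p)) has_derivative
      (\<lambda>v. frechet_derivative (\<lambda>q. g q (f p) (h p)) (at p) v
        + g p (frechet_derivative f (at p) v) (h p))) (at p)"
    by (rule has_derivative_linear_field[OF open_U linear_g(2) smooth_g assms(1,3)])
  note eq = frechet_derivative_at[OF this, symmetric]
  show ?thesis
    using has_derivative_linear_field[OF open_U linear_g(1)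
        smooth_on_linear_field[OF open_U linear_g(2) smooth_g assms(1)] assms(2,3)]
    unfolding eq .
qed

lemma smooth_g_field:
  assumes "smooth_on U f" "smooth_on U h"
  shows "smooth_on U (\<lambda>p. g p (f p) (h p))"
  by (rule smooth_on_linear_field[OF open_U linear_g(1)
        smooth_on_linear_field[OF open_U linear_g(2) smooth_g assms(1)] assms(2)])

lemma inner_product_on_gM:
  assumes "p \<in> U"
  shows "inner_product_on (tangent_space M p) (gM p)"
  unfolding inner_product_on_def
proof (intro conjI ballI impI)
  fix x assume "x \<in> tangent_space M p"
  then obtain v where x: "x = tv v"
    using assms by (auto simp: tangent_space_M)
  show "linear_on (tangent_space M p) (gM p x)"
    using linear_on_tangent_space[OF assms linear_g(1)[OF assms, of v]] by (simp add: gM_def[abs_def] x)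
  assume "\<forall>y\<in>tangent_space M p. gM p x y = 0"
  then have "g p v w = 0" for w
    using assms by (auto simp: tangent_space_M gM_def x simp del: split_paired_All)
  then show "x = 0"
    using g_nondegenerate[OF assms] x tv_simps(4) by metis
qed (use assms in \<open>simp add: gM_def g_commute\<close>)

lemma smooth_gM:
  assumes "smooth_on U f" "smooth_on U h"
  shows "smooth_on U (\<lambda>p. gM p (vf f p) (vf h p))"
proof -
  have "smooth_on U (\<lambda>p. g p (f p) (h p)) \<longleftrightarrow> smooth_on U (\<lambda>p. gM p (vf f p) (vf h p))"
    by (rule smooth_on_cong_open[OF open_U]) (simp add: gM_def)
  then show ?thesis
    using smooth_g_field[OF assms] by (rule iffD1)
qed

lemma pseudo_riemannian_gM: "pseudo_riemannian M gM"
  unfolding pseudo_riemannian_def vector_fields_M smooth_functions_M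
  using smooth_manifold_M inner_product_on_gM smooth_gM by auto

lemma smooth_one_form_\<phi>: "smooth_one_form M (\<lambda>p v. \<phi> p (v chart))"
proof -
  have "smooth_on U (\<lambda>p. \<phi> p (vf f p chart))" if "smooth_on U f" for f
    using smooth_on_linear_field[OF open_U linear_\<phi> smooth_\<phi> that]
      smooth_on_cong_open[OF open_U, of "\<lambda>p. \<phi> p (f p)" "\<lambda>p. \<phi> p (vf f p chart)"] by simp
  then show ?thesis
    unfolding smooth_one_form_def vector_fields_M smooth_functions_M
    by (auto intro: linear_on_tangent_space linear_\<phi>)
qed

lemma weyl_equation:
  assumes "smooth_on U f" "smooth_on U h" "smooth_on U l" "p \<in> U"
  shows "tangent_deriv M p (vf f p) (\<lambda>q. gM q (vf h q) (vf l q)) - gM p (D (vf f) (vf h) p) (vf l p)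
      - gM p (vf h p) (D (vf f) (vf l) p) = - 2 * \<phi> p (vf f p chart) * gM p (vf h p) (vf l p)"
proof -
  have "frechet_derivative (\<lambda>q. gM q (vf h q) (vf l q)) (at p)
      = frechet_derivative (\<lambda>q. g q (h q) (l q)) (at p)"
    by (rule frechet_derivative_cong_open[OF open_U assms(4)]) (simp add: gM_def)
  then show ?thesis
    using weyl[OF assms(4), of "h p" "l p" "f p"] assms(4)
    by (simp add: tangent_deriv_M gM_def D_vf cov_def
        frechet_derivative_at[OF has_derivative_g_field[OF assms(2,3,4)], symmetric]
        linear_add[OF linear_g(1)] linear_add[OF linear_g(2)])
qed

lemma weyl_manifold_M: "weyl_manifold M gM D"
proof -
  have "\<forall>X\<in>vector_fields M. \<forall>Y\<in>vector_fields M. \<forall>Z\<in>vector_fields M. \<forall>p\<in>pts M.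
        tangent_deriv M p (X p) (\<lambda>q. gM q (Y q) (Z q)) - gM p (D X Y p) (Z p) - gM p (Y p) (D X Z p)
        = - 2 * \<phi> p (X p chart) * gM p (Y p) (Z p)"
    unfolding vector_fields_M using weyl_equation by auto
  then show ?thesis
    unfolding weyl_manifold_def
    using pseudo_riemannian_gM connection_D torsion_free_D smooth_one_form_\<phi>
    by (intro conjI exI[of _ "\<lambda>p v. \<phi> p (v chart)"]) assumption+
qed

lemma endo_apply_vf: "endo_apply M JM (vf f) = vf (\<lambda>p. std_J k (f p))"
  by (auto simp: endo_apply_def JM_def vf_def)

lemma smooth_std_J: "smooth_on U f \<Longrightarrow> smooth_on U (\<lambda>p. std_J k (f p))"
  by (rule smooth_on_linear[OF open_U linear_std_J])

lemma endomorphism_on_JM: "p \<in> U \<Longrightarrow> endomorphism_on (tangent_space M p) (JM p)"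
  unfolding JM_def[abs_def] by (rule endomorphism_on_tangent_space[OF _ linear_std_J])

lemma complex_structure_on_JM:
  assumes "p \<in> U"
  shows "complex_structure_on k (tangent_space M p) (JM p)"
proof -
  have "JM p (JM p x) = sgn_of k *\<^sub>R x" if "x \<in> tangent_space M p" for x
  proof -
    have "x \<in> range tv"
      using that assms by (simp add: tangent_space_M)
    then obtain v where "x = tv v"
      by (rule rangeE)
    then show ?thesis
      by (simp add: JM_def tv_simps(3))
  qed
  moreover have "trace_on (tangent_space M p) (JM p) = 0"
    using trace_on_tangent_space[OF assms linear_std_J, of k]
    by (simp add: JM_def[abs_def] inner_std_J_basis)
  ultimately show ?thesis
    using endomorphism_on_JM[OF assms] unfolding complex_structure_on_def by blast
qed

text \<open>The endomorphism is \<open>std_J\<close> in the given chart, so this chart is itself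
  adapted.\<close>

lemma integrable_JM: "integrable k M JM"
  unfolding integrable_def
proof
  fix p assume "p \<in> pts M"
  then show "\<exists>c. chart_on (mtop M) c \<and> (\<forall>d\<in>matlas M. compatible c d) \<and> p \<in> cdom c \<and>
    (\<forall>q\<in>cdom c. \<forall>v\<in>tangent_space M q.
      tangent_deriv M q (JM q v) (cmap c) = std_J k (tangent_deriv M q v (cmap c)))"
    using chart_on_chart compatible_chart
    by (intro exI[of _ chart]) (simp add: tangent_deriv_M JM_def)
qed

lemma complex_manifold_M: "complex_manifold k M JM"
  unfolding complex_manifold_def smooth_endo_field_def vector_fields_M
  using smooth_manifold_M endomorphism_on_JM complex_structure_on_JM integrable_JM
  by (auto simp: endo_apply_vf smooth_std_J)

lemma cov_std_J:
  assumes "smooth_on U h" "p \<in> U"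
  shows "cov f (\<lambda>p. std_J k (h p)) p = std_J k (cov f h p)"
proof -
  have "frechet_derivative (\<lambda>p. std_J k (h p)) (at p) = (\<lambda>v. std_J k (frechet_derivative h (at p) v))"
    using frechet_derivative_at[OF bounded_linear.has_derivative[OF _ smooth_on_has_derivative[OF assms]]]
      linear_std_J by (metis linear_conv_bounded_linear)
  then show ?thesis
    using assms by (simp add: cov_def parallel_J linear_add[OF linear_std_J])
qed

theorem kaehler_weyl_manifold_M: "kaehler_weyl_manifold k M gM JM D"
  unfolding kaehler_weyl_manifold_def vector_fields_M
  using weyl_manifold_M complex_manifold_M hermitian
  by (auto simp: endo_apply_vf D_vf vf_eq_iff cov_std_J hermitian_on_def gM_def JM_def)

lemma curvature_tensor_tv:
  assumes "p \<in> U" "\<Gamma> p = (\<lambda>v w. 0)"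
  shows "curvature_tensor M gM D p (tv x) (tv y) (tv z) (tv w)
    = g p (frechet_derivative (\<lambda>q. \<Gamma> q y z) (at p) x) w - g p (frechet_derivative (\<lambda>q. \<Gamma> q x z) (at p) y) w"
  using assms by (simp add: curvature_tensor_def curvature_at_tv gM_def linear_diff[OF linear_g(2)])

end

section \<open>Smooth families of bilinear forms\<close>

lemma smooth_on_det:
  fixes A :: "'a::real_normed_vector \<Rightarrow> real ^ 'n ^ 'n::finite"
  assumes "open S" "\<And>i j. smooth_on S (\<lambda>x. A x $ i $ j)"
  shows "smooth_on S (\<lambda>x. det (A x))"
  unfolding det_def
  by (intro smooth_on_sum[OF assms(1)] smooth_on_mult[OF assms(1)] smooth_on_prod[OF assms(1)]
      smooth_on_const assms(2))

text \<open>The indices are transposed so that the matrix acts on the coordinates of the first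
  argument of \<open>b\<close>.\<close>

definition gram_matrix :: "('n \<Rightarrow> 'e) \<Rightarrow> ('e \<Rightarrow> 'e \<Rightarrow> real) \<Rightarrow> real ^ 'n ^ 'n::finite"
  where "gram_matrix e b = (\<chi> i j. b (e j) (e i))"

lemma sum_basis_reindex:
  fixes f :: "'e::euclidean_space \<Rightarrow> 'c::comm_monoid_add"
  assumes "bij_betw e (UNIV :: 'n::finite set) Basis"
  shows "(\<Sum>i\<in>Basis. f i) = (\<Sum>j\<in>UNIV. f (e j))"
  using sum.reindex_bij_betw[OF assms, of f] by simp

lemma ball_Basis_iff:
  assumes "bij_betw e (UNIV :: 'n::finite set) Basis"
  shows "(\<forall>i\<in>Basis. P i) \<longleftrightarrow> (\<forall>j. P (e j))"
  using bij_betw_imp_surj_on[OF assms] by (metis rangeE rangeI)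

lemma gram_matrix_mult:
  fixes e :: "'n::finite \<Rightarrow> 'e::euclidean_space"
  assumes "bij_betw e UNIV Basis" "bilinear b"
  shows "gram_matrix e b *v (\<chi> j. v \<bullet> e j) = (\<chi> i. b v (e i))"
proof -
  have "(\<Sum>j\<in>UNIV. b (e j) w * (v \<bullet> e j)) = b v w" for w
  proof -
    have "linear (\<lambda>v. b v w)"
      using assms(2) by (simp add: bilinear_def)
    from linear_euclidean_sum[OF this, of v] sum_basis_reindex[OF assms(1), of "\<lambda>i. (v \<bullet> i) * b i w"]
    show ?thesis by (simp add: mult.commute)
  qed
  then show ?thesis
    by (simp add: gram_matrix_def matrix_vector_mult_def vec_eq_iff)
qed

lemma bilinear_eq_0_iff_basis:
  fixes b :: "'v::real_vector \<Rightarrow> 'e::euclidean_space \<Rightarrow> real"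
  assumes "linear (b v)" "bij_betw e (UNIV :: 'n::finite set) Basis"
  shows "(\<forall>w. b v w = 0) \<longleftrightarrow> (\<forall>i. b v (e i) = 0)"
proof
  assume "\<forall>i. b v (e i) = 0"
  then have "\<forall>i\<in>Basis. b v i = 0"
    unfolding ball_Basis_iff[OF assms(2)] .
  then show "\<forall>w. b v w = 0"
    using linear_euclidean_sum[OF assms(1)] by (metis (no_types, lifting) scaleR_zero_right sum.neutral)
qed simp

text \<open>For a smooth family of forms this makes nondegeneracy the nonvanishing of a single
  smooth function: an open condition, and the one under which Cramer's rule applies.\<close>

lemma nondegenerate_iff_det:
  fixes e :: "'n::finite \<Rightarrow> 'e::euclidean_space"
  assumes e: "bij_betw e UNIV Basis" and b: "bilinear b"
  shows "(\<forall>v. (\<forall>w. b v w = 0) \<longrightarrow> v = 0) \<longleftrightarrow> det (gram_matrix e b) \<noteq> 0"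
proof -
  have lin: "linear (b v)" for v
    using b by (simp add: bilinear_def)
  have iff0: "(\<forall>w. b v w = 0) \<longleftrightarrow> gram_matrix e b *v (\<chi> j. v \<bullet> e j) = 0" for v
    unfolding gram_matrix_mult[OF e b] bilinear_eq_0_iff_basis[where b = b, OF lin e]
    by (simp add: vec_eq_iff)
  have v0: "v = 0 \<longleftrightarrow> (\<chi> j. v \<bullet> e j) = 0" for v
  proof
    assume "(\<chi> j. v \<bullet> e j) = 0"
    then have "\<forall>i\<in>Basis. v \<bullet> i = 0"
      unfolding ball_Basis_iff[OF e] by (simp add: vec_eq_iff)
    then show "v = 0"
      using euclidean_all_zero_iff by blast
  qed (simp add: vec_eq_iff)
  have surj: "\<exists>v. c = (\<chi> j. v \<bullet> e j)" for c :: "real ^ 'n"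
  proof -
    have inj: "e i = e j \<longleftrightarrow> i = j" for i j
      using e by (auto simp: bij_betw_def inj_on_def)
    have eB: "e i \<in> Basis" for i
      using e by (auto simp: bij_betw_def)
    have "c = (\<chi> j. (\<Sum>i\<in>UNIV. c $ i *\<^sub>R e i) \<bullet> e j)"
      by (simp add: vec_eq_iff inner_sum_left inner_Basis[OF eB eB] inj if_distrib cong: if_cong)
    then show ?thesis by blast
  qed
  have "(\<forall>v. (\<forall>w. b v w = 0) \<longrightarrow> v = 0) \<longleftrightarrow> (\<forall>c. gram_matrix e b *v c = 0 \<longrightarrow> c = 0)"
    unfolding iff0 using v0 surj by metis
  also have "\<dots> \<longleftrightarrow> det (gram_matrix e b) \<noteq> 0"
    unfolding matrix_left_invertible_ker[symmetric] invertible_left_inverse[symmetric]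
    by (rule invertible_det_nz)
  finally show ?thesis .
qed

lemma open_nondegenerate:
  fixes e :: "'n::finite \<Rightarrow> 'e::euclidean_space" and b :: "'a::real_normed_vector \<Rightarrow> 'e \<Rightarrow> 'e \<Rightarrow> real"
  assumes e: "bij_betw e UNIV Basis" and b: "\<And>x. bilinear (b x)"
    and smooth: "\<And>v w. smooth_on UNIV (\<lambda>x. b x v w)"
  shows "open {x. \<forall>v. (\<forall>w. b x v w = 0) \<longrightarrow> v = 0}"
proof -
  have "smooth_on UNIV (\<lambda>x. det (gram_matrix e (b x)))"
    by (intro smooth_on_det) (simp_all add: gram_matrix_def smooth)
  then have "continuous_on UNIV (\<lambda>x. det (gram_matrix e (b x)))"
    by (rule smooth_on_imp_continuous_on)
  then have "open {x. det (gram_matrix e (b x)) \<noteq> 0}"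
    by (intro open_Collect_neq continuous_on_const)
  then show ?thesis
    by (simp add: nondegenerate_iff_det[OF e b])
qed

text \<open>By Cramer's rule the coordinates of the solution are quotients of determinants.\<close>

lemma smooth_on_bilinear_solution:
  fixes e :: "'n::finite \<Rightarrow> 'e::euclidean_space" and b :: "'a::real_normed_vector \<Rightarrow> 'e \<Rightarrow> 'e \<Rightarrow> real"
  assumes e: "bij_betw e UNIV Basis" and U: "open U"
    and b: "\<And>x. x \<in> U \<Longrightarrow> bilinear (b x)" "\<And>v w. smooth_on U (\<lambda>x. b x v w)"
    and nondeg: "\<And>x v. x \<in> U \<Longrightarrow> (\<And>w. b x v w = 0) \<Longrightarrow> v = 0"
    and \<kappa>: "\<And>w. smooth_on U (\<lambda>x. \<kappa> x w)"
    and s: "\<And>x w. x \<in> U \<Longrightarrow> b x (s x) w = \<kappa> x w"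
  shows "smooth_on U s"
proof -
  let ?A = "\<lambda>x. gram_matrix e (b x)"
  let ?R = "\<lambda>k x. \<chi> i j. if j = k then (\<chi> i. \<kappa> x (e i)) $ i else ?A x $ i $ j"
  have det: "det (?A x) \<noteq> 0" if "x \<in> U" for x
    using nondegenerate_iff_det[OF e b(1)[OF that]] nondeg[OF that] by blast
  have sol: "s x \<bullet> e k = det (?R k x) / det (?A x)" if "x \<in> U" for x k
  proof -
    have "?A x *v (\<chi> j. s x \<bullet> e j) = (\<chi> i. \<kappa> x (e i))"
      using gram_matrix_mult[OF e b(1)[OF that]] s[OF that] by simp
    then have "(\<chi> j. s x \<bullet> e j) = (\<chi> k. det (?R k x) / det (?A x))"
      using cramer[OF det[OF that]] by blast
    then show ?thesis
      by (simp add: vec_eq_iff)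
  qed
  have A: "smooth_on U (\<lambda>x. ?A x $ i $ j)" for i j
    by (simp add: gram_matrix_def b(2))
  have "smooth_on U (\<lambda>x. ?R k x $ i $ j)" for k i j
    using A \<kappa> by (cases "j = k") simp_all
  then have "smooth_on U (\<lambda>x. det (?R k x) / det (?A x))" for k
    using A det by (intro smooth_on_divide[OF U] smooth_on_det[OF U]) auto
  then have "smooth_on U (\<lambda>x. s x \<bullet> e k)" for k
    using smooth_on_cong_open[OF U, of "\<lambda>x. s x \<bullet> e k" "\<lambda>x. det (?R k x) / det (?A x)"] sol by simp
  then show ?thesis
    unfolding smooth_on_component_iff[OF U, of s] ball_Basis_iff[OF e] by blast
qed

text \<open>The map \<open>T\<close> sends \<open>v\<close> to the Euclidean representative of
  \<open>b v\<close>. Nondegeneracy makes it injective, hence surjective in finite dimension; no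
  definiteness is involved.\<close>

lemma nondegenerate_riesz:
  fixes b :: "'e::euclidean_space \<Rightarrow> 'e \<Rightarrow> real"
  assumes b: "bilinear b" and nondeg: "\<And>v. (\<And>w. b v w = 0) \<Longrightarrow> v = 0" and \<kappa>: "linear \<kappa>"
  shows "\<exists>!v. \<forall>w. b v w = \<kappa> w"
proof -
  have lin: "linear (b v)" "linear (\<lambda>v. b v w)" for v w
    using b by (simp_all add: bilinear_def)
  have unique: "v = v'" if "\<forall>w. b v w = b v' w" for v v'
    using nondeg[of "v - v'"] that by (simp add: linear_diff[OF lin(2)])
  define T where "T v = (\<Sum>i\<in>Basis. b v i *\<^sub>R i)" for v
  have T: "T v \<bullet> i = b v i" if "i \<in> Basis" for v i
    using that by (simp add: T_def)
  have "linear T"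
    unfolding T_def
    by (rule linearI) (simp_all add: linear_add[OF lin(2)] linear_scale[OF lin(2)] scaleR_add_left
        sum.distrib scaleR_sum_right)
  have ext: "b v w = \<kappa>' w" if "\<forall>i\<in>Basis. b v i = \<kappa>' i" "linear \<kappa>'" for v w \<kappa>'
    unfolding linear_euclidean_sum[OF lin(1)[of v], of w] linear_euclidean_sum[OF that(2), of w]
    using that(1) by simp
  have "inj T"
  proof (rule injI)
    fix v v' assume "T v = T v'"
    then have "\<forall>i\<in>Basis. b v i = b v' i"
      using T by metis
    then have "b v w = b v' w" for w
      using ext lin(1) by blast
    then show "v = v'"
      using unique by blast
  qed
  then have "surj T"
    using linear_inj_imp_surj \<open>linear T\<close> by blast
  then obtain v where "T v = (\<Sum>i\<in>Basis. \<kappa> i *\<^sub>R i)"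
    by (metis surjD)
  then have "\<forall>i\<in>Basis. b v i = \<kappa> i"
    using T by (metis inner_sum_left_Basis)
  then have "\<forall>w. b v w = \<kappa> w"
    using ext[OF _ \<kappa>] by blast
  then show ?thesis
    using unique by metis
qed

text \<open>Square matrices are indexed by a finite type, so the standard basis is numbered by
  \<open>'k + 'k\<close>.\<close>

definition basis_vector :: "'k + 'k \<Rightarrow> (real ^ 'k::finite) \<times> (real ^ 'k)"
  where "basis_vector s = (case s of Inl i \<Rightarrow> (axis i 1, 0) | Inr i \<Rightarrow> (0, axis i 1))"

lemma bij_betw_basis_vector: "bij_betw basis_vector UNIV Basis"
proof -
  have "inj basis_vector"
    by (rule injI) (auto simp: basis_vector_def axis_eq_axis split: sum.splits)
  moreover have "range basis_vector = Basis"
    by (auto simp: Basis_prod_def Basis_vec_def basis_vector_def UNIV_sum image_Un image_image)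
  ultimately show ?thesis
    by (simp add: bij_betw_def)
qed

section \<open>The Weyl connection of a conformally Kaehler metric\<close>

lemma sgn_of_square [simp]: "sgn_of k * sgn_of k = 1" "sgn_of k * (sgn_of k * x) = x"
  by (cases k; simp)+

text \<open>The classical passage from a closed Kaehler form to a parallel complex structure, for
  constant \<open>J\<close>. It combines the cyclic identity at \<open>u\<close>, \<open>v\<close>,
  \<open>w\<close> with the one at \<open>u\<close>, \<open>J v\<close>, \<open>J w\<close>. As it
  is purely algebraic, it serves both for the connection of a chart and for its linearization at the
  origin.\<close>

lemma koszul_skew:
  fixes S :: "'a \<Rightarrow> 'a \<Rightarrow> 'a \<Rightarrow> real"
  assumes sym: "\<And>u v w. S u v w = S u w v"
    and skew: "\<And>u v w. S u (J v) w = - S u v (J w)"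
    and JJ: "\<And>u v w. S u v (J (J w)) = sgn_of k * S u v w"
    and kaehler: "\<And>u v w. S u v (J w) + S v w (J u) + S w u (J v) = 0"
  shows "S u (J v) w + S (J v) u w - S w u (J v) = - (S u v (J w) + S v u (J w) - S (J w) u v)"
proof -
  have "S (J v) (J w) (J u) = - sgn_of k * S (J v) u w"
    using skew[of "J v" w "J u"] JJ sym[of "J v" w u] by simp
  then have "sgn_of k * (S u (J v) w - S (J v) u w + S (J w) u v) = 0"
    using kaehler[of u "J v" "J w"] by (simp add: JJ algebra_simps)
  then have "S u (J v) w - S (J v) u w + S (J w) u v = 0"
    by (cases k) simp_all
  then show ?thesis
    using kaehler[of u v w] skew[of u v w] skew[of v u w] sym[of v w "J u"] by linarith
qed

locale conformal_kaehler_chart = open_chart U for U :: "((real ^ 'k::finite) \<times> (real ^ 'k)) set" +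
  fixes k :: kind
    and g :: "(real ^ 'k) \<times> (real ^ 'k) \<Rightarrow> (real ^ 'k) \<times> (real ^ 'k) \<Rightarrow> (real ^ 'k) \<times> (real ^ 'k) \<Rightarrow> real"
    and \<phi> :: "(real ^ 'k) \<times> (real ^ 'k) \<Rightarrow> (real ^ 'k) \<times> (real ^ 'k) \<Rightarrow> real"
  assumes bilinear_g: "\<And>p. p \<in> U \<Longrightarrow> bilinear (g p)"
    and g_commute: "\<And>p v w. p \<in> U \<Longrightarrow> g p v w = g p w v"
    and g_nondegenerate: "\<And>p v. p \<in> U \<Longrightarrow> (\<And>w. g p v w = 0) \<Longrightarrow> v = 0"
    and smooth_g: "\<And>v w. smooth_on U (\<lambda>p. g p v w)"
    and linear_\<phi>: "\<And>p. p \<in> U \<Longrightarrow> linear (\<phi> p)"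
    and smooth_\<phi>: "\<And>v. smooth_on U (\<lambda>p. \<phi> p v)"
    and hermitian: "\<And>p v w. p \<in> U \<Longrightarrow> g p (std_J k v) (std_J k w) = - sgn_of k * g p v w"
    and kaehler: "\<And>p u v w. p \<in> U \<Longrightarrow>
      frechet_derivative (\<lambda>q. g q v (std_J k w)) (at p) u + 2 * \<phi> p u * g p v (std_J k w)
      + (frechet_derivative (\<lambda>q. g q w (std_J k u)) (at p) v + 2 * \<phi> p v * g p w (std_J k u))
      + (frechet_derivative (\<lambda>q. g q u (std_J k v)) (at p) w + 2 * \<phi> p w * g p u (std_J k v)) = 0"
begin

text \<open>The Weyl condition says that
  \<open>g p (\<Gamma> p u v) w + g p v (\<Gamma> p u w)\<close> equals \<open>S p u v w\<close>.
  The axiom \<open>kaehler\<close> is the vanishing of the cyclic sum of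
  \<open>S p u v (std_J k w)\<close>, that is of d\<Omega> + 2 \<phi> \<and> \<Omega>.\<close>

definition S where "S p u v w = frechet_derivative (\<lambda>q. g q v w) (at p) u + 2 * \<phi> p u * g p v w"

text \<open>The Koszul formula: the part symmetric in \<open>u\<close> and \<open>v\<close> is
  forced by freedom from torsion, and \<open>K p u v w + K p u w v\<close> gives back
  \<open>S p u v w\<close>.\<close>

definition K where "K p u v w = (S p u v w + S p v u w - S p w u v) / 2"

definition \<Gamma> where "\<Gamma> p u v = (THE z. \<forall>w. g p z w = K p u v w)"

lemma linear_g: "p \<in> U \<Longrightarrow> linear (g p v)" "p \<in> U \<Longrightarrow> linear (\<lambda>v. g p v w)"
  using bilinear_g unfolding bilinear_def by blast+

lemma S_commute: "p \<in> U \<Longrightarrow> S p u v w = S p u w v"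
  unfolding S_def using g_commute[of p v w]
    frechet_derivative_cong_open[OF open_U, of p "\<lambda>q. g q v w" "\<lambda>q. g q w v"] g_commute[of _ v w] by simp

lemma linear_S:
  assumes "p \<in> U"
  shows "linear (\<lambda>u. S p u v w)" "linear (\<lambda>v. S p u v w)" "linear (\<lambda>w. S p u v w)"
proof -
  note d = smooth_on_linear_frechet_derivative[OF smooth_g assms]
  show "linear (\<lambda>u. S p u v w)"
    by (rule linearI) (simp_all add: S_def linear_add[OF d] linear_scale[OF d] algebra_simps
        linear_add[OF linear_\<phi>[OF assms]] linear_scale[OF linear_\<phi>[OF assms]])
  show *: "linear (\<lambda>v. S p u v w)" for w
  proof (rule linearI)
    fix v v' :: "(real ^ 'k) \<times> (real ^ 'k)" and r :: real
    have "frechet_derivative (\<lambda>q. g q (v + v') w) (at p) u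
      = frechet_derivative (\<lambda>q. g q v w + g q v' w) (at p) u"
      by (subst frechet_derivative_cong_open[OF open_U assms, of _ "\<lambda>q. g q v w + g q v' w"])
        (simp_all add: linear_add[OF linear_g(2)])
    then show "S p u (v + v') w = S p u v w + S p u v' w"
      by (simp add: S_def frechet_derivative_add[OF smooth_g smooth_g assms]
          linear_add[OF linear_g(2)[OF assms]] algebra_simps)
    have "frechet_derivative (\<lambda>q. g q (r *\<^sub>R v) w) (at p) u
      = frechet_derivative (\<lambda>q. r *\<^sub>R g q v w) (at p) u"
      by (subst frechet_derivative_cong_open[OF open_U assms, of _ "\<lambda>q. r *\<^sub>R g q v w"])
        (simp_all add: linear_scale[OF linear_g(2)])
    then show "S p u (r *\<^sub>R v) w = r *\<^sub>R S p u v w"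
      using frechet_derivative_scaleR[OF smooth_on_const smooth_g assms, of r v w u]
      by (simp add: S_def linear_scale[OF linear_g(2)[OF assms]] algebra_simps)
  qed
  show "linear (\<lambda>w. S p u v w)"
    using *[of v] S_commute[OF assms, of u v] by simp
qed

lemma linear_K:
  assumes "p \<in> U"
  shows "linear (\<lambda>u. K p u v w)" "linear (\<lambda>v. K p u v w)" "linear (\<lambda>w. K p u v w)"
  by (rule linearI; simp add: K_def algebra_simps add_divide_distrib diff_divide_distrib
      linear_add[OF linear_S(1)[OF assms]] linear_scale[OF linear_S(1)[OF assms]]
      linear_add[OF linear_S(2)[OF assms]] linear_scale[OF linear_S(2)[OF assms]]
      linear_add[OF linear_S(3)[OF assms]] linear_scale[OF linear_S(3)[OF assms]])+

lemma g_eqI: "p \<in> U \<Longrightarrow> (\<And>w. g p v w = g p v' w) \<Longrightarrow> v = v'"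
  using g_nondegenerate[of p "v - v'"] by (simp add: linear_diff[OF linear_g(2)])

lemma g_\<Gamma>: "p \<in> U \<Longrightarrow> g p (\<Gamma> p u v) w = K p u v w"
proof -
  assume p: "p \<in> U"
  have "\<exists>!z. \<forall>w. g p z w = K p u v w"
    by (rule nondegenerate_riesz[OF bilinear_g[OF p] g_nondegenerate[OF p] linear_K(3)[OF p]])
  then have "\<forall>w. g p (\<Gamma> p u v) w = K p u v w"
    unfolding \<Gamma>_def by (rule theI')
  then show ?thesis ..
qed

lemma smooth_S: "smooth_on U (\<lambda>p. S p u v w)"
  unfolding S_def
  by (intro smooth_on_add[OF open_U] smooth_on_mult[OF open_U] smooth_on_frechet_derivative
      smooth_g smooth_\<phi> smooth_on_const)

lemma smooth_K: "smooth_on U (\<lambda>p. K p u v w)"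
  unfolding K_def
  by (intro smooth_on_divide[OF open_U] smooth_on_diff[OF open_U] smooth_on_add[OF open_U] smooth_S smooth_on_const)
    simp

lemma hermitian_skew: "p \<in> U \<Longrightarrow> g p (std_J k v) w = - g p v (std_J k w)"
  using hermitian[of p v "std_J k w"] by (cases k) (simp_all add: linear_neg[OF linear_g(1)])

lemma S_skew:
  assumes "p \<in> U"
  shows "S p u (std_J k v) w = - S p u v (std_J k w)"
proof -
  have "frechet_derivative (\<lambda>q. g q (std_J k v) w) (at p) u
    = frechet_derivative (\<lambda>q. (-1) *\<^sub>R g q v (std_J k w)) (at p) u"
    by (subst frechet_derivative_cong_open[OF open_U assms, of _ "\<lambda>q. (-1) *\<^sub>R g q v (std_J k w)"])
      (simp_all add: hermitian_skew)
  then show ?thesis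
    using frechet_derivative_scaleR[OF smooth_on_const smooth_g assms, of "-1" v "std_J k w" u]
    by (simp add: S_def hermitian_skew[OF assms])
qed

lemma \<Gamma>_parallel_J:
  assumes "p \<in> U"
  shows "\<Gamma> p u (std_J k v) = std_J k (\<Gamma> p u v)"
proof (rule g_eqI[OF assms])
  fix w
  have "S p u v (std_J k (std_J k w)) = sgn_of k * S p u v w" for u v w
    using linear_scale[OF linear_S(3)[OF assms]] by simp
  then have "S p u (std_J k v) w + S p (std_J k v) u w - S p w u (std_J k v)
      = - (S p u v (std_J k w) + S p v u (std_J k w) - S p (std_J k w) u v)"
    using kaehler[OF assms]
    by (intro koszul_skew[of "S p" "std_J k" k] S_commute[OF assms] S_skew[OF assms]) (simp_all add: S_def)
  then show "g p (\<Gamma> p u (std_J k v)) w = g p (std_J k (\<Gamma> p u v)) w"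
    unfolding hermitian_skew[OF assms] g_\<Gamma>[OF assms] K_def
    by (simp only: minus_divide_left)
qed

sublocale kaehler_weyl_chart U \<Gamma> k g \<phi>
proof
  show "bilinear (\<Gamma> p)" if "p \<in> U" for p
    unfolding bilinear_def
    by (intro conjI allI linearI g_eqI[OF that])
      (simp_all add: linear_add[OF linear_g(2)[OF that]] linear_scale[OF linear_g(2)[OF that]] g_\<Gamma>[OF that]
        linear_add[OF linear_K(1)[OF that]] linear_scale[OF linear_K(1)[OF that]]
        linear_add[OF linear_K(2)[OF that]] linear_scale[OF linear_K(2)[OF that]])
  show "smooth_on U (\<lambda>p. \<Gamma> p v w)" for v w
    by (rule smooth_on_bilinear_solution[OF bij_betw_basis_vector open_U bilinear_g smooth_g
          g_nondegenerate smooth_K g_\<Gamma>])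
  show "\<Gamma> p v w = \<Gamma> p w v" if "p \<in> U" for p v w
    using S_commute[OF that, of _ v w] by (intro g_eqI[OF that]) (simp add: g_\<Gamma>[OF that] K_def)
  show "frechet_derivative (\<lambda>q. g q v w) (at p) u - g p (\<Gamma> p u v) w - g p v (\<Gamma> p u w)
      = - 2 * \<phi> p u * g p v w" if "p \<in> U" for p u v w
  proof -
    have "K p u v w + K p u w v = S p u v w"
      unfolding K_def S_commute[OF that, of u w v] S_commute[OF that, of v w u] S_commute[OF that, of w v u]
      by (simp add: field_simps)
    then show ?thesis
      unfolding g_commute[OF that, of v "\<Gamma> p u w"] g_\<Gamma>[OF that] S_def by linarith
  qed
qed ((fact bilinear_g g_commute g_nondegenerate smooth_g smooth_\<phi> hermitian \<Gamma>_parallel_J)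
    | simp add: linear_add[OF linear_\<phi>] linear_scale[OF linear_\<phi>])+

lemma \<Gamma>_eq_0:
  assumes "p \<in> U" "\<And>v w. frechet_derivative (\<lambda>q. g q v w) (at p) = (\<lambda>u. 0)" "\<phi> p = (\<lambda>u. 0)"
  shows "\<Gamma> p = (\<lambda>u v. 0)"
  using linear_0[OF linear_g(2)[OF assms(1)]]
  by (intro ext g_eqI[OF assms(1)]) (simp add: g_\<Gamma>[OF assms(1)] K_def S_def assms(2,3))

text \<open>Since \<Gamma> vanishes at \<open>p\<close>, the variation of the metric drops out. The
  curvature with its last index lowered is thus read off from derivatives of \<open>K\<close>,
  without inverting \<open>g\<close>.\<close>

lemma g_derivative_\<Gamma>:
  assumes "p \<in> U" "\<Gamma> p = (\<lambda>u v. 0)"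
  shows "g p (frechet_derivative (\<lambda>q. \<Gamma> q u v) (at p) x) w = frechet_derivative (\<lambda>q. K q u v w) (at p) x"
proof -
  have "g q (\<Gamma> q u v) w = K q u v w" if "q \<in> U" for q
    by (rule g_\<Gamma>[OF that])
  then have "frechet_derivative (\<lambda>q. K q u v w) (at p) = frechet_derivative (\<lambda>q. g q (\<Gamma> q u v) w) (at p)"
    using frechet_derivative_cong_open[OF open_U assms(1), of "\<lambda>q. g q (\<Gamma> q u v) w" "\<lambda>q. K q u v w"] by simp
  moreover have "frechet_derivative (\<lambda>q. g q 0 w) (at p) x = 0"
    using frechet_derivative_cong_open[OF open_U assms(1), of "\<lambda>q. g q 0 w" "\<lambda>q. 0"]
      linear_0[OF linear_g(2)] by simp
  moreover have "((\<lambda>q. g q (\<Gamma> q u v) w) has_derivative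
      (\<lambda>y. frechet_derivative (\<lambda>q. g q (\<Gamma> p u v) w) (at p) y
        + g p (frechet_derivative (\<lambda>q. \<Gamma> q u v) (at p) y) w
        + g p (\<Gamma> p u v) (frechet_derivative (\<lambda>_. w) (at p) y))) (at p)"
    by (rule has_derivative_g_field[OF smooth_\<Gamma> smooth_on_const assms(1)])
  note fun_cong[OF frechet_derivative_at[OF this], of x]
  ultimately show ?thesis
    using linear_0[OF linear_g(1)[OF assms(1)]] by (simp add: assms(2))
qed

end

section \<open>Second-order data realizing a curvature model\<close>

text \<open>For a curvature model, \<open>F\<close> is the alternating Ricci tensor times
  \<open>- 2 / m\<close>. Characterizing it by \<open>A_trace\<close> keeps traces out of the
  algebra.\<close>

locale kaehler_weyl_algebra =
  fixes k :: kind and b :: "'v::real_vector \<Rightarrow> 'v \<Rightarrow> real" and J :: "'v \<Rightarrow> 'v"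
    and A :: "'v tensor4" and F :: "'v \<Rightarrow> 'v \<Rightarrow> real"
  assumes linear_b: "\<And>x. linear (b x)" and b_commute: "\<And>x y. b x y = b y x"
    and linear_J: "linear J" and J_J: "\<And>x. J (J x) = sgn_of k *\<^sub>R x"
    and b_hermitian: "\<And>x y. b (J x) (J y) = - sgn_of k * b x y"
    and linear_F: "\<And>x. linear (F x)" and F_swap: "\<And>x y. F x y = - F y x"
    and A_linear: "multilinear4 A"
    and A_swap: "\<And>x y z w. A x y z w = - A y x z w"
    and A_bianchi: "\<And>x y z w. A x y z w + A y z x w + A z x y w = 0"
    and A_trace: "\<And>x y z w. A x y z w + A x y w z = 2 * F x y * b z w"
    and A_J: "\<And>x y z w. A x y (J z) (J w) = - sgn_of k * A x y z w"
begin

lemma b_linear_simps: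
  "b (x + x') y = b x y + b x' y" "b (r *\<^sub>R x) y = r * b x y"
  "b y (x + x') = b y x + b y x'" "b y (r *\<^sub>R x) = r * b y x"
  "b (- x) y = - b x y" "b y (- x) = - b y x"
  using linear_add[OF linear_b] linear_scale[OF linear_b] linear_neg[OF linear_b] by (simp_all add: b_commute[of _ y])

lemma J_linear_simps: "J (x + y) = J x + J y" "J (r *\<^sub>R x) = r *\<^sub>R J x" "J (- x) = - J x"
  using linear_neg[OF linear_J] linear_add[OF linear_J] linear_scale[OF linear_J] by simp_all

lemma F_linear_simps:
  "F (x + x') y = F x y + F x' y" "F (r *\<^sub>R x) y = r * F x y"
  "F y (x + x') = F y x + F y x'" "F y (r *\<^sub>R x) = r * F y x"
  "F (- x) y = - F x y" "F y (- x) = - F y x"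
  using linear_add[OF linear_F] linear_scale[OF linear_F] linear_neg[OF linear_F] by (simp_all add: F_swap[of _ y])

lemma A_linear_simps:
  "A (x + x') y z w = A x y z w + A x' y z w" "A (r *\<^sub>R x) y z w = r * A x y z w"
  "A x (y + y') z w = A x y z w + A x y' z w" "A x (r *\<^sub>R y) z w = r * A x y z w"
  "A x y (z + z') w = A x y z w + A x y z' w" "A x y (r *\<^sub>R z) w = r * A x y z w"
  "A x y z (w + w') = A x y z w + A x y z w'" "A x y z (r *\<^sub>R w) = r * A x y z w" "A x y z (- w) = - A x y z w"
  using A_linear linear_neg[of "\<lambda>w. A x y z w"] linear_add[of "\<lambda>x. A x y z w"] linear_add[of "\<lambda>y. A x y z w"]
    linear_add[of "\<lambda>z. A x y z w"] linear_add[of "\<lambda>w. A x y z w"]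
    linear_scale[of "\<lambda>x. A x y z w"] linear_scale[of "\<lambda>y. A x y z w"]
    linear_scale[of "\<lambda>z. A x y z w"] linear_scale[of "\<lambda>w. A x y z w"]
  unfolding multilinear4_def by simp_all

lemma b_skew: "b (J x) y = - b x (J y)"
  using b_hermitian[of x "J y"] by (cases k) (simp_all add: J_J b_linear_simps)

lemma b_J_swap: "b x (J y) = - b y (J x)"
  using b_skew[of x y] b_commute[of "J x" y] by simp

lemma A_skew: "A x y (J z) w = - A x y z (J w)"
  using A_J[of x y z "J w"] by (cases k) (simp_all add: J_J A_linear_simps)

text \<open>The full antisymmetrization of \<open>A x y z (J w)\<close> vanishes by the Bianchi identity, while its
  part skew in \<open>z\<close> and \<open>w\<close> is \<open>F x y * b z (J w)\<close>: hence \<open>F\<close> wedged with the Kaehler form is zero.\<close>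

lemma F_wedge:
  "F x y * b z (J w) + F z w * b x (J y) - F x z * b y (J w) - F y w * b x (J z)
    + F x w * b y (J z) + F y z * b x (J w) = 0"
proof -
  have tr: "A p q r (J s) - A p q s (J r) = 2 * (F p q * b r (J s))" for p q r s
    using A_trace[of p q r "J s"] A_skew[of p q s r] by simp
  show ?thesis
    using tr[of x y z w] tr[of z w x y] tr[of x z y w] tr[of y w x z] tr[of x w y z] tr[of y z x w]
      A_bianchi[of x y z "J w"] A_bianchi[of x y w "J z"] A_bianchi[of x z w "J y"] A_bianchi[of y z w "J x"]
      A_swap[of z x y "J w"] A_swap[of w x y "J z"] A_swap[of w x z "J y"] A_swap[of w y z "J x"]
    by linarith
qed

text \<open>The 3-form \<open>d\<Omega>\<close> prescribed at second order has the Poincare primitive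
  \<open>F(x,-) \<and> \<Omega>\<^sub>0(x,-) / 4\<close>. An exact form removes the part of it that is not Hermitian; this
  multiplies the Hermitian part by 2 for the \<open>J\<close>-Hermitian part of \<open>F\<close> and by 4/3 for the other part,
  hence the weights 1/2 and 1/3 that are combined in \<open>Ft\<close>.\<close>

definition Ft where "Ft x y = (5 * F x y - sgn_of k * F (J x) (J y)) / 12"

text \<open>Twice the Hermitian part, in \<open>z\<close> and \<open>w\<close>, of the symmetric
  product of \<open>Ft x\<close> and \<open>b y\<close>.\<close>

definition HF0 where "HF0 x y z w = Ft x z * b y w + Ft x w * b y z
  - sgn_of k * (Ft x (J z) * b y (J w) + Ft x (J w) * b y (J z))"

text \<open>Polarized in \<open>x\<close> and \<open>y\<close>: the metric contains half of
  \<open>HF p p\<close>, whose derivative in direction \<open>u\<close> is then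
  \<open>HF p u\<close>.\<close>

definition HF where "HF x y z w = (HF0 x y z w + HF0 y x z w) / 2"

text \<open>The derivative at the origin, in direction \<open>x\<close>, of the tensor
  \<open>S\<close> of a chart whose metric has second-order part \<open>HF\<close> and whose form
  \<phi> is half of \<open>F p\<close> to first order.\<close>

definition SF where "SF x y z w = HF x y z w + F x y * b z w"

lemma Ft_linear_simps:
  "Ft (x + x') y = Ft x y + Ft x' y" "Ft (r *\<^sub>R x) y = r * Ft x y"
  "Ft y (x + x') = Ft y x + Ft y x'" "Ft y (r *\<^sub>R x) = r * Ft y x"
  by (simp_all add: Ft_def J_linear_simps F_linear_simps algebra_simps add_divide_distrib diff_divide_distrib)

lemma HF_linear_simps:
  "HF (x + x') y z w = HF x y z w + HF x' y z w" "HF (r *\<^sub>R x) y z w = r * HF x y z w"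
  "HF x (y + y') z w = HF x y z w + HF x y' z w" "HF x (r *\<^sub>R y) z w = r * HF x y z w"
  "HF x y (z + z') w = HF x y z w + HF x y z' w" "HF x y (r *\<^sub>R z) w = r * HF x y z w"
  "HF x y z (w + w') = HF x y z w + HF x y z w'" "HF x y z (r *\<^sub>R w) = r * HF x y z w"
  by (simp_all add: HF_def HF0_def Ft_linear_simps b_linear_simps J_linear_simps algebra_simps
      add_divide_distrib diff_divide_distrib)

lemma HF_swap: "HF x y z w = HF y x z w" "HF x y z w = HF x y w z"
  by (simp_all add: HF_def HF0_def algebra_simps)

lemma HF_skew: "HF x y (J z) w = - HF x y z (J w)"
  unfolding HF_def HF0_def Ft_def
  by (cases k) (simp_all add: J_J F_linear_simps J_linear_simps b_linear_simps b_skew field_simps)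

text \<open>This is where the weights in \<open>Ft\<close> are confirmed: the Kaehler form of the
  \<open>HF\<close> part has the prescribed differential, as a linear consequence of
  \<open>F_wedge\<close>.\<close>

lemma SF_kaehler: "SF x u v (J w) + SF x v w (J u) + SF x w u (J v) = 0"
proof -
  \<comment> \<open>Swaps are instantiated in one direction only, so that rewriting terminates and
    every product takes a unique normal form.\<close>
  note rules = b_commute[of u x] b_commute[of v x] b_commute[of w x] b_commute[of v u] b_commute[of w u]
    b_commute[of w v] b_J_swap[of u x] b_J_swap[of v x] b_J_swap[of w x] b_J_swap[of v u] b_J_swap[of w u]
    b_J_swap[of w v]
    F_swap[of u x] F_swap[of v x] F_swap[of w x] F_swap[of v u] F_swap[of w u] F_swap[of w v]
    F_swap[of u "J x"] F_swap[of v "J x"] F_swap[of w "J x"] F_swap[of v "J u"] F_swap[of w "J u"] F_swap[of w "J v"]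
    F_swap[of "J u" x] F_swap[of "J v" x] F_swap[of "J w" x] F_swap[of "J v" u] F_swap[of "J w" u] F_swap[of "J w" v]
    F_swap[of "J u" "J x"] F_swap[of "J v" "J x"] F_swap[of "J w" "J x"] F_swap[of "J v" "J u"]
    F_swap[of "J w" "J u"] F_swap[of "J w" "J v"]
  \<comment> \<open>Every product in the expansion carries an odd number of \<open>J\<close>, so the
    matching identities are the eight with \<open>J\<close> inserted into evenly many of the four
    arguments.\<close>
  note wedge = F_wedge[of x u v w] F_wedge[of "J x" "J u" v w] F_wedge[of "J x" u "J v" w]
    F_wedge[of "J x" u v "J w"] F_wedge[of x "J u" "J v" w] F_wedge[of x "J u" v "J w"]
    F_wedge[of x u "J v" "J w"] F_wedge[of "J x" "J u" "J v" "J w"]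
  show ?thesis
    using wedge
    unfolding SF_def HF_def HF0_def Ft_def
    by (cases k; simp add: J_J F_linear_simps b_linear_simps b_skew J_linear_simps rules field_simps;
        linarith)
qed

text \<open>The curvature at the origin of such a chart: the Koszul expression built from
  \<open>SF\<close>, alternated in \<open>x\<close> and \<open>y\<close>.\<close>

definition C where "C x y z w = (SF x y z w + SF x z y w - SF x w y z
  - (SF y x z w + SF y z x w - SF y w x z)) / 2"

lemma SF_linear_simps:
  "SF (x + x') y z w = SF x y z w + SF x' y z w" "SF (r *\<^sub>R x) y z w = r * SF x y z w"
  "SF x (y + y') z w = SF x y z w + SF x y' z w" "SF x (r *\<^sub>R y) z w = r * SF x y z w"
  "SF x y (z + z') w = SF x y z w + SF x y z' w" "SF x y (r *\<^sub>R z) w = r * SF x y z w"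
  "SF x y z (w + w') = SF x y z w + SF x y z w'" "SF x y z (r *\<^sub>R w) = r * SF x y z w"
  by (simp_all add: SF_def HF_linear_simps F_linear_simps b_linear_simps algebra_simps)

lemma C_linear_simps:
  "C (x + x') y z w = C x y z w + C x' y z w" "C (r *\<^sub>R x) y z w = r * C x y z w"
  "C x (y + y') z w = C x y z w + C x y' z w" "C x (r *\<^sub>R y) z w = r * C x y z w"
  "C x y (z + z') w = C x y z w + C x y z' w" "C x y (r *\<^sub>R z) w = r * C x y z w"
  "C x y z (w + w') = C x y z w + C x y z w'" "C x y z (r *\<^sub>R w) = r * C x y z w"
  by (simp_all add: C_def SF_linear_simps algebra_simps add_divide_distrib diff_divide_distrib)

lemma SF_commute: "SF x u v w = SF x u w v"
  using HF_swap(2)[of x u v w] b_commute[of v w] by (simp add: SF_def)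

lemma C_skew: "C x y (J z) w = - C x y z (J w)"
proof -
  have skew: "SF x u (J v) w = - SF x u v (J w)" for x u v w
    by (simp add: SF_def HF_skew b_skew)
  have JJ: "SF x u v (J (J w)) = sgn_of k * SF x u v w" for x u v w
    by (simp add: J_J SF_linear_simps)
  have "SF x u (J v) w + SF x (J v) u w - SF x w u (J v)
      = - (SF x u v (J w) + SF x v u (J w) - SF x (J w) u v)" for x u v w
    by (rule koszul_skew[of "SF x" J k, OF SF_commute skew JJ SF_kaehler])
  from this[of x y z w] this[of y x z w] show ?thesis
    unfolding C_def by (simp add: field_simps)
qed

section \<open>The Riemannian Kaehler part of the curvature\<close>

definition AR where "AR x y z w = A x y z w - C x y z w"

lemma AR_linear_simps:
  "AR (x + x') y z w = AR x y z w + AR x' y z w" "AR (r *\<^sub>R x) y z w = r * AR x y z w"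
  "AR x (y + y') z w = AR x y z w + AR x y' z w" "AR x (r *\<^sub>R y) z w = r * AR x y z w"
  "AR x y (z + z') w = AR x y z w + AR x y z' w" "AR x y (r *\<^sub>R z) w = r * AR x y z w"
  "AR x y z (w + w') = AR x y z w + AR x y z w'" "AR x y z (r *\<^sub>R w) = r * AR x y z w"
  by (simp_all add: AR_def C_linear_simps A_linear_simps algebra_simps)

text \<open>\<open>A\<close> and \<open>C\<close> have the same part symmetric in the last two
  arguments, the one prescribed by \<open>F\<close>, so it cancels in the difference.\<close>

lemma AR_swap: "AR x y z w = - AR y x z w" "AR x y z w = - AR x y w z"
proof -
  show "AR x y z w = - AR y x z w"
    using A_swap[of x y z w] by (simp add: AR_def C_def field_simps)
  have "C x y z w + C x y w z = 2 * F x y * b z w"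
    using SF_commute[of x y z w] SF_commute[of y x z w] F_swap[of x y] HF_swap(1)[of x y z w]
      SF_commute[of x z y w] SF_commute[of x w y z] SF_commute[of y z x w] SF_commute[of y w x z]
    by (simp add: C_def SF_def field_simps)
  then show "AR x y z w = - AR x y w z"
    using A_trace[of x y z w] by (simp add: AR_def)
qed

lemma AR_bianchi: "AR x y z w + AR y z x w + AR z x y w = 0"
  using A_bianchi[of x y z w] SF_commute[of x y z w] SF_commute[of y z x w] SF_commute[of z x y w]
    SF_commute[of x z y w] SF_commute[of z y x w] SF_commute[of y x z w]
    SF_commute[of x w y z] SF_commute[of y w x z] SF_commute[of z w x y]
  by (simp add: AR_def C_def field_simps)

text \<open>The octahedron argument: combine the four Bianchi identities obtained by rotating the
  arguments.\<close>

lemma AR_pair: "AR x y z w = AR z w x y"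
  using AR_bianchi[of x y z w] AR_bianchi[of y z w x] AR_bianchi[of z w x y] AR_bianchi[of w x y z]
    AR_swap(2)[of x y z w] AR_swap(2)[of z w x y] AR_swap(2)[of y z x w] AR_swap(2)[of w x y z]
    AR_swap(1)[of x z y w] AR_swap(2)[of x z w y] AR_swap(1)[of w y z x] AR_swap(2)[of y w z x]
  by linarith

lemma AR_skew: "AR x y (J z) w = - AR x y z (J w)"
  by (simp add: AR_def A_skew C_skew)

lemma AR_skew': "AR (J x) y z w = - AR x (J y) z w"
  using AR_skew[of z w x y] AR_pair[of "J x" y z w] AR_pair[of x "J y" z w] by simp

text \<open>A Kaehler metric with curvature \<open>AR\<close> at the origin has this second-order part in complex normal
  coordinates.\<close>

definition HR where "HR x y z w = - sgn_of k * AR z (J w) x (J y)"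

lemma HR_swap: "HR x y z w = HR y x z w" "HR x y z w = HR x y w z"
  using AR_skew[of z "J w" x y] AR_swap(2)[of z "J w" "J x" y] AR_skew'[of z w x "J y"] AR_swap(1)[of "J z" w x "J y"]
  by (simp_all add: HR_def)

lemma HR_skew: "HR x y (J z) w = - HR x y z (J w)"
  by (simp add: HR_def AR_skew')

text \<open>Once the extra \<open>J\<close> is absorbed, closedness of the Kaehler form is the first
  Bianchi identity of \<open>AR\<close>.\<close>

lemma HR_kaehler: "HR x u v (J w) + HR x v w (J u) + HR x w u (J v) = 0"
proof -
  have "HR x p q (J r) = AR q r (J x) p" for p q r
    by (simp add: HR_def J_J AR_linear_simps AR_skew[of q r x p])
  then show ?thesis
    using AR_bianchi[of v w u "J x"] AR_swap(2)[of v w "J x" u] AR_swap(2)[of w u "J x" v]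
      AR_swap(2)[of u v "J x" w]
    by simp
qed

text \<open>The left side is the curvature at a point where the first derivatives of the metric
  vanish and the second ones are \<open>HR\<close>. Pair symmetry matches the four terms in twos,
  and the Bianchi identity moves both \<open>J\<close> into the second pair.\<close>

lemma HR_curvature: "(HR x z y w - HR x w y z - HR y z x w + HR y w x z) / 2 = AR x y z w"
proof -
  have 1: "AR y (J w) x (J z) = AR x (J z) y (J w)" "AR y (J z) x (J w) = AR x (J w) y (J z)"
    by (rule AR_pair)+
  have "AR x (J z) y (J w) - AR y (J z) x (J w) = AR x y (J z) (J w)"
    using AR_bianchi[of x "J z" y "J w"] AR_swap(1)[of "J z" y x "J w"] AR_swap(1)[of y x "J z" "J w"] by linarith
  moreover have "AR x y (J z) (J w) = - sgn_of k * AR x y z w"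
    using AR_skew[of x y z "J w"] by (simp add: J_J AR_linear_simps)
  ultimately have "sgn_of k * AR x (J z) y (J w) - sgn_of k * AR y (J z) x (J w) = - AR x y z w"
    by (simp add: right_diff_distrib[symmetric])
  then show ?thesis
    unfolding HR_def 1[symmetric] by (simp add: 1)
qed

definition H where "H x y z w = HF x y z w + HR x y z w"

lemma H_linear_simps:
  "H (x + x') y z w = H x y z w + H x' y z w" "H (r *\<^sub>R x) y z w = r * H x y z w"
  "H x (y + y') z w = H x y z w + H x y' z w" "H x (r *\<^sub>R y) z w = r * H x y z w"
  "H x y (z + z') w = H x y z w + H x y z' w" "H x y (r *\<^sub>R z) w = r * H x y z w"
  "H x y z (w + w') = H x y z w + H x y z w'" "H x y z (r *\<^sub>R w) = r * H x y z w"
  by (simp_all add: H_def HR_def HF_linear_simps AR_linear_simps J_linear_simps algebra_simps)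

lemma H_swap: "H x y z w = H y x z w" "H x y z w = H x y w z"
  using HF_swap[of x y z w] HR_swap[of x y z w] by (simp_all add: H_def)

lemma H_hermitian: "H x y (J z) (J w) = - sgn_of k * H x y z w"
  using HF_skew[of x y z "J w"] HR_skew[of x y z "J w"]
  by (simp add: H_def HR_def J_J HF_linear_simps AR_linear_simps J_linear_simps algebra_simps)

lemma H_kaehler:
  "H x u v (J w) + H x v w (J u) + H x w u (J v) + F x u * b v (J w) + F x v * b w (J u) + F x w * b u (J v) = 0"
  using SF_kaehler[of x u v w] HR_kaehler[of x u v w] by (simp add: H_def SF_def)

text \<open>\<open>HR\<close> is symmetric in its first two arguments, so only the four terms of
  \<open>HR_curvature\<close> survive and give \<open>AR\<close>; the remaining terms give
  \<open>C\<close>.\<close>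

lemma H_curvature:
  defines "S \<equiv> \<lambda>x y z w. H x y z w + F x y * b z w"
  shows "A x y z w = (S x y z w + S x z y w - S x w y z - (S y x z w + S y z x w - S y w x z)) / 2"
  using HR_curvature[of x z y w] HR_swap(1)[of x y z w]
  unfolding S_def H_def by (simp add: AR_def C_def SF_def field_simps)

end

section \<open>Two-forms in dimension four\<close>

definition wedge :: "('v \<Rightarrow> 'v \<Rightarrow> real) \<Rightarrow> ('v \<Rightarrow> 'v \<Rightarrow> real) \<Rightarrow> 'v \<Rightarrow> 'v \<Rightarrow> 'v \<Rightarrow> 'v \<Rightarrow> real"
  where "wedge P Q x y z w = P x y * Q z w + P z w * Q x y - P x z * Q y w - P y w * Q x z
    + P x w * Q y z + P y z * Q x w"

text \<open>The determinant with these four rows, by Laplace expansion along the first two: products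
  of complementary minors, as they arise in a wedge of two 2-forms.\<close>

definition det4 :: "real list \<Rightarrow> real list \<Rightarrow> real list \<Rightarrow> real list \<Rightarrow> real"
  where "det4 x y z w = (let m = (\<lambda>x y i j. x ! i * y ! j - x ! j * y ! i) in
    m x y 0 1 * m z w 2 3 - m x y 0 2 * m z w 1 3 + m x y 0 3 * m z w 1 2
    + m x y 1 2 * m z w 0 3 - m x y 1 3 * m z w 0 2 + m x y 2 3 * m z w (0::nat) (Suc 0))"

lemma alternating_expand4:
  fixes P :: "'v::real_vector \<Rightarrow> 'v \<Rightarrow> real"
  assumes "bilinear P" "\<And>x y. P x y = - P y x"
  shows "P (x0 *\<^sub>R e0 + x1 *\<^sub>R e1 + x2 *\<^sub>R e2 + x3 *\<^sub>R e3) (y0 *\<^sub>R e0 + y1 *\<^sub>R e1 + y2 *\<^sub>R e2 + y3 *\<^sub>R e3)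
    = (x0 * y1 - x1 * y0) * P e0 e1 + (x0 * y2 - x2 * y0) * P e0 e2 + (x0 * y3 - x3 * y0) * P e0 e3
    + (x1 * y2 - x2 * y1) * P e1 e2 + (x1 * y3 - x3 * y1) * P e1 e3 + (x2 * y3 - x3 * y2) * P e2 e3"
proof -
  have "P z z = 0" for z
    using assms(2)[of z z] by simp
  then show ?thesis
    using assms(2)[of e1 e0] assms(2)[of e2 e0] assms(2)[of e3 e0] assms(2)[of e2 e1]
      assms(2)[of e3 e1] assms(2)[of e3 e2]
    by (simp add: bilinear_ladd[OF assms(1)] bilinear_radd[OF assms(1)] bilinear_lmul[OF assms(1)]
        bilinear_rmul[OF assms(1)] algebra_simps)
qed

lemma wedge_expand4:
  fixes P Q :: "'v::real_vector \<Rightarrow> 'v \<Rightarrow> real"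
  assumes P: "bilinear P" "\<And>x y. P x y = - P y x" and Q: "bilinear Q" "\<And>x y. Q x y = - Q y x"
  shows "wedge P Q (x0 *\<^sub>R e0 + x1 *\<^sub>R e1 + x2 *\<^sub>R e2 + x3 *\<^sub>R e3)
      (y0 *\<^sub>R e0 + y1 *\<^sub>R e1 + y2 *\<^sub>R e2 + y3 *\<^sub>R e3)
      (z0 *\<^sub>R e0 + z1 *\<^sub>R e1 + z2 *\<^sub>R e2 + z3 *\<^sub>R e3)
      (w0 *\<^sub>R e0 + w1 *\<^sub>R e1 + w2 *\<^sub>R e2 + w3 *\<^sub>R e3)
    = det4 [x0, x1, x2, x3] [y0, y1, y2, y3] [z0, z1, z2, z3] [w0, w1, w2, w3] * wedge P Q e0 e1 e2 e3"
  unfolding wedge_def alternating_expand4[OF P] alternating_expand4[OF Q] det4_def Let_def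
  by (simp add: numeral_2_eq_2 numeral_3_eq_3) algebra

text \<open>Top-degree forms on a space spanned by four vectors are proportional. The
  cross-multiplied form requires no nonvanishing; fixing \<open>x\<close> turns it into an identity
  between 3-forms.\<close>

lemma wedge_proportional4:
  fixes P Q :: "'v::real_vector \<Rightarrow> 'v \<Rightarrow> real"
  assumes P: "bilinear P" "\<And>x y. P x y = - P y x" and Q: "bilinear Q" "\<And>x y. Q x y = - Q y x"
    and span: "\<And>v. \<exists>a0 a1 a2 a3. v = a0 *\<^sub>R e0 + a1 *\<^sub>R e1 + a2 *\<^sub>R e2 + a3 *\<^sub>R e3"
  shows "wedge P Q x y z w * wedge P P e0 e1 e2 e3 = wedge P P x y z w * wedge P Q e0 e1 e2 e3"
proof -
  obtain x0 x1 x2 x3 where x: "x = x0 *\<^sub>R e0 + x1 *\<^sub>R e1 + x2 *\<^sub>R e2 + x3 *\<^sub>R e3"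
    using span by blast
  obtain y0 y1 y2 y3 where y: "y = y0 *\<^sub>R e0 + y1 *\<^sub>R e1 + y2 *\<^sub>R e2 + y3 *\<^sub>R e3"
    using span by blast
  obtain z0 z1 z2 z3 where z: "z = z0 *\<^sub>R e0 + z1 *\<^sub>R e1 + z2 *\<^sub>R e2 + z3 *\<^sub>R e3"
    using span by blast
  obtain w0 w1 w2 w3 where w: "w = w0 *\<^sub>R e0 + w1 *\<^sub>R e1 + w2 *\<^sub>R e2 + w3 *\<^sub>R e3"
    using span by blast
  show ?thesis
    unfolding x y z w wedge_expand4[OF P P] wedge_expand4[OF P Q] by simp
qed

section \<open>Realization at the origin\<close>

definition (in kaehler_weyl_algebra) metric :: "'v \<Rightarrow> 'v \<Rightarrow> 'v \<Rightarrow> real"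
  where "metric p v w = b v w + H p p v w / 2"

context kaehler_weyl_algebra
begin

lemma bilinear_metric: "bilinear (metric p)"
  unfolding bilinear_def
  by (auto intro!: linearI simp: metric_def H_linear_simps b_linear_simps algebra_simps add_divide_distrib)

lemma metric_commute: "metric p v w = metric p w v"
  using b_commute[of v w] H_swap(2)[of p p v w] by (simp add: metric_def)

lemma metric_hermitian: "metric p (J v) (J w) = - sgn_of k * metric p v w"
  using b_hermitian[of v w] H_hermitian[of p p v w] by (simp add: metric_def algebra_simps)

lemma metric_0: "metric 0 = b"
  using H_linear_simps(2)[of 0] by (simp add: metric_def fun_eq_iff)

end

locale euclidean_model = kaehler_weyl_algebra k b J A F
  for k and b :: "'e::euclidean_space \<Rightarrow> 'e \<Rightarrow> real" and J A F
begin

lemma bounded_bilinear_H: "bounded_bilinear (\<lambda>x y. H x y v w)"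
  unfolding bilinear_conv_bounded_bilinear[symmetric]
  by (auto simp: bilinear_def H_linear_simps intro!: linearI)

lemma bounded_bilinear_F: "bounded_bilinear F"
  unfolding bilinear_conv_bounded_bilinear[symmetric]
  by (auto simp: bilinear_def F_linear_simps intro!: linearI)

lemma smooth_metric: "open U \<Longrightarrow> smooth_on U (\<lambda>p. metric p v w)"
  unfolding metric_def
  by (intro smooth_on_add smooth_on_divide smooth_on_const smooth_on_bilinear[OF _ bounded_bilinear_H]
      smooth_on_id) auto

lemma metric_derivative: "frechet_derivative (\<lambda>q. metric q v w) (at p) = (\<lambda>u. H p u v w)"
proof -
  have "((\<lambda>q. metric q v w) has_derivative (\<lambda>u. 0 + (H p u v w + H u p v w) / 2)) (at p)"
    unfolding metric_def
    by (intro has_derivative_add has_derivative_const bounded_linear.has_derivative[OF bounded_linear_divide]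
        bounded_bilinear.FDERIV[OF bounded_bilinear_H] has_derivative_ident)
  from frechet_derivative_at[OF this, symmetric] show ?thesis
    using H_swap(1)[of _ p v w] by simp
qed

end

locale second_order_chart = euclidean_model k b "std_J k" A F
  for k and b :: "(real ^ 'k::finite) \<times> (real ^ 'k) \<Rightarrow> (real ^ 'k) \<times> (real ^ 'k) \<Rightarrow> real" and A F +
  fixes U :: "((real ^ 'k) \<times> (real ^ 'k)) set"
    and \<phi> :: "(real ^ 'k) \<times> (real ^ 'k) \<Rightarrow> (real ^ 'k) \<times> (real ^ 'k) \<Rightarrow> real"
  assumes open_U: "open U" and origin: "0 \<in> U"
    and metric_nondegenerate: "\<And>p v. p \<in> U \<Longrightarrow> (\<And>w. metric p v w = 0) \<Longrightarrow> v = 0"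
    and linear_\<phi>: "\<And>p. p \<in> U \<Longrightarrow> linear (\<phi> p)"
    and smooth_\<phi>: "\<And>v. smooth_on U (\<lambda>p. \<phi> p v)"
    and \<phi>_wedge: "\<And>p u v w. p \<in> U \<Longrightarrow>
      2 * \<phi> p u * metric p v (std_J k w) + 2 * \<phi> p v * metric p w (std_J k u) + 2 * \<phi> p w * metric p u (std_J k v)
      = F p u * b v (std_J k w) + F p v * b w (std_J k u) + F p w * b u (std_J k v)"
    and \<phi>_0: "\<phi> 0 = (\<lambda>u. 0)"
    and \<phi>_derivative: "\<And>u. ((\<lambda>q. \<phi> q u) has_derivative (\<lambda>x. F x u / 2)) (at 0)"

begin

sublocale chart: conformal_kaehler_chart U k metric \<phi>
proof
  show "frechet_derivative (\<lambda>q. metric q v (std_J k w)) (at p) u + 2 * \<phi> p u * metric p v (std_J k w)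
    + (frechet_derivative (\<lambda>q. metric q w (std_J k u)) (at p) v + 2 * \<phi> p v * metric p w (std_J k u))
    + (frechet_derivative (\<lambda>q. metric q u (std_J k v)) (at p) w + 2 * \<phi> p w * metric p u (std_J k v)) = 0"
    if "p \<in> U" for p u v w
    \<comment> \<open>The derivative of the metric is \<open>H p\<close> at every point, so
      \<open>H_kaehler\<close> computes d\<Omega> exactly throughout \<open>U\<close>.\<close>
    using \<phi>_wedge[OF that, of u v w] H_kaehler[of p u v w] unfolding metric_derivative by linarith
qed ((fact open_U metric_nondegenerate smooth_\<phi>)
    | (rule bilinear_metric metric_commute smooth_metric[OF open_U] metric_hermitian) | simp add: linear_add[OF linear_\<phi>] linear_scale[OF linear_\<phi>])+

lemma \<Gamma>_0: "chart.\<Gamma> 0 = (\<lambda>u v. 0)"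
  using H_linear_simps(2)[of 0] by (intro chart.\<Gamma>_eq_0[OF origin]) (simp_all add: metric_derivative \<phi>_0)

text \<open>As \<phi> vanishes at the origin, the product of \<phi> with the metric contributes only
  through the derivative of \<phi>.\<close>

lemma S_derivative: "((\<lambda>q. chart.S q u v w) has_derivative (\<lambda>x. H x u v w + F x u * b v w)) (at 0)"
proof -
  have 1: "((\<lambda>q. H q u v w) has_derivative (\<lambda>x. H x u v w)) (at 0)"
    using bounded_bilinear.bounded_linear_left[OF bounded_bilinear_H] by (rule bounded_linear_imp_has_derivative)
  have "((\<lambda>q. metric q v w) has_derivative (\<lambda>x. H 0 x v w)) (at 0)"
    using smooth_on_has_derivative[OF smooth_metric[OF open_U] origin] by (simp add: metric_derivative)
  then have "((\<lambda>q. 2 * \<phi> q u * metric q v w) has_derivative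
      (\<lambda>x. 2 * \<phi> 0 u * H 0 x v w + 2 * (F x u / 2) * metric 0 v w)) (at 0)"
    by (intro has_derivative_mult has_derivative_mult_right \<phi>_derivative)
  from has_derivative_add[OF 1 this] show ?thesis
    by (simp add: chart.S_def metric_derivative \<phi>_0 metric_0)
qed

lemma K_derivative:
  "frechet_derivative (\<lambda>q. chart.K q u v w) (at 0) x
    = (H x u v w + F x u * b v w + (H x v u w + F x v * b u w) - (H x w u v + F x w * b u v)) / 2"
proof -
  have "((\<lambda>q. chart.K q u v w) has_derivative (\<lambda>x. ((H x u v w + F x u * b v w)
      + (H x v u w + F x v * b u w) - (H x w u v + F x w * b u v)) / 2)) (at 0)"
    unfolding chart.K_def
    by (intro has_derivative_add has_derivative_diff bounded_linear.has_derivative[OF bounded_linear_divide]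
        S_derivative)
  from fun_cong[OF frechet_derivative_at[OF this], of x] show ?thesis
    by (rule sym)
qed

lemma curvature_tensor_origin:
  "curvature_tensor chart.M chart.gM chart.D 0 (chart.tv x) (chart.tv y) (chart.tv z) (chart.tv w) = A x y z w"
  unfolding chart.curvature_tensor_tv[OF origin \<Gamma>_0] chart.g_derivative_\<Gamma>[OF origin \<Gamma>_0] K_derivative
    H_curvature[of x y z w]
  by (simp add: diff_divide_distrib)

lemma realization:
  "\<exists>(M :: ((real ^ 'k) \<times> (real ^ 'k), (real ^ 'k) \<times> (real ^ 'k)) mfd) g JM D P \<Phi>.
    kaehler_weyl_manifold k M g JM D \<and> P \<in> pts M \<and>
    linear \<Phi> \<and> bij_betw \<Phi> UNIV (tangent_space M P) \<and>
    (\<forall>x y. g P (\<Phi> x) (\<Phi> y) = b x y) \<and>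
    (\<forall>x. JM P (\<Phi> x) = \<Phi> (std_J k x)) \<and>
    (\<forall>x y z w. curvature_tensor M g D P (\<Phi> x) (\<Phi> y) (\<Phi> z) (\<Phi> w) = A x y z w)"
proof (intro exI conjI allI)
  show "kaehler_weyl_manifold k chart.M chart.gM chart.JM chart.D"
    by (rule chart.kaehler_weyl_manifold_M)
  show "0 \<in> pts chart.M"
    using origin by simp
  show "bij_betw chart.tv UNIV (tangent_space chart.M 0)"
    using origin by (simp add: bij_betw_def chart.tangent_space_M inj_on_def)
qed (simp_all add: chart.linear_tv chart.gM_def chart.JM_def metric_0 curvature_tensor_origin)

end

section \<open>Solving for the Lee form in an adapted frame\<close>

locale framed_model = euclidean_model k b "std_J k" A F
  for k and b :: "(real ^ 'k::finite) \<times> (real ^ 'k) \<Rightarrow> (real ^ 'k) \<times> (real ^ 'k) \<Rightarrow> real" and A F +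
  assumes b_nondegenerate: "\<And>v. (\<And>w. b v w = 0) \<Longrightarrow> v = 0"
    and frame_orthogonal: "\<And>i j. i \<noteq> j \<Longrightarrow> b (axis i 1, 0) (axis j 1, 0) = 0"
      "\<And>i j. i \<noteq> j \<Longrightarrow> b (axis i 1, 0) (0, axis j 1) = 0"
    and frame_nonnull: "\<And>i. b (axis i 1, 0) (axis i 1, 0) \<noteq> 0"
begin

abbreviation e :: "'k \<Rightarrow> (real ^ 'k) \<times> (real ^ 'k)" where "e i \<equiv> (axis i 1, 0)"

lemma std_J_e: "(0, axis i 1) = std_J k (e i)"
  by (simp add: std_J_def)

lemma b_frame:
  assumes "i \<noteq> j"
  shows "b (e i) (e j) = 0" "b (e i) (std_J k (e j)) = 0" "b (std_J k (e i)) (e j) = 0"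
    "b (std_J k (e i)) (std_J k (e j)) = 0" "b (e i) (std_J k (std_J k (e j))) = 0"
    "b (std_J k (e i)) (std_J k (std_J k (e j))) = 0"
  using frame_orthogonal(1)[OF assms] frame_orthogonal(2)[OF assms] frame_orthogonal(2)[OF assms[symmetric]]
    b_commute[of "std_J k (e i)" "e j"] b_hermitian[of "e i" "e j"]
  by (simp_all add: std_J_e b_linear_simps del: scaleR_Pair)

lemma b_frame_same: "b (e i) (std_J k (e i)) = 0" "b (e i) (std_J k (std_J k (e i))) = sgn_of k * b (e i) (e i)"
  using b_J_swap[of "e i" "e i"] by (simp_all add: b_linear_simps del: scaleR_Pair)

lemma Basis_frame: "x \<in> Basis \<Longrightarrow> \<exists>i. x = e i \<or> x = std_J k (e i)"
  unfolding std_J_e[symmetric] by (auto simp: Basis_prod_def Basis_vec_def)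

text \<open>Evaluate \<open>F_wedge\<close> on frame vectors. With \<open>e l\<close> and its image
  under \<open>std_J\<close> as last arguments, \<open>l\<close> a third index, orthogonality leaves
  a single term and kills the entries of \<open>F\<close> between different indices. For two indices
  it shows that the ratios of \<open>F (e i) (std_J k (e i))\<close> to \<open>b (e i) (e i)\<close>
  are opposite; three pairwise opposite numbers are zero.\<close>

lemma F_eq_0:
  assumes "CARD('k) \<ge> 3"
  shows "F = (\<lambda>x y. 0)"
proof -
  have third: "\<exists>l. l \<noteq> i \<and> l \<noteq> j" for i j :: 'k
  proof (rule ccontr)
    assume "\<not> ?thesis"
    then have "(UNIV :: 'k set) \<subseteq> {i, j}"
      by auto
    then have "CARD('k) \<le> card {i, j}"
      by (intro card_mono) auto
    then show False
      using assms card_insert_le_m1[of 2 "{j}" i] by simp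
  qed
  have nz: "sgn_of k * b (e l) (e l) \<noteq> 0" for l
    using frame_nonnull by (cases k) auto
  have off: "F x y = 0" if "i \<noteq> j" "x = e i \<or> x = std_J k (e i)" "y = e j \<or> y = std_J k (e j)" for i j x y
  proof -
    obtain l where l: "l \<noteq> i" "l \<noteq> j"
      using third by blast
    have "F x y * b (e l) (std_J k (std_J k (e l))) = 0"
      using F_wedge[of x y "e l" "std_J k (e l)"] that(2,3)
      by (elim disjE) (simp_all only: b_frame[OF l(1)[symmetric]] b_frame[OF l(2)[symmetric]] b_frame[OF that(1)]
          mult_zero_right add_0_right diff_zero)
    then show ?thesis
      using nz[of l] by (simp only: b_frame_same) simp
  qed
  have opposite: "F (e i) (std_J k (e i)) / b (e i) (e i) = - (F (e l) (std_J k (e l)) / b (e l) (e l))"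
    if "i \<noteq> l" for i l
  proof -
    have "F (e i) (std_J k (e i)) * (sgn_of k * b (e l) (e l))
        + F (e l) (std_J k (e l)) * (sgn_of k * b (e i) (e i)) = 0"
      using F_wedge[of "e i" "std_J k (e i)" "e l" "std_J k (e l)"]
      by (simp only: b_frame[OF that] b_frame[OF that[symmetric]] b_frame_same mult_zero_right add_0_right diff_zero)
    then have "sgn_of k * (F (e i) (std_J k (e i)) * b (e l) (e l) + F (e l) (std_J k (e l)) * b (e i) (e i)) = 0"
      by (simp add: algebra_simps)
    then have "F (e i) (std_J k (e i)) * b (e l) (e l) + F (e l) (std_J k (e l)) * b (e i) (e i) = 0"
      using nz[of i] by simp
    then show ?thesis
      using frame_nonnull[of i] frame_nonnull[of l] by (simp add: field_simps)
  qed
  have diag: "F (e i) (std_J k (e i)) = 0" for i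
  proof -
    obtain j where j: "j \<noteq> i"
      using third by blast
    obtain l where l: "l \<noteq> i" "l \<noteq> j"
      using third by blast
    have "F (e i) (std_J k (e i)) / b (e i) (e i) = 0"
      using opposite[OF j] opposite[OF l(1)] opposite[OF l(2)] by simp
    then show ?thesis
      using nz[of i] by simp
  qed
  have "F x y = 0" if xy: "x \<in> Basis" "y \<in> Basis" for x y
  proof -
    obtain i where i: "x = e i \<or> x = std_J k (e i)"
      using Basis_frame[OF xy(1)] by blast
    obtain j where j: "y = e j \<or> y = std_J k (e j)"
      using Basis_frame[OF xy(2)] by blast
    show ?thesis
    proof (cases "i = j")
      case True
      have "F z z = 0" for z
        using F_swap[of z z] by simp
      moreover have "F (std_J k (e i)) (e i) = 0"
        using F_swap[of "std_J k (e i)" "e i"] diag by simp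
      ultimately show ?thesis
        using i j diag[of i] unfolding True by (elim disjE) simp_all
    next
      case False
      then show ?thesis
        using off i j by blast
    qed
  qed
  moreover have "bilinear F" "bilinear (\<lambda>x y. 0 :: real)"
    using bounded_bilinear_F by (simp_all add: bilinear_conv_bounded_bilinear[symmetric] bilinear_def linear_zero)
  ultimately show ?thesis
    using bilinear_eq_stdbasis[of F "\<lambda>x y. 0"] by blast
qed

lemma open_metric_nondegenerate: "open {p. \<forall>v. (\<forall>w. metric p v w = 0) \<longrightarrow> v = 0}"
  by (rule open_nondegenerate[OF bij_betw_basis_vector bilinear_metric smooth_metric[OF open_UNIV]])

lemma metric_nondegenerate_0: "0 \<in> {p. \<forall>v. (\<forall>w. metric p v w = 0) \<longrightarrow> v = 0}"
  unfolding mem_Collect_eq metric_0 using b_nondegenerate by (intro allI impI) metis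

lemma second_order_chart_F_0:
  assumes "F = (\<lambda>x y. 0)"
  shows "second_order_chart k b A F {p. \<forall>v. (\<forall>w. metric p v w = 0) \<longrightarrow> v = 0} (\<lambda>p v. 0)"
proof
  show "0 \<in> {p. \<forall>v. (\<forall>w. metric p v w = 0) \<longrightarrow> v = 0}"
    by (rule metric_nondegenerate_0)
qed (use open_metric_nondegenerate assms in auto)

definition kform where "kform p v w = metric p v (std_J k w)"

lemma kform_swap: "kform p v w = - kform p w v"
proof -
  have "metric p (std_J k v) (std_J k (std_J k w)) = - sgn_of k * metric p v (std_J k w)"
    by (rule metric_hermitian)
  then have "sgn_of k * metric p (std_J k v) w = - sgn_of k * metric p v (std_J k w)"
    by (simp add: bilinear_rmul[OF bilinear_metric])
  then have "metric p (std_J k v) w = - metric p v (std_J k w)"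
    by (cases k) simp_all
  then show ?thesis
    using metric_commute[of p "std_J k v" w] by (simp add: kform_def)
qed

lemma bilinear_kform: "bilinear (kform p)"
  unfolding bilinear_def kform_def
  by (intro conjI allI linearI) (simp_all add: J_linear_simps bilinear_ladd[OF bilinear_metric]
      bilinear_lmul[OF bilinear_metric] bilinear_radd[OF bilinear_metric] bilinear_rmul[OF bilinear_metric])

lemma smooth_kform: "open S \<Longrightarrow> smooth_on S (\<lambda>p. kform p v w)"
  unfolding kform_def by (rule smooth_metric)

lemma frame_span:
  assumes "UNIV = {i, j}" "i \<noteq> j"
  shows "\<exists>a0 a1 a2 a3. v = a0 *\<^sub>R e i + a1 *\<^sub>R std_J k (e i) + a2 *\<^sub>R e j + a3 *\<^sub>R std_J k (e j)"
proof -
  have "l = i \<or> l = j" for l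
    using assms by auto
  then have "v = (fst v $ i) *\<^sub>R e i + (snd v $ i) *\<^sub>R std_J k (e i) + (fst v $ j) *\<^sub>R e j
      + (snd v $ j) *\<^sub>R std_J k (e j)"
    using assms(2) by (auto simp: std_J_def prod_eq_iff vec_eq_iff axis_def)
  then show ?thesis by blast
qed

text \<open>In dimension four the Lee form is determined by the metric: as the Kaehler form \<open>\<Omega>\<close> satisfies
  \<open>d\<Omega> = - F(p, -) \<and> \<Omega>\<^sub>0\<close>, one solves \<open>2 \<phi> \<and> \<Omega> = F(p, -) \<and> \<Omega>\<^sub>0\<close> by contracting the proportionality
  of the 4-forms \<open>\<Omega> \<and> \<Omega>\<^sub>0\<close> and \<open>\<Omega> \<and> \<Omega>\<close>.\<close>

lemma second_order_chart_dim4: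
  fixes i j :: 'k
  assumes ij: "UNIV = {i, j}" "i \<noteq> j"
  shows "\<exists>U \<phi>. second_order_chart k b A F U \<phi>"
proof -
  define W where "W P Q = wedge P Q (e i) (std_J k (e i)) (e j) (std_J k (e j))"
    for P Q :: "(real ^ 'k) \<times> (real ^ 'k) \<Rightarrow> (real ^ 'k) \<times> (real ^ 'k) \<Rightarrow> real"
  define U where "U = {p. \<forall>v. (\<forall>w. metric p v w = 0) \<longrightarrow> v = 0} \<inter> {p. W (kform p) (kform p) \<noteq> 0}"
  \<comment> \<open>\<open>N p\<close> is \<open>b\<close> followed by the inverse of the metric,
    the identity at the origin. Half of \<open>l p\<close> is the ratio of \<Omega> \<and>
    \<open>\<Omega>\<^sub>0\<close> to \<Omega> \<and> \<Omega>.\<close>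
  define N where "N p u = (THE z. \<forall>w. metric p z w = b u w)" for p u
  define l where "l p = 2 * W (kform p) (kform 0) / W (kform p) (kform p)" for p
  define \<phi> where "\<phi> p u = (l p * F p u - F p (N p u)) / 2" for p u
  have smooth_W: "smooth_on S (\<lambda>p. W (kform p) (kform p))" "smooth_on S (\<lambda>p. W (kform p) (kform 0))" if "open S" for S
    unfolding W_def wedge_def
    by (intro smooth_on_add[OF that] smooth_on_diff[OF that] smooth_on_mult[OF that] smooth_kform[OF that]
        smooth_on_const)+
  have open_U: "open U"
    unfolding U_def using smooth_on_imp_continuous_on[OF smooth_W(1)[OF open_UNIV]]
    by (intro open_Int open_metric_nondegenerate open_Collect_neq continuous_on_const)
  have "W (kform 0) (kform 0) = 2 * ((sgn_of k * b (e i) (e i)) * (sgn_of k * b (e j) (e j)))"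
    unfolding W_def wedge_def kform_def metric_0 b_frame[OF ij(2)] b_frame_same by simp
  also have "\<dots> \<noteq> 0"
    using frame_nonnull by (cases k) simp_all
  finally have W0: "W (kform 0) (kform 0) \<noteq> 0" .
  have origin: "0 \<in> U"
    using metric_nondegenerate_0 W0 unfolding U_def by blast
  have nondeg: "v = 0" if "p \<in> U" "\<And>w. metric p v w = 0" for p v
    using that unfolding U_def by blast
  have W: "W (kform p) (kform p) \<noteq> 0" if "p \<in> U" for p
    using that unfolding U_def by blast
  have ex1: "\<exists>!z. \<forall>w. metric p z w = \<kappa> w" if "p \<in> U" "linear \<kappa>" for p \<kappa>
    by (rule nondegenerate_riesz[OF bilinear_metric nondeg[OF that(1)] that(2)])
  have N: "metric p (N p u) w = b u w" if "p \<in> U" for p u w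
    using theI'[OF ex1[OF that linear_b[of u]]] unfolding N_def by blast
  have eqI: "v = v'" if "p \<in> U" "\<And>w. metric p v w = metric p v' w" for p v v'
    using nondeg[OF that(1), of "v - v'"] that(2) by (simp add: bilinear_lsub[OF bilinear_metric])
  have linear_N: "linear (N p)" if "p \<in> U" for p
    by (intro linearI eqI[OF that])
      (simp_all add: N[OF that] bilinear_ladd[OF bilinear_metric] bilinear_lmul[OF bilinear_metric] b_linear_simps)
  have N0: "N 0 u = u" for u
    by (rule eqI[OF origin]) (simp add: N[OF origin], simp add: metric_0)
  have smooth_N: "smooth_on U (\<lambda>p. N p u)" for u
    by (rule smooth_on_bilinear_solution[OF bij_betw_basis_vector open_U bilinear_metric smooth_metric[OF open_U]
          nondeg smooth_on_const N])
  have smooth_l: "smooth_on U l"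
    unfolding l_def using W
    by (intro smooth_on_divide[OF open_U] smooth_on_mult[OF open_U] smooth_on_const smooth_W[OF open_U]) auto
  have linear_\<phi>: "linear (\<phi> p)" if "p \<in> U" for p
    by (rule linearI) (simp_all add: \<phi>_def linear_add[OF linear_N[OF that]] linear_scale[OF linear_N[OF that]]
          F_linear_simps algebra_simps add_divide_distrib diff_divide_distrib)
  have "second_order_chart k b A F U \<phi>"
  proof
    show "smooth_on U (\<lambda>p. \<phi> p u)" for u
      unfolding \<phi>_def
      by (intro smooth_on_divide[OF open_U] smooth_on_diff[OF open_U] smooth_on_mult[OF open_U] smooth_l
          smooth_on_bilinear[OF open_U bounded_bilinear_F] smooth_on_id[OF open_U] smooth_N smooth_on_const) auto
    show "\<phi> 0 = (\<lambda>u. 0)"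
      using F_linear_simps(2)[of 0] by (simp add: \<phi>_def fun_eq_iff)
    show "((\<lambda>q. \<phi> q u) has_derivative (\<lambda>x. F x u / 2)) (at 0)" for u
    proof -
      have "((\<lambda>q. F q u) has_derivative (\<lambda>x. F x u)) (at 0)"
        using bounded_bilinear.bounded_linear_left[OF bounded_bilinear_F] by (rule bounded_linear_imp_has_derivative)
      then have "((\<lambda>q. \<phi> q u) has_derivative (\<lambda>x.
          ((l 0 * F x u + frechet_derivative l (at 0) x * F 0 u)
            - (F 0 (frechet_derivative (\<lambda>q. N q u) (at 0) x) + F x (N 0 u))) / 2)) (at 0)"
        unfolding \<phi>_def
        by (intro bounded_linear.has_derivative[OF bounded_linear_divide] has_derivative_diff has_derivative_mult
            bounded_bilinear.FDERIV[OF bounded_bilinear_F] has_derivative_ident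
            smooth_on_has_derivative[OF smooth_N origin] smooth_on_has_derivative[OF smooth_l origin])
      \<comment> \<open>The derivatives of \<open>l\<close> and \<open>N\<close> are multiplied by
        values of \<open>F 0\<close>, which is zero. As \<open>N 0\<close> is the identity, what
        remains is \<open>(2 * F x u - F x u) / 2\<close>.\<close>
      moreover have "l 0 = 2"
        using W0 by (simp add: l_def)
      ultimately show ?thesis
        using F_linear_simps(2)[of 0] by (simp add: N0)
    qed
    show "2 * \<phi> p u * metric p v (std_J k w) + 2 * \<phi> p v * metric p w (std_J k u)
        + 2 * \<phi> p w * metric p u (std_J k v)
      = F p u * b v (std_J k w) + F p v * b w (std_J k u) + F p w * b u (std_J k v)"
      if p: "p \<in> U" for p u v w
    proof -
      have two_\<phi>: "2 * \<phi> p z = l p * F p z - F p (N p z)" for z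
        by (simp add: \<phi>_def)
      have "linear (\<lambda>z. sgn_of k * F p (std_J k z))"
        by (rule linearI) (simp_all add: J_linear_simps F_linear_simps algebra_simps)
      \<comment> \<open>\<open>X\<close> is the vector whose contraction with \<Omega> is
        \<open>F p\<close>. Its contraction with \<open>\<Omega>\<^sub>0\<close> is
        \<open>F p (N p z)\<close>, the origin of the second term of \<phi>; the first comes from
        contracting \<Omega> \<and> \<Omega>.\<close>
      then obtain X where X: "metric p X z = sgn_of k * F p (std_J k z)" for z
        using ex1[OF p] by blast
      have 1: "kform p X z = F p z" for z
        by (simp add: kform_def X F_linear_simps)
      have 2: "kform 0 X z = F p (N p z)" for z
      proof -
        have "F p (N p z) = - metric p (N p z) (std_J k X)"
          using kform_swap[of p X "N p z"] unfolding 1 unfolding kform_def .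
        then show ?thesis
          using b_J_swap[of X z] by (simp add: N[OF p] kform_def metric_0)
      qed
      have "wedge (kform p) (kform 0) X u v w * W (kform p) (kform p)
          = wedge (kform p) (kform p) X u v w * W (kform p) (kform 0)"
        unfolding W_def
        by (rule wedge_proportional4[OF bilinear_kform kform_swap bilinear_kform kform_swap frame_span[OF ij]])
      then have "wedge (kform p) (kform 0) X u v w = wedge (kform p) (kform p) X u v w * (l p / 2)"
        using W[OF p] by (simp add: l_def field_simps)
      then show ?thesis
        using kform_swap[of p u w] kform_swap[of 0 u w] unfolding wedge_def 1 2 two_\<phi>
        by (simp add: kform_def metric_0 algebra_simps)
    qed
  qed ((fact open_U origin nondeg) | simp add: linear_add[OF linear_\<phi>] linear_scale[OF linear_\<phi>])+
  then show ?thesis by blast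
qed

lemma second_order_chart_exists:
  assumes "CARD('k) \<ge> 2"
  shows "\<exists>U \<phi>. second_order_chart k b A F U \<phi>"
proof (cases "CARD('k) = 2")
  case True
  then obtain i j :: 'k where "UNIV = {i, j}" "i \<noteq> j"
    by (meson card_2_iff)
  then show ?thesis
    by (rule second_order_chart_dim4)
next
  case False
  then have "F = (\<lambda>x y. 0)"
    using assms by (intro F_eq_0) simp
  then show ?thesis
    using second_order_chart_F_0 by blast
qed

end

section \<open>Adapted orthogonal frames\<close>

lemma independent_orthogonal:
  fixes b :: "'v::real_vector \<Rightarrow> 'v \<Rightarrow> real"
  assumes lin: "\<And>x. linear (b x)"
    and orth: "\<And>x y. x \<in> T \<Longrightarrow> y \<in> T \<Longrightarrow> x \<noteq> y \<Longrightarrow> b x y = 0" "\<And>x. x \<in> T \<Longrightarrow> b x x \<noteq> 0"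
  shows "independent T"
proof
  assume "dependent T"
  then obtain t u v where t: "finite t" "t \<subseteq> T" "(\<Sum>x\<in>t. u x *\<^sub>R x) = 0" and v: "v \<in> t" "u v \<noteq> 0"
    unfolding dependent_explicit by blast
  have "0 = b v (\<Sum>x\<in>t. u x *\<^sub>R x)"
    by (simp add: t(3) linear_0[OF lin])
  also have "\<dots> = (\<Sum>x\<in>t. u x * b v x)"
    by (simp add: linear_sum[OF lin] linear_scale[OF lin])
  also have "\<dots> = (\<Sum>x\<in>{v}. u x * b v x)"
    using t v orth(1) by (intro sum.mono_neutral_right) auto
  finally show False
    using v t(2) orth(2)[of v] by auto
qed

locale hermitian_space =
  fixes k :: kind and b :: "'v::real_vector \<Rightarrow> 'v \<Rightarrow> real" and J :: "'v \<Rightarrow> 'v"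
  assumes linear_b: "\<And>x. linear (b x)" and b_commute: "\<And>x y. b x y = b y x"
    and b_nondegenerate: "\<And>x. (\<And>y. b x y = 0) \<Longrightarrow> x = 0"
    and linear_J: "linear J" and J_J: "\<And>x. J (J x) = sgn_of k *\<^sub>R x"
    and b_hermitian: "\<And>x y. b (J x) (J y) = - sgn_of k * b x y"
begin

text \<open>Half of an adapted basis: together with its image under \<open>J\<close>, such a set is
  orthogonal without null vectors. Orthogonality of \<open>x\<close> and \<open>J x\<close> is
  automatic, so only distinct pairs are constrained.\<close>

definition frame :: "'v set \<Rightarrow> bool"
  where "frame S \<longleftrightarrow> finite S \<and> (\<forall>x\<in>S. b x x \<noteq> 0) \<and> (\<forall>x\<in>S. \<forall>y\<in>S. x \<noteq> y \<longrightarrow> b x y = 0 \<and> b x (J y) = 0)"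

lemma b_linear_simps: "b x (y + z) = b x y + b x z" "b x (y - z) = b x y - b x z" "b x (r *\<^sub>R y) = r * b x y"
  "b (y + z) x = b y x + b z x" "b (y - z) x = b y x - b z x" "b (r *\<^sub>R y) x = r * b y x"
  using linear_add[OF linear_b] linear_diff[OF linear_b] linear_scale[OF linear_b] by (simp_all add: b_commute[of _ x])

lemma b_J_swap: "b x (J y) = - b y (J x)"
proof -
  have "sgn_of k * b (J x) y = - sgn_of k * b x (J y)"
    using b_hermitian[of x "J y"] by (simp add: J_J b_linear_simps)
  then have "b (J x) y = - b x (J y)"
    by (cases k) simp_all
  then show ?thesis
    using b_commute[of "J x" y] by simp
qed

lemma b_J_self: "b x (J x) = 0"
  using b_J_swap[of x x] by simp

lemma frame_union:
  assumes "frame S"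
  shows "\<And>x y. x \<in> S \<union> J ` S \<Longrightarrow> y \<in> S \<union> J ` S \<Longrightarrow> x \<noteq> y \<Longrightarrow> b x y = 0"
    and "\<And>x. x \<in> S \<union> J ` S \<Longrightarrow> b x x \<noteq> 0"
    and "card (S \<union> J ` S) = 2 * card S"
proof -
  have orth: "b x y = 0" "b x (J y) = 0" if "x \<in> S" "y \<in> S" "x \<noteq> y" for x y
    using assms that by (auto simp: frame_def)
  have orth': "b x y = 0" if "x \<in> S" "y \<in> S" "J x \<noteq> J y" for x y
    using orth(1)[of x y] that by auto
  have J0: "b x (J y) = 0" if "x \<in> S" "y \<in> S" for x y
    using orth(2)[OF that] b_J_self by metis
  then have J0': "b (J x) y = 0" if "x \<in> S" "y \<in> S" for x y
    using that b_commute by metis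
  show "b x y = 0" if "x \<in> S \<union> J ` S" "y \<in> S \<union> J ` S" "x \<noteq> y" for x y
    using that by (auto simp: orth orth' J0 J0' b_hermitian)
  show nn: "b x x \<noteq> 0" if "x \<in> S \<union> J ` S" for x
    using that assms by (cases k) (auto simp: frame_def b_hermitian)
  have "inj J"
    using J_J by (intro inj_on_inverseI[where g = "\<lambda>x. sgn_of k *\<^sub>R J x"]) simp
  then have "card (J ` S) = card S"
    by (simp add: card_image inj_on_subset)
  moreover have "S \<inter> J ` S = {}"
    using J0 nn by auto
  ultimately show "card (S \<union> J ` S) = 2 * card S"
    using assms by (simp add: card_Un_disjoint frame_def)
qed

lemma independent_frame: "frame S \<Longrightarrow> independent (S \<union> J ` S)"
  by (rule independent_orthogonal[where b = b, OF linear_b frame_union(1,2)])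

text \<open>In indefinite signature the component of \<open>x\<close> orthogonal to the frame may be
  null, so another vector may have to be taken. If all vectors orthogonal to the frame were null,
  polarization would make \<open>b\<close> vanish on the orthogonal complement, and
  \<open>x - P x\<close> would be orthogonal to everything, hence zero.\<close>

lemma frame_extend:
  assumes S: "frame S" and x: "x \<notin> span (S \<union> J ` S)"
  shows "\<exists>w. w \<notin> S \<and> frame (insert w S)"
proof -
  let ?T = "S \<union> J ` S"
  define P where "P y = (\<Sum>t\<in>?T. (b y t / b t t) *\<^sub>R t)" for y
  have fin: "finite ?T"
    using S by (simp add: frame_def)
  have P: "b (y - P y) t = 0" if "t \<in> ?T" for y t
  proof -
    have "b t (P y) = (\<Sum>s\<in>?T. b y s / b s s * b t s)"
      by (simp add: P_def linear_sum[OF linear_b] linear_scale[OF linear_b])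
    also have "\<dots> = (\<Sum>s\<in>{t}. b y s / b s s * b t s)"
      using fin that frame_union(1)[OF S that] by (intro sum.mono_neutral_right) auto
    also have "\<dots> = b y t"
      using frame_union(2)[OF S that] by simp
    finally have "b t (y - P y) = 0"
      using b_commute[of t y] by (simp add: b_linear_simps(2))
    then show ?thesis
      using b_commute[of t "y - P y"] by simp
  qed
  have P_span: "P y \<in> span ?T" for y
    unfolding P_def by (intro span_sum span_scale span_base)
  have "\<exists>w. (\<forall>t\<in>?T. b w t = 0) \<and> b w w \<noteq> 0"
  proof (rule ccontr)
    assume "\<not> ?thesis"
    then have null: "b w w = 0" if "\<forall>t\<in>?T. b w t = 0" for w
      using that by blast
    have "b (x - P x) y = 0" for y
    proof -
      have "b (x - P x) (P y) = 0"
        using P[of _ x] by (simp add: P_def[of y] linear_sum[OF linear_b] linear_scale[OF linear_b])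
      moreover have "b (x - P x) (y - P y) = 0"
      proof -
        have "b (x - P x + (y - P y)) (x - P x + (y - P y)) = 0"
          by (intro null ballI) (simp add: b_linear_simps(4) P)
        moreover have "b (x - P x) (x - P x) = 0" "b (y - P y) (y - P y) = 0"
          by (intro null ballI P; assumption)+
        ultimately show ?thesis
          using b_commute[of "y - P y" "x - P x"] by (simp only: b_linear_simps(1,4))
      qed
      ultimately show ?thesis
        by (simp add: b_linear_simps(2)[of _ y])
    qed
    then have "x = P x"
      using b_nondegenerate[of "x - P x"] by simp
    then show False
      using x P_span by metis
  qed
  then obtain w where w: "\<forall>t\<in>?T. b w t = 0" "b w w \<noteq> 0"
    by blast
  have "b y w = 0" "b w y = 0" "b w (J y) = 0" "b y (J w) = 0" if "y \<in> S" for y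
    using w(1) that b_commute[of y w] b_J_swap[of y w] by auto
  then have "frame (insert w S)"
    using S w(2) by (auto simp: frame_def)
  then show ?thesis
    using w by blast
qed

lemma frame_exists:
  fixes B :: "'v set"
  assumes B: "finite B" "independent B" "span B = UNIV" and n: "2 * n \<le> card B"
  shows "\<exists>S. frame S \<and> card S = n"
  using n
proof (induction n)
  case 0
  have "frame {}"
    by (simp add: frame_def)
  then show ?case
    using card.empty by blast
next
  case (Suc n)
  then obtain S where S: "frame S" "card S = n"
    by auto
  have "span (S \<union> J ` S) \<noteq> UNIV"
  proof
    assume "span (S \<union> J ` S) = UNIV"
    then have "card B \<le> card (S \<union> J ` S)"
      using independent_span_bound[of "S \<union> J ` S" B] B(2) S(1) by (simp add: frame_def)
    then show False
      using frame_union(3)[OF S(1)] S(2) Suc.prems by simp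
  qed
  then obtain w where "w \<notin> S" "frame (insert w S)"
    using frame_extend[OF S(1)] by blast
  then show ?case
    using S by (intro exI[of _ "insert w S"]) (simp add: frame_def)
qed

lemma frame_spans:
  fixes B :: "'v set"
  assumes B: "finite B" "span B = UNIV" and S: "frame S" "2 * card S = card B"
  shows "span (S \<union> J ` S) = UNIV"
proof (rule ccontr)
  assume "\<not> ?thesis"
  then obtain x where x: "x \<notin> span (S \<union> J ` S)"
    by blast
  then have "independent (insert x (S \<union> J ` S))"
    using independent_insertI independent_frame[OF S(1)] by blast
  then have "card (insert x (S \<union> J ` S)) \<le> card B"
    using independent_span_bound[OF B(1)] B(2) by blast
  moreover have "x \<notin> S \<union> J ` S"
    using x by (rule contrapos_nn) (rule span_base)
  ultimately show False
    using frame_union(3)[OF S(1)] S by (simp add: frame_def)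
qed

lemma frame_coordinates:
  fixes B :: "'v set"
  assumes B: "finite B" "independent B" "span B = UNIV" "card B = 2 * CARD('k::finite)"
  shows "\<exists>\<Psi> :: (real ^ 'k) \<times> (real ^ 'k) \<Rightarrow> 'v. linear \<Psi> \<and> bij \<Psi> \<and> (\<forall>x. \<Psi> (std_J k x) = J (\<Psi> x)) \<and>
    (\<forall>i. b (\<Psi> (axis i 1, 0)) (\<Psi> (axis i 1, 0)) \<noteq> 0) \<and>
    (\<forall>i j. i \<noteq> j \<longrightarrow> b (\<Psi> (axis i 1, 0)) (\<Psi> (axis j 1, 0)) = 0 \<and> b (\<Psi> (axis i 1, 0)) (\<Psi> (0, axis j 1)) = 0)"
proof -
  obtain S where S: "frame S" "card S = CARD('k)"
    using frame_exists[OF B(1-3), of "CARD('k)"] B(4) by auto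
  then obtain e where e: "bij_betw e (UNIV :: 'k set) S"
    using finite_same_card_bij[of "UNIV :: 'k set" S] by (auto simp: frame_def)
  then have eS: "e i \<in> S" and inj: "e i = e j \<longleftrightarrow> i = j" for i j
    by (auto simp: bij_betw_def inj_on_def)
  have nonnull: "b (e i) (e i) \<noteq> 0" for i
    using S(1) eS by (auto simp: frame_def)
  have orth: "b (e i) (e j) = 0" "b (e i) (J (e j)) = 0" if "i \<noteq> j" for i j
    using S(1) eS inj that unfolding frame_def by blast+
  define \<Psi> :: "(real ^ 'k) \<times> (real ^ 'k) \<Rightarrow> 'v"
    where "\<Psi> x = (\<Sum>i\<in>UNIV. (fst x $ i) *\<^sub>R e i + (snd x $ i) *\<^sub>R J (e i))" for x
  have lin: "linear \<Psi>"
    by (rule linearI) (simp_all add: \<Psi>_def scaleR_add_left sum.distrib scaleR_sum_right scaleR_add_right algebra_simps)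
  have \<Psi>J: "\<Psi> (std_J k x) = J (\<Psi> x)" for x
    by (simp add: \<Psi>_def std_J_def linear_sum[OF linear_J] linear_add[OF linear_J] linear_scale[OF linear_J]
        J_J case_prod_beta add.commute mult.commute)
  have axis_simps: "\<Psi> (axis i 1, 0) = e i" "\<Psi> (0, axis i 1) = J (e i)" for i
    by (simp_all add: \<Psi>_def axis_def if_distrib[of "\<lambda>r. r *\<^sub>R _"] cong: if_cong)
  have "S \<union> J ` S \<subseteq> range \<Psi>"
    using e axis_simps by (metis (no_types, lifting) Un_least bij_betw_def image_subsetI rangeI rangeE subsetI)
  then have "span (S \<union> J ` S) \<subseteq> range \<Psi>"
    using linear_subspace_image[OF lin subspace_UNIV] by (rule span_minimal)
  then have "surj \<Psi>"
    using frame_spans[OF B(1,3) S(1)] S(2) B(4) by auto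
  moreover have "inj \<Psi>"
  proof -
    have first: "fst x $ i * b (e i) (e i) = b (e i) (\<Psi> x)" for x i
    proof -
      have "b (e i) (\<Psi> x) = (\<Sum>j\<in>UNIV. fst x $ j * b (e i) (e j) + snd x $ j * b (e i) (J (e j)))"
        by (simp add: \<Psi>_def linear_sum[OF linear_b] b_linear_simps)
      also have "\<dots> = (\<Sum>j\<in>{i}. fst x $ j * b (e i) (e j) + snd x $ j * b (e i) (J (e j)))"
        using orth by (intro sum.mono_neutral_right) auto
      finally show ?thesis
        by (simp add: b_J_self)
    qed
    have fst_0: "fst x = 0" if "\<Psi> x = 0" for x
      using first[of x] nonnull that by (simp add: vec_eq_iff linear_0[OF linear_b])
    have "x = 0" if "\<Psi> x = 0" for x
    proof -
      \<comment> \<open>Up to sign, \<open>std_J\<close> moves the second block of coordinates into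
        the first, so pairing with the frame vectors detects that block as well.\<close>
      have "fst (std_J k x) = 0"
        using that by (intro fst_0) (simp add: \<Psi>J linear_0[OF linear_J])
      then have "snd x = 0"
        by (cases k) (simp_all add: std_J_def case_prod_beta)
      then show ?thesis
        using fst_0[OF that] by (simp add: prod_eq_iff)
    qed
    then show ?thesis
      using linear_injective_0[OF lin] by blast
  qed
  ultimately show ?thesis
    using lin \<Psi>J nonnull orth by (intro exI[of _ \<Psi>]) (simp add: bij_def axis_simps)
qed

end

section \<open>Transport of a curvature model to coordinates\<close>

lemma linear_on_UNIV: "linear_on UNIV f \<longleftrightarrow> linear f"
  by (auto simp: linear_on_def linear_iff)

text \<open>\<open>F\<close> is read off from \<open>A\<close> at one pair with
  \<open>b z0 w0\<close> nonzero instead of from the Ricci trace. It then inherits linearity and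
  antisymmetry from \<open>A\<close>, and the trace only has to be independent of that pair.\<close>

lemma kaehler_weyl_model_algebra:
  fixes b :: "'v::real_vector \<Rightarrow> 'v \<Rightarrow> real"
  assumes model: "kaehler_weyl_model k b J A" and nontrivial: "\<exists>x :: 'v. x \<noteq> 0"
  shows "hermitian_space k b J" "\<exists>F. kaehler_weyl_algebra k b J A F"
proof -
  have b: "linear (b x)" "b x y = b y x" "(\<And>y. b x y = 0) \<Longrightarrow> x = 0" for x y
    using model by (auto simp: kaehler_weyl_model_def inner_product_on_def linear_on_UNIV)
  have J: "linear J" "J (J x) = sgn_of k *\<^sub>R x" "b (J x) (J y) = - sgn_of k * b x y" for x y
    using model by (auto simp: kaehler_weyl_model_def complex_structure_on_def endomorphism_on_def
        linear_on_UNIV hermitian_on_def)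
  have A_K: "multilinear4 A" "\<forall>x y z w. A x y z w = - sgn_of k * A x y (J z) (J w)"
    using model unfolding kaehler_weyl_model_def kaehler_tensors_def by blast+
  have A_W: "A x y z w + A y x z w = 0" "A x y z w + A y z x w + A z x y w = 0"
    "A x y z w + A x y w z = - (4 / real (dim (UNIV :: 'v set))) * ricci_alt b A x y * b z w" for x y z w
    using model unfolding kaehler_weyl_model_def weyl_tensors_def by blast+
  show "hermitian_space k b J"
    by unfold_locales (use b J linear_add[OF J(1)] linear_scale[OF J(1)] linear_add[OF b(1)] linear_scale[OF b(1)] in auto)
  obtain z0 w0 where zw: "b z0 w0 \<noteq> 0"
    using nontrivial b(3) by blast
  define F where "F x y = (A x y z0 w0 + A x y w0 z0) / (2 * b z0 w0)" for x y
  have A_linear: "linear (\<lambda>y. A x y z w)" for x z w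
    using A_K(1) by (simp add: multilinear4_def)
  have linear_F: "linear (F x)" for x
    unfolding F_def
    by (rule linearI) (simp_all add: linear_add[OF A_linear] linear_scale[OF A_linear] algebra_simps add_divide_distrib)
  have F_swap: "F x y = - F y x" for x y
    using A_W(1)[of x y z0 w0] A_W(1)[of x y w0 z0] by (simp add: F_def eq_neg_iff_add_eq_0 add_divide_distrib[symmetric])
  have A_trace: "A x y z w + A x y w z = 2 * F x y * b z w" for x y z w
    unfolding F_def A_W(3) using zw by (simp add: b(2)[of w0 z0])
  have A_J: "A x y (J z) (J w) = - sgn_of k * A x y z w" for x y z w
    using A_K(2)[rule_format, of x y z w] by (simp add: mult.assoc[symmetric])
  have A_swap: "A x y z w = - A y x z w" for x y z w
    using A_W(1)[of x y z w] by simp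
  have "kaehler_weyl_algebra k b J A F"
    by (rule kaehler_weyl_algebra.intro[OF b(1,2) J linear_F F_swap A_K(1) A_swap A_W(2) A_trace A_J])
  then show "\<exists>F. kaehler_weyl_algebra k b J A F"
    by (rule exI[where x = F])
qed

lemma kaehler_weyl_algebra_transport:
  assumes "kaehler_weyl_algebra k b J A F" "linear \<Psi>" "inj \<Psi>" "linear J'" "\<And>x. \<Psi> (J' x) = J (\<Psi> x)"
  shows "kaehler_weyl_algebra k (\<lambda>x y. b (\<Psi> x) (\<Psi> y)) J' (\<lambda>x y z w. A (\<Psi> x) (\<Psi> y) (\<Psi> z) (\<Psi> w))
    (\<lambda>x y. F (\<Psi> x) (\<Psi> y))"
proof -
  interpret kaehler_weyl_algebra k b J A F by fact
  have lin: "linear (\<lambda>x. f (\<Psi> x))" if "linear f" for f :: "'a \<Rightarrow> real"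
    using linear_compose[OF assms(2) that] by (simp add: o_def)
  have "J' (J' x) = sgn_of k *\<^sub>R x" for x
    using J_J[of "\<Psi> x"] assms(3) by (intro injD[OF assms(3)]) (simp add: assms(5) linear_scale[OF assms(2)])
  then show ?thesis
    using lin linear_b linear_F assms(4) A_linear
    by (intro kaehler_weyl_algebra.intro)
      (auto simp: assms(5) multilinear4_def intro: lin b_commute F_swap A_swap A_bianchi A_trace
        simp: A_J b_hermitian)
qed

theorem theorem1p5:
  fixes k :: kind
    and b :: "'v::real_vector \<Rightarrow> 'v \<Rightarrow> real"
    and J :: "'v \<Rightarrow> 'v"
    and A :: "'v tensor4"
    and m :: nat
  assumes "dim (UNIV :: 'v set) = m" and "even m" and "m \<ge> 4"
    and "DIM((real ^ 'k::finite) \<times> (real ^ 'k)) = m"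
    and "kaehler_weyl_model k b J A"
  shows "\<exists>(M :: ((real ^ 'k) \<times> (real ^ 'k), (real ^ 'k) \<times> (real ^ 'k)) mfd) g JM D P \<Phi>.
    kaehler_weyl_manifold k M g JM D \<and>
    P \<in> pts M \<and>
    linear \<Phi> \<and> bij_betw \<Phi> UNIV (tangent_space M P) \<and>
    (\<forall>x y. g P (\<Phi> x) (\<Phi> y) = b x y) \<and>
    (\<forall>x. JM P (\<Phi> x) = \<Phi> (J x)) \<and>
    (\<forall>x y z w. curvature_tensor M g D P (\<Phi> x) (\<Phi> y) (\<Phi> z) (\<Phi> w) = A x y z w)"
proof -
  have card: "m = 2 * CARD('k)"
    using assms(4) by simp
  obtain B :: "'v set" where B: "independent B" "UNIV \<subseteq> span B" "card B = m"
    using basis_exists[of "UNIV :: 'v set"] assms(1) by metis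
  \<comment> \<open>Infinite sets have cardinality 0, so a positive \<open>m\<close> makes
    \<open>B\<close> finite.\<close>
  have B': "finite B" "span B = UNIV" "card B = 2 * CARD('k)"
    using B assms(3) card card_gt_0_iff[of B] by auto
  have "\<exists>x :: 'v. x \<noteq> 0"
  proof (rule ccontr)
    assume "\<not> ?thesis"
    then have "B \<subseteq> {0}"
      by auto
    then have "card B \<le> 1"
      using card_mono[of "{0}" B] by simp
    then show False
      using B(3) assms(3) by simp
  qed
  note alg = kaehler_weyl_model_algebra[OF assms(5) this]
  interpret hermitian_space k b J
    by (rule alg(1))
  obtain F where F: "kaehler_weyl_algebra k b J A F"
    using alg(2) ..
  obtain \<Psi> :: "(real ^ 'k) \<times> (real ^ 'k) \<Rightarrow> 'v" where \<Psi>: "linear \<Psi>" "bij \<Psi>" "\<And>x. \<Psi> (std_J k x) = J (\<Psi> x)"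
    "\<And>i. b (\<Psi> (axis i 1, 0)) (\<Psi> (axis i 1, 0)) \<noteq> 0"
    "\<And>i j. i \<noteq> j \<Longrightarrow> b (\<Psi> (axis i 1, 0)) (\<Psi> (axis j 1, 0)) = 0"
    "\<And>i j. i \<noteq> j \<Longrightarrow> b (\<Psi> (axis i 1, 0)) (\<Psi> (0, axis j 1)) = 0"
    using frame_coordinates[OF B'(1) B(1) B'(2,3)] by blast
  let ?b = "\<lambda>x y. b (\<Psi> x) (\<Psi> y)"
  let ?A = "\<lambda>x y z w. A (\<Psi> x) (\<Psi> y) (\<Psi> z) (\<Psi> w)"
  let ?F = "\<lambda>x y. F (\<Psi> x) (\<Psi> y)"
  have inv: "\<Psi> (inv \<Psi> x) = x" "inv \<Psi> (\<Psi> y) = y" for x y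
    using \<Psi>(2) by (simp_all add: bij_def surj_f_inv_f)
  \<comment> \<open>The model is pulled back along \<Psi>, which turns \<open>J\<close> into
    \<open>std_J\<close> and the chosen frame into coordinate vectors. The realization found there
    is composed with the inverse of \<Psi> at the end.\<close>
  interpret framed_model k ?b ?A ?F
  proof (intro framed_model.intro framed_model_axioms.intro euclidean_model.intro)
    show "kaehler_weyl_algebra k ?b (std_J k) ?A ?F"
      using kaehler_weyl_algebra_transport[OF F \<Psi>(1) bij_is_inj[OF \<Psi>(2)] linear_std_J \<Psi>(3)] .
    show "v = 0" if "\<And>w. ?b v w = 0" for v
    proof -
      have "\<Psi> v = 0"
        using that[of "inv \<Psi> _"] by (intro b_nondegenerate) (simp add: inv)
      then show ?thesis
        using inv(2)[of v] inv(2)[of 0] linear_0[OF \<Psi>(1)] by simp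
    qed
  qed (fact \<Psi>(4-6))+
  have "CARD('k) \<ge> 2"
    using card assms(3) by simp
  then obtain U \<phi> where "second_order_chart k ?b ?A ?F U \<phi>"
    using second_order_chart_exists by blast
  then interpret second_order_chart k ?b ?A ?F U \<phi> .
  obtain M :: "((real ^ 'k) \<times> (real ^ 'k), (real ^ 'k) \<times> (real ^ 'k)) mfd" and g JM D P \<Phi> where
    M: "kaehler_weyl_manifold k M g JM D" "P \<in> pts M" "linear \<Phi>" "bij_betw \<Phi> UNIV (tangent_space M P)"
      "\<And>x y. g P (\<Phi> x) (\<Phi> y) = ?b x y" "\<And>x. JM P (\<Phi> x) = \<Phi> (std_J k x)"
      "\<And>x y z w. curvature_tensor M g D P (\<Phi> x) (\<Phi> y) (\<Phi> z) (\<Phi> w) = ?A x y z w"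
    using realization by blast
  have J: "std_J k (inv \<Psi> x) = inv \<Psi> (J x)" for x
    using \<Psi>(3)[of "inv \<Psi> x"] inv by metis
  have "linear (inv \<Psi>)"
  proof (rule linearI)
    show "inv \<Psi> (x + y) = inv \<Psi> x + inv \<Psi> y" for x y
      using inv(2)[of "inv \<Psi> x + inv \<Psi> y"] by (simp add: linear_add[OF \<Psi>(1)] inv(1))
    show "inv \<Psi> (r *\<^sub>R x) = r *\<^sub>R inv \<Psi> x" for r x
      using inv(2)[of "r *\<^sub>R inv \<Psi> x"] by (simp add: linear_scale[OF \<Psi>(1)] inv(1))
  qed
  then have "linear (\<Phi> \<circ> inv \<Psi>)"
    using linear_compose M(3) by blast
  moreover have "bij_betw (\<Phi> \<circ> inv \<Psi>) UNIV (tangent_space M P)"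
    using bij_betw_trans[OF bij_imp_bij_inv[OF \<Psi>(2)] M(4)] .
  ultimately show ?thesis
    using M(1,2,5-7) J inv(1)
    by (intro exI[of _ M] exI[of _ g] exI[of _ JM] exI[of _ D] exI[of _ P] exI[of _ "\<Phi> \<circ> inv \<Psi>"]) simp
qed

end
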